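(* Let $\mathbb{K}$ be a commutative ring with unit and let $f:P\to Q$ be a morphism of operadic poset species, i.e. a morphism of poset species which commutes with the structure morphisms $a$ and with the morphisms $\varphi$ and $\psi$. Then the pullback morphisms $$f^*:h^\bullet(Q)\to h^\bullet(P),\qquad f^*:\check{h}^\bullet(Q)\to\check{h}^\bullet(P),\qquad f^*:\hat{h}^\bullet(Q)\to\hat{h}^\bullet(P)$$ are respectively a morphism of graded operads, and compatible morphisms of graded left operadic modules and of graded right operadic modules. In other words, the structures of a graded operad on $h^\bullet(P)$, of a left operadic module over $h^\bullet(P)$ on $\check{h}^\bullet(P)$, and of a right operadic module over $h^\bullet(P)$ on $\hat{h}^\bullet(P)$ are (contravariantly) functorial in the operadic poset species $P$.
   Context: Conventions. All posets are finite, all finite sets $S$ are non-empty. Graded $\mathbb{K}$-modules carry the Koszul sign symmetry. Operads are monoids for the composition of graded species $(F\circ G)(S)=\bigoplus_{\pi\in\Pi(S)}F(\pi)\otimes\bigotimes_{T\in\pi}G(T)$, and left/right modules are understood accordingly. Poset cohomology. Let $P$ be a poset, $\min P$, $\max P$ its sets of minimal and maximal elements. Let $C^n(P)$ be the free $\mathbb{K}$-module on symbols $[x_0<\cdots<x_n]$ for chains in $P$, with differential $d[x_0<\cdots<x_n]=\sum_{y<x_0}[y<x_0<\cdots<x_n]+\sum_{i=1}^n(-1)^i\sum_{x_{i-1}<y<x_i}[\cdots<x_{i-1}<y<x_i<\cdots]+(-1)^{n+1}\sum_{y>x_n}[x_0<\cdots<x_n<y]$. The subcomplexes $c^\bullet$,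 $\check{c}^\bullet$, $\hat{c}^\bullet$ are spanned by the chains with respectively ($x_0\in\min P$ and $x_n\in\max P$), ($x_0\in\min P$), ($x_n\in\max P$); their cohomologies are $h^\bullet(P)$, $\check{h}^\bullet(P)$, $\hat{h}^\bullet(P)$. For a morphism of posets $f:P\to Q$ with $f^{-1}(\min Q)\subset\min P$ and $f^{-1}(\max Q)\subset\max P$, $f^*[y_0<\cdots<y_n]=\sum_{f(x_i)=y_i}[x_0<\cdots<x_n]$ induces pullbacks on all three. Künneth morphisms $\kappa$ are induced by $[x_0<\cdots<x_m]\otimes[y_0<\cdots<y_n]\mapsto[(x_0,y_0)<\cdots<(x_m,y_0)<(x_m,y_1)<\cdots<(x_m,y_n)]$. For $x\in P$, concatenation $[x_0<\cdots<x_m=x]\otimes[x=x_m<\cdots<x_{m+n}]\mapsto[x_0<\cdots<x_{m+n}]$ induces $\mu_x:h^\bullet(P_{\le x})\otimes h^\bullet(P_{\ge x})\to h^\bullet(P)$, $\check{\mu}_x:h^\bullet(P_{\le x})\otimes\check{h}^\bullet(P_{\ge x})\to\check{h}^\bullet(P)$, $\hat{\mu}_x:\hat{h}^\bullet(P_{\le x})\otimes h^\bullet(P_{\ge x})\to\hat{h}^\bullet(P)$. Structures. For an operadic poset species $P$, and $\pi\in\Pi(S)$, the operad composition $\rho_\pi: h^{\bullet}(P(\pi)) \otimes \bigotimes_{T\in\pi} h^{\bullet}(P(T)) \to h^{\bullet}(P(S))$ is $\sum_{x\in P(S),a(x)=\pi}\mu_x\circ(\varphi_x^*\otimes\psi_x^*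 )\circ(\mathrm{id}\otimes\kappa)$; the left module structure $\check{\rho}_\pi:h^{\bullet}(P(\pi)) \otimes \bigotimes_{T\in\pi} \check{h}^{\bullet}(P(T)) \to \check{h}^{\bullet}(P(S))$ and the right module structure $\hat{\rho}_\pi:\hat{h}^{\bullet}(P(\pi)) \otimes \bigotimes_{T\in\pi} h^{\bullet}(P(T)) \to \hat{h}^{\bullet}(P(S))$ are given by the same formula with $\check{\mu}_x$, resp. $\hat{\mu}_x$, in place of $\mu_x$. Here $h^\bullet(P)$ denotes the species $S\mapsto h^\bullet(P(S))$, and similarly for the variants. Partitions. $\Pi(S)$ is the poset of partitions of $S$, with $\alpha\le\beta$ iff $\alpha$ is obtained by merging blocks of $\beta$. For $T\subset S$, $\pi_{|T}$ is the set of blocks of $\pi$ contained in $T$. There are isomorphisms $\varphi_\pi:\Pi_{\le\pi}(S)\to\Pi(\pi)$, $\alpha\mapsto\{\pi_{|T},T\in\alpha\}$, and $\psi_\pi:\Pi_{\ge\pi}(S)\to\prod_{T\in\pi}\Pi(T)$, $\beta\mapsto(\beta_{|T})_{T\in\pi}$. Operadic poset species. A poset species is a functor from finite sets and bijections to posets. An operadic poset species is a poset species $P$ with a morphism of poset species $a:P\to\Pi$ such that $a^{-1}(\min\Pi(S))=\min P(S)$ and $a^{-1}(\max\Pi(S))=\max P(S)$ for all $S$, and, for all $S$ and $x\in P(S)$ with $a(x)=\pi$, morphisms of posets $\varphi_x:P_{\le x}(S)\to P(\pi)$ and $\psi_x:P_{\ge x}(S)\to\prod_{T\in\pi}P(T)$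 with $a\circ\varphi_x=\varphi_\pi\circ a$ and $a\circ\psi_x=\psi_\pi\circ a$, satisfying: (Equivariance) For a bijection $g:S\to S'$, $x\in P(S)$, $x'=P(g)(x)$, $\pi=a(x)$, $\pi'=a(x')$, and the induced bijections $g:\pi\to\pi'$ and $g_{|T}:T\to g(T)$: $P(g)\circ\varphi_x=\varphi_{x'}\circ P(g)$ and $(P(g_{|T}))_{T\in\pi}\circ\psi_x=\psi_{x'}\circ P(g)$. (Unitality) $P(\{s\})$ is a singleton for every singleton $\{s\}$. (Associativity) Let $x\le x'$ in $P(S)$, $\pi=a(x)$, $\pi'=a(x')$, $\underline{x}=\varphi_{x'}(x)\in P(\pi')$, $(x'_{|T})_{T\in\pi}=\psi_x(x')$; identify $\pi$ with the partition $\{\pi'_{|T},T\in\pi\}$ of $\pi'$. Then $\varphi_{\underline{x}}\circ\varphi_{x'}=\varphi_x$ on $P_{\le x}(S)$; $(\psi_{x'_{|T}})_{T\in\pi}\circ\psi_x=\psi_{x'}$ on $P_{\ge x'}(S)$; and $\psi_{\underline{x}}\circ\varphi_{x'}=(\varphi_{x'_{|T}})_{T\in\pi}\circ\psi_x$ as maps $P_{[x,x']}(S)\to\prod_{T\in\pi}P(\pi'_{|T})$. A morphism $f:P\to Q$ commuting with the structure means: $a\circ f=a$, and for all $x\in P(S)$ with $a(x)=\pi$, $\varphi_{f(x)}\circ f=f\circ\varphi_x$ on $P_{\le x}(S)$ and $\psi_{f(x)}\circ f=(f)_{T\in\pi}\circ\psi_x$ on $P_{\ge x}(S)$. (The condition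 $a\circ f=a$ implies that $f$ satisfies the conditions needed for pullbacks.)
   Formalization: For the left module structure, κ is the Alexander–Whitney cross product, as the printed one-chain formula does not send cocycles of č to cocycles; they agree on c. ρ is formed by summing over x on cochains, since φ_x*, ψ_x* need not be defined on cohomology. *)

theory Defs
  imports Complex_Main "HOL-Library.FSet" "HOL-Library.Disjoint_Sets"
    "HOL-Library.FuncSet" "HOL-Library.Function_Algebras"
begin

section \<open>Finite sets and partitions\<close>

text \<open>Species are evaluated on a finite set \<open>S\<close>, on a partition \<open>\<pi>\<close> of \<open>S\<close> (itself a finite set, whose
  elements are the blocks) and on the blocks of \<open>\<pi>\<close>. Hence finite sets are taken inside one universe
  of points in which a finite set of points is again a point. There are finite subsets of every
  cardinality, so finite subsets of this type and their bijections form a category equivalent to that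
  of all finite sets and bijections.\<close>

datatype 'a pt = Atom 'a | Block "'a pt fset"

fun elts :: "'a pt \<Rightarrow> 'a pt set" where
  "elts (Atom a) = {}"
| "elts (Block A) = fset A"

definition block :: "'a pt set \<Rightarrow> 'a pt" where
  "block A = Block (Abs_fset A)"

definition fin_set :: "'a set \<Rightarrow> bool" where
  "fin_set S \<longleftrightarrow> finite S \<and> S \<noteq> {}"

definition Parts :: "'a pt set \<Rightarrow> 'a pt set set" where
  "Parts S = {\<pi>. \<pi> \<subseteq> range Block \<and> partition_on S (elts ` \<pi>)}"

definition Pi_order :: "'a pt set \<Rightarrow> 'a pt set rel" where
  "Pi_order S = {(\<alpha>, \<beta>). \<alpha> \<in> Parts S \<and> \<beta> \<in> Parts S \<and> refines S (elts ` \<beta>) (elts ` \<alpha>)}"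

definition restr :: "'a pt set \<Rightarrow> 'a pt \<Rightarrow> 'a pt set" where
  "restr \<pi> T = {U \<in> \<pi>. elts U \<subseteq> elts T}"

definition Pi_phi :: "'a pt set \<Rightarrow> 'a pt set \<Rightarrow> 'a pt set" where
  "Pi_phi \<pi> \<alpha> = (\<lambda>T. block (restr \<pi> T)) ` \<alpha>"

text \<open>The map induced on blocks by a map \<open>g\<close>.\<close>

definition block_map :: "('a pt \<Rightarrow> 'a pt) \<Rightarrow> 'a pt \<Rightarrow> 'a pt" where
  "block_map g T = block (g ` elts T)"


section \<open>Posets\<close>

text \<open>A poset is a relation \<open>r\<close> with \<open>Partial_order r\<close>; its underlying set is \<open>Field r\<close>.\<close>

definition poset_hom :: "'p rel \<Rightarrow> 'q rel \<Rightarrow> ('p \<Rightarrow> 'q) \<Rightarrow> bool" where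
  "poset_hom r s f \<longleftrightarrow> f \<in> Field r \<rightarrow> Field s \<and> (\<forall>(x, y) \<in> r. (f x, f y) \<in> s)"

definition minimals :: "'p rel \<Rightarrow> 'p set" where
  "minimals r = {x \<in> Field r. \<forall>y. (y, x) \<in> r \<longrightarrow> y = x}"

definition maximals :: "'p rel \<Rightarrow> 'p set" where
  "maximals r = {x \<in> Field r. \<forall>y. (x, y) \<in> r \<longrightarrow> y = x}"

definition down :: "'p rel \<Rightarrow> 'p \<Rightarrow> 'p rel" where
  "down r x = Restr r (under r x)"

definition up :: "'p rel \<Rightarrow> 'p \<Rightarrow> 'p rel" where
  "up r x = Restr r (above r x)"

definition prod_poset :: "'i set \<Rightarrow> ('i \<Rightarrow> 'p rel) \<Rightarrow> ('i \<Rightarrow> 'p) rel" where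
  "prod_poset I r = {(u, v). u \<in> (\<Pi>\<^sub>E i\<in>I. Field (r i)) \<and> v \<in> (\<Pi>\<^sub>E i\<in>I. Field (r i)) \<and>
     (\<forall>i\<in>I. (u i, v i) \<in> r i)}"


section \<open>Poset cohomology\<close>

text \<open>Throughout, the coefficient type \<open>'k\<close> has sort \<open>{comm_ring, comm_monoid_mult}\<close>: a commutative
  ring with unit, the zero ring being allowed (unlike in \<open>comm_ring_1\<close>).\<close>

definition chains :: "'p rel \<Rightarrow> nat \<Rightarrow> 'p list set" where
  "chains r n = {xs. length xs = Suc n \<and> set xs \<subseteq> Field r \<and>
     sorted_wrt (\<lambda>x y. (x, y) \<in> r \<and> x \<noteq> y) xs}"

text \<open>The selectors \<open>Plain\<close>, \<open>Check\<close>, \<open>Hat\<close> stand for the complexes \<open>c\<close>, \<open>c\<close> with a check and \<open>c\<close>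
  with a hat, and for their cohomologies.\<close>

datatype variant = Plain | Check | Hat

definition vchains :: "variant \<Rightarrow> 'p rel \<Rightarrow> nat \<Rightarrow> 'p list set" where
  "vchains v r n = {xs \<in> chains r n.
     (v \<in> {Plain, Check} \<longrightarrow> hd xs \<in> minimals r) \<and>
     (v \<in> {Plain, Hat} \<longrightarrow> last xs \<in> maximals r)}"

text \<open>As posets are finite, the free module on a set of chains is the module of functions on lists
  vanishing outside that set.\<close>

definition cochains :: "variant \<Rightarrow> 'p rel \<Rightarrow> nat \<Rightarrow> ('p list \<Rightarrow> 'k::{comm_ring,comm_monoid_mult}) set" where
  "cochains v r n = {F. \<forall>xs. xs \<notin> vchains v r n \<longrightarrow> F xs = 0}"

definition basis :: "'b \<Rightarrow> 'b \<Rightarrow> 'k::{comm_ring,comm_monoid_mult}" where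
  "basis x = (\<lambda>y. if y = x then 1 else 0)"

definition basis_sum :: "'b set \<Rightarrow> 'b \<Rightarrow> 'k::{comm_ring,comm_monoid_mult}" where
  "basis_sum X = (\<lambda>y. \<Sum>x\<in>X. basis x y)"

text \<open>Linear extension of \<open>\<phi>\<close>, given on the basis \<open>A\<close>.\<close>

definition lin_ext :: "'b set \<Rightarrow> ('b \<Rightarrow> 'c \<Rightarrow> 'k) \<Rightarrow> ('b \<Rightarrow> 'k) \<Rightarrow> 'c \<Rightarrow> 'k::{comm_ring,comm_monoid_mult}" where
  "lin_ext A \<phi> F = (\<lambda>y. \<Sum>x\<in>A. F x * \<phi> x y)"

text \<open>The \<open>i\<close>-th term inserts one element in position \<open>i\<close>: below \<open>x\<^sub>0\<close> for \<open>i = 0\<close>, above \<open>x\<^sub>n\<close> for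
  \<open>i = n + 1\<close>, and strictly between two consecutive elements otherwise.\<close>

definition d :: "'p rel \<Rightarrow> nat \<Rightarrow> ('p list \<Rightarrow> 'k) \<Rightarrow> 'p list \<Rightarrow> 'k::{comm_ring,comm_monoid_mult}" where
  "d r n = lin_ext (chains r n) (\<lambda>xs zs. \<Sum>i\<le>Suc n. (- 1) ^ i *
     basis_sum {take i xs @ y # drop i xs |y. take i xs @ y # drop i xs \<in> chains r (Suc n)} zs)"

definition cocycles :: "variant \<Rightarrow> 'p rel \<Rightarrow> nat \<Rightarrow> ('p list \<Rightarrow> 'k::{comm_ring,comm_monoid_mult}) set" where
  "cocycles v r n = {F \<in> cochains v r n. d r n F = 0}"

fun coboundaries :: "variant \<Rightarrow> 'p rel \<Rightarrow> nat \<Rightarrow> ('p list \<Rightarrow> 'k::{comm_ring,comm_monoid_mult}) set" where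
  "coboundaries v r 0 = {0}"
| "coboundaries v r (Suc n) = d r n ` cochains v r n"

definition cohomologous :: "variant \<Rightarrow> 'p rel \<Rightarrow> nat \<Rightarrow> ('p list \<Rightarrow> 'k::{comm_ring,comm_monoid_mult}) rel" where
  "cohomologous v r n = {(F, G). F \<in> cocycles v r n \<and> G \<in> cocycles v r n \<and> F - G \<in> coboundaries v r n}"

abbreviation coclass :: "variant \<Rightarrow> 'p rel \<Rightarrow> nat \<Rightarrow> ('p list \<Rightarrow> 'k) \<Rightarrow> ('p list \<Rightarrow> 'k::{comm_ring,comm_monoid_mult}) set" where
  "coclass v r n F \<equiv> cohomologous v r n `` {F}"

definition cohomology :: "variant \<Rightarrow> 'p rel \<Rightarrow> nat \<Rightarrow> ('p list \<Rightarrow> 'k::{comm_ring,comm_monoid_mult}) set set" where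
  "cohomology v r n = cocycles v r n // cohomologous v r n"

definition hadd :: "variant \<Rightarrow> 'p rel \<Rightarrow> nat \<Rightarrow> ('p list \<Rightarrow> 'k) set \<Rightarrow> ('p list \<Rightarrow> 'k) set \<Rightarrow>
    ('p list \<Rightarrow> 'k::{comm_ring,comm_monoid_mult}) set" where
  "hadd v r n A B = (\<Union>F\<in>A. \<Union>G\<in>B. coclass v r n (F + G))"

definition hsmult :: "variant \<Rightarrow> 'p rel \<Rightarrow> nat \<Rightarrow> 'k \<Rightarrow> ('p list \<Rightarrow> 'k) set \<Rightarrow>
    ('p list \<Rightarrow> 'k::{comm_ring,comm_monoid_mult}) set" where
  "hsmult v r n c A = (\<Union>F\<in>A. coclass v r n (\<lambda>xs. c * F xs))"

text \<open>Pullback along \<open>f\<close> from the poset \<open>s\<close> to the poset \<open>r\<close>, on cochains and on cohomology.\<close>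

definition pull :: "'p rel \<Rightarrow> 'q rel \<Rightarrow> ('p \<Rightarrow> 'q) \<Rightarrow> nat \<Rightarrow> ('q list \<Rightarrow> 'k) \<Rightarrow>
    'p list \<Rightarrow> 'k::{comm_ring,comm_monoid_mult}" where
  "pull r s f n = lin_ext (chains s n) (\<lambda>ys. basis_sum {xs \<in> chains r n. map f xs = ys})"

definition hpull :: "variant \<Rightarrow> 'p rel \<Rightarrow> 'q rel \<Rightarrow> ('p \<Rightarrow> 'q) \<Rightarrow> nat \<Rightarrow> ('q list \<Rightarrow> 'k) set \<Rightarrow>
    ('p list \<Rightarrow> 'k::{comm_ring,comm_monoid_mult}) set" where
  "hpull v r s f n A = (\<Union>F\<in>A. coclass v r n (pull r s f n F))"

text \<open>Concatenation at \<open>x\<close>.\<close>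

definition concat_at :: "'p rel \<Rightarrow> 'p \<Rightarrow> nat \<Rightarrow> nat \<Rightarrow> ('p list \<Rightarrow> 'k) \<Rightarrow> ('p list \<Rightarrow> 'k) \<Rightarrow>
    'p list \<Rightarrow> 'k::{comm_ring,comm_monoid_mult}" where
  "concat_at r x m n F G = (\<lambda>zs. \<Sum>xs\<in>{xs \<in> chains (down r x) m. last xs = x}.
     \<Sum>ys\<in>{ys \<in> chains (up r x) n. hd ys = x}. F xs * G ys * basis (xs @ tl ys) zs)"

text \<open>Kuenneth map for the product of the posets \<open>r T\<close>, \<open>T \<in> set Ts\<close>, the factors being taken in the
  order of the list \<open>Ts\<close>. A tuple of chains \<open>yss\<close> is sent to the sum of the chains \<open>zs\<close> of the product
  in which coordinate \<open>Ts ! i\<close> runs through \<open>yss ! i\<close> during the \<open>i\<close>-th segment of \<open>zs\<close>; this is the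
  (iterated) Alexander-Whitney cross product of cochains. If every chain of \<open>yss\<close> starts at a minimal
  and ends at a maximal element, then coordinates are constant outside of their segment and there is
  a single such \<open>zs\<close>, namely \<open>[(x\<^sub>0,y\<^sub>0) < \<dots> < (x\<^sub>m,y\<^sub>0) < (x\<^sub>m,y\<^sub>1) < \<dots> < (x\<^sub>m,y\<^sub>n)]\<close> for two factors (lemma
  \<open>kunneth_chains_pair\<close> below). If chains only start at minimal elements (variant \<open>Check\<close>), the
  coordinates \<open>x\<^sub>m\<close> may still increase after their segment: keeping only the single chain above would
  not give a map of complexes, e.g. for the square of the poset \<open>{0 < 1}\<close> the differential of
  \<open>[(0,0)]\<close> contains the term \<open>[(0,0) < (1,1)]\<close>.\<close>

definition kunneth_chains :: "('i \<Rightarrow> 'p rel) \<Rightarrow> 'i list \<Rightarrow> 'p list list \<Rightarrow> ('i \<Rightarrow> 'p) list set" where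
  "kunneth_chains r Ts yss =
     {zs \<in> chains (prod_poset (set Ts) r) (\<Sum>i<length Ts. length (yss ! i) - 1).
        \<forall>i<length Ts. map (\<lambda>z. z (Ts ! i))
          (take (length (yss ! i)) (drop (\<Sum>j<i. length (yss ! j) - 1) zs)) = yss ! i}"

lemma kunneth_chains_pair:
  assumes TU: "T \<noteq> U" and po: "Partial_order (r T)" "Partial_order (r U)"
    and xs: "xs \<in> chains (r T) m" "last xs \<in> maximals (r T)"
    and ys: "ys \<in> chains (r U) n" "hd ys \<in> minimals (r U)"
  defines "pair \<equiv> \<lambda>x y. (\<lambda>V\<in>{T, U}. if V = T then x else y)"
  shows "kunneth_chains r [T, U] [xs, ys] =
    {map (\<lambda>x. pair x (hd ys)) xs @ map (\<lambda>y. pair (last xs) y) (tl ys)}"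
    (is "_ = {?W}")
proof -
  have lx: "length xs = Suc m" and ly: "length ys = Suc n"
    using xs ys by (auto simp: chains_def)
  have lW: "length ?W = Suc (m + n)" using lx ly by simp
  have last_x: "last xs = xs ! m" and hd_y: "hd ys = ys ! 0"
    using lx ly by (auto simp: last_conv_nth hd_conv_nth length_0_conv[symmetric] simp del: length_0_conv)
  have W: "?W ! j = pair (xs ! min j m) (ys ! (j - m))" if "j \<le> m + n" for j
  proof (cases "j \<le> m")
    case True
    then show ?thesis using lx hd_y by (simp add: nth_append min_def)
  next
    case False
    then have "Suc (j - Suc m) = j - m" by simp
    then show ?thesis using False that lx ly last_x by (simp add: nth_append nth_tl min_def)
  qed
  have pT: "pair x y T = x" and pU: "pair x y U = y" for x y
    using TU by (auto simp: pair_def)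
  have Fx: "xs ! i \<in> Field (r T)" if "i \<le> m" for i
    using that xs lx by (force simp: chains_def)
  have Fy: "ys ! i \<in> Field (r U)" if "i \<le> n" for i
    using that ys ly by (force simp: chains_def)
  have sx: "(xs ! i, xs ! j) \<in> r T \<and> xs ! i \<noteq> xs ! j" if "i < j" "j \<le> m" for i j
    using that xs lx sorted_wrt_nth_less[of _ xs i j] by (auto simp: chains_def)
  have sy: "(ys ! i, ys ! j) \<in> r U \<and> ys ! i \<noteq> ys ! j" if "i < j" "j \<le> n" for i j
    using that ys ly sorted_wrt_nth_less[of _ ys i j] by (auto simp: chains_def)
  have rT: "(x, x) \<in> r T" if "x \<in> Field (r T)" for x
    using po(1) that by (auto simp: order_on_defs refl_on_def)
  have rU: "(x, x) \<in> r U" if "x \<in> Field (r U)" for x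
    using po(2) that by (auto simp: order_on_defs refl_on_def)
  have pair_in: "(pair x y, pair x' y') \<in> prod_poset {T, U} r \<longleftrightarrow> (x, x') \<in> r T \<and> (y, y') \<in> r U"
    if "x \<in> Field (r T)" "x' \<in> Field (r T)" "y \<in> Field (r U)" "y' \<in> Field (r U)" for x x' y y'
    using that TU by (auto simp: prod_poset_def pair_def)
  have kc: "zs \<in> kunneth_chains r [T, U] [xs, ys] \<longleftrightarrow> zs \<in> chains (prod_poset {T, U} r) (m + n) \<and>
      (\<forall>j\<le>m. (zs ! j) T = xs ! j) \<and> (\<forall>j\<le>n. (zs ! (m + j)) U = ys ! j)" (is "?L \<longleftrightarrow> ?R") for zs
  proof (cases "zs \<in> chains (prod_poset {T, U} r) (m + n)")
    case True
    then have "length zs = Suc (m + n)" by (simp add: chains_def)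
    then have "map (\<lambda>z. z T) (take (Suc m) zs) = xs \<longleftrightarrow> (\<forall>j\<le>m. (zs ! j) T = xs ! j)"
      and "map (\<lambda>z. z U) (take (Suc n) (drop m zs)) = ys \<longleftrightarrow> (\<forall>j\<le>n. (zs ! (m + j)) U = ys ! j)"
      using lx ly by (auto simp: list_eq_iff_nth_eq less_Suc_eq_le)
    then show ?thesis
      using True lx ly by (auto simp add: kunneth_chains_def All_less_Suc numeral_2_eq_2)
  next
    case False
    then show ?thesis by (simp add: kunneth_chains_def lx ly numeral_2_eq_2)
  qed
  have memW: "?W ! j = pair (xs ! min j m) (ys ! (j - m)) \<and> xs ! min j m \<in> Field (r T) \<and>
      ys ! (j - m) \<in> Field (r U)" if "j \<le> m + n" for j
    using that W Fx Fy by auto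
  have strict: "(?W ! i, ?W ! j) \<in> prod_poset {T, U} r \<and> ?W ! i \<noteq> ?W ! j"
    if "i < j" "j \<le> m + n" for i j
  proof -
    have "(xs ! min i m, xs ! min j m) \<in> r T"
      using sx[of "min i m" "min j m"] rT[OF Fx, of "min i m"] that by (cases "min i m = min j m") auto
    moreover have "(ys ! (i - m), ys ! (j - m)) \<in> r U"
      using sy[of "i - m" "j - m"] rU[OF Fy, of "i - m"] that by (cases "i - m = j - m") auto
    moreover have "xs ! min i m \<noteq> xs ! min j m \<or> ys ! (i - m) \<noteq> ys ! (j - m)"
    proof (cases "i < m")
      case True
      then show ?thesis using sx[of "i" "min j m"] that by (simp add: min_def split: if_splits)
    next
      case False
      then show ?thesis using sy[of "i - m" "j - m"] that by simp
    qed
    ultimately show ?thesis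
    proof -
      have ij: "i \<le> m + n" "j \<le> m + n" using that by auto
      have w: "?W ! i = pair (xs ! min i m) (ys ! (i - m))" "?W ! j = pair (xs ! min j m) (ys ! (j - m))"
        using W ij by auto
      have neq: "pair (xs ! min i m) (ys ! (i - m)) \<noteq> pair (xs ! min j m) (ys ! (j - m))"
        if "xs ! min i m \<noteq> xs ! min j m \<or> ys ! (i - m) \<noteq> ys ! (j - m)"
        using that pT pU by metis
      assume "(xs ! min i m, xs ! min j m) \<in> r T" "(ys ! (i - m), ys ! (j - m)) \<in> r U"
        "xs ! min i m \<noteq> xs ! min j m \<or> ys ! (i - m) \<noteq> ys ! (j - m)"
      moreover have "xs ! min i m \<in> Field (r T)" "xs ! min j m \<in> Field (r T)"
        "ys ! (i - m) \<in> Field (r U)" "ys ! (j - m) \<in> Field (r U)"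
        using memW ij by auto
      ultimately show ?thesis unfolding w using pair_in neq by blast
    qed
  qed
  have W_in: "?W \<in> kunneth_chains r [T, U] [xs, ys]"
  proof -
    have "set ?W \<subseteq> Field (prod_poset {T, U} r)"
    proof
      fix z assume "z \<in> set ?W"
      then obtain j where j: "j \<le> m + n" "z = ?W ! j"
        using lW by (metis in_set_conv_nth less_Suc_eq_le)
      then have "(z, z) \<in> prod_poset {T, U} r"
        using conjunct1[OF memW[OF j(1)]] conjunct2[OF memW[OF j(1)]] pair_in rT rU by simp
      then show "z \<in> Field (prod_poset {T, U} r)" by (auto simp: Field_def)
    qed
    moreover have "sorted_wrt (\<lambda>x y. (x, y) \<in> prod_poset {T, U} r \<and> x \<noteq> y) ?W"
      unfolding sorted_wrt_iff_nth_less using strict lW by (metis less_Suc_eq_le)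
    ultimately have "?W \<in> chains (prod_poset {T, U} r) (m + n)"
      using lW unfolding chains_def by blast
    moreover have "(?W ! j) T = xs ! j" if "j \<le> m" for j
      using W[of j] that pT by (simp add: min_def)
    moreover have "(?W ! (m + j)) U = ys ! j" if "j \<le> n" for j
      using W[of "m + j"] that pU by simp
    ultimately show ?thesis unfolding kc by blast
  qed
  moreover have "zs = ?W" if zs: "zs \<in> kunneth_chains r [T, U] [xs, ys]" for zs
  proof (rule nth_equalityI)
    have zc: "zs \<in> chains (prod_poset {T, U} r) (m + n)"
      and zT: "\<And>j. j \<le> m \<Longrightarrow> (zs ! j) T = xs ! j"
      and zU: "\<And>j. j \<le> n \<Longrightarrow> (zs ! (m + j)) U = ys ! j"
      using zs kc by auto
    have lz: "length zs = Suc (m + n)" using zc by (simp add: chains_def)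
    then show "length zs = length ?W" using lW by simp
    fix j assume "j < length zs"
    then have j: "j \<le> m + n" using lz by simp
    have le: "(zs ! i, zs ! k) \<in> prod_poset {T, U} r" if "i < k" "k \<le> m + n" for i k
      using that zc lz sorted_wrt_nth_less[of _ zs i k] by (auto simp: chains_def)
    have "zs ! j \<in> Field (prod_poset {T, U} r)"
      using zc j lz by (force simp: chains_def)
    then have ext: "zs ! j \<in> extensional {T, U}"
      by (auto simp: Field_def prod_poset_def PiE_def)
    have "(zs ! j) T = xs ! min j m"
    proof (cases "j \<le> m")
      case True
      then show ?thesis using zT by (simp add: min_def)
    next
      case False
      then have "((zs ! m) T, (zs ! j) T) \<in> r T" using le[of m j] j by (auto simp: prod_poset_def)
      then show ?thesis using False xs(2) zT[of m] last_x by (auto simp: maximals_def min_def)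
    qed
    moreover have "(zs ! j) U = ys ! (j - m)"
    proof (cases "m \<le> j")
      case True
      then show ?thesis using zU[of "j - m"] j by simp
    next
      case False
      then have "((zs ! j) U, (zs ! m) U) \<in> r U" using le[of j m] by (auto simp: prod_poset_def)
      then show ?thesis using False ys(2) zU[of 0] hd_y by (auto simp: minimals_def)
    qed
    ultimately have "zs ! j = pair (xs ! min j m) (ys ! (j - m))"
      using ext unfolding pair_def by (auto simp: extensional_def fun_eq_iff restrict_def)
    then show "zs ! j = ?W ! j" using W[OF j] by simp
  qed
  ultimately show ?thesis by blast
qed

definition kunneth :: "('i \<Rightarrow> 'p rel) \<Rightarrow> 'i list \<Rightarrow> nat list \<Rightarrow> ('p list \<Rightarrow> 'k) list \<Rightarrow>
    ('i \<Rightarrow> 'p) list \<Rightarrow> 'k::{comm_ring,comm_monoid_mult}" where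
  "kunneth r Ts ns Gs = (\<lambda>zs. \<Sum>yss\<in>listset (map2 (\<lambda>T n. chains (r T) n) Ts ns).
     prod_list (map2 (\<lambda>G ys. G ys) Gs yss) * basis_sum (kunneth_chains r Ts yss) zs)"


section \<open>Operadic poset species\<close>

text \<open>\<open>act S g\<close> is the map \<open>P(g)\<close> from \<open>P(S)\<close> to \<open>P(g ` S)\<close>, \<open>phi S x\<close> is \<open>\<phi>\<^sub>x\<close>, and \<open>psi S x y T\<close> is the
  component of \<open>\<psi>\<^sub>x(y)\<close> indexed by \<open>T\<close>.\<close>

record ('a, 'p) ops_data =
  pos :: "'a pt set \<Rightarrow> 'p rel"
  act :: "'a pt set \<Rightarrow> ('a pt \<Rightarrow> 'a pt) \<Rightarrow> 'p \<Rightarrow> 'p"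
  amap :: "'a pt set \<Rightarrow> 'p \<Rightarrow> 'a pt set"
  phi :: "'a pt set \<Rightarrow> 'p \<Rightarrow> 'p \<Rightarrow> 'p"
  psi :: "'a pt set \<Rightarrow> 'p \<Rightarrow> 'p \<Rightarrow> 'a pt \<Rightarrow> 'p"

abbreviation blocks_poset :: "('a, 'p) ops_data \<Rightarrow> 'a pt set \<Rightarrow> ('a pt \<Rightarrow> 'p) rel" where
  "blocks_poset P \<pi> \<equiv> prod_poset \<pi> (\<lambda>T. pos P (elts T))"

definition poset_species :: "('a, 'p) ops_data \<Rightarrow> bool" where
  "poset_species P \<longleftrightarrow> (\<forall>S. fin_set S \<longrightarrow>
     finite (Field (pos P S)) \<and> Partial_order (pos P S) \<and>
     (\<forall>g. inj_on g S \<longrightarrow> poset_hom (pos P S) (pos P (g ` S)) (act P S g)) \<and>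
     (\<forall>g g' x. inj_on g S \<and> (\<forall>s\<in>S. g s = g' s) \<and> x \<in> Field (pos P S) \<longrightarrow>
        act P S g x = act P S g' x) \<and>
     (\<forall>x\<in>Field (pos P S). act P S id x = x) \<and>
     (\<forall>g h x. inj_on g S \<and> inj_on h (g ` S) \<and> x \<in> Field (pos P S) \<longrightarrow>
        act P S (h \<circ> g) x = act P (g ` S) h (act P S g x)))"

definition species_over_Pi :: "('a, 'p) ops_data \<Rightarrow> bool" where
  "species_over_Pi P \<longleftrightarrow> (\<forall>S. fin_set S \<longrightarrow>
     poset_hom (pos P S) (Pi_order S) (amap P S) \<and>
     (\<forall>g x. inj_on g S \<and> x \<in> Field (pos P S) \<longrightarrow>
        amap P (g ` S) (act P S g x) = block_map g ` amap P S x) \<and>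
     {x \<in> Field (pos P S). amap P S x \<in> minimals (Pi_order S)} = minimals (pos P S) \<and>
     {x \<in> Field (pos P S). amap P S x \<in> maximals (Pi_order S)} = maximals (pos P S))"

definition structure_maps :: "('a, 'p) ops_data \<Rightarrow> bool" where
  "structure_maps P \<longleftrightarrow> (\<forall>S x. fin_set S \<and> x \<in> Field (pos P S) \<longrightarrow>
     poset_hom (down (pos P S) x) (pos P (amap P S x)) (phi P S x) \<and>
     poset_hom (up (pos P S) x) (blocks_poset P (amap P S x)) (psi P S x) \<and>
     (\<forall>y. (y, x) \<in> pos P S \<longrightarrow>
        amap P (amap P S x) (phi P S x y) = Pi_phi (amap P S x) (amap P S y)) \<and>
     (\<forall>y. (x, y) \<in> pos P S \<longrightarrow> (\<forall>T\<in>amap P S x.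
        amap P (elts T) (psi P S x y T) = restr (amap P S y) T)))"

definition equivariance :: "('a, 'p) ops_data \<Rightarrow> bool" where
  "equivariance P \<longleftrightarrow> (\<forall>S g x. fin_set S \<and> inj_on g S \<and> x \<in> Field (pos P S) \<longrightarrow>
     (let S' = g ` S; x' = act P S g x; \<pi> = amap P S x in
       (\<forall>y. (y, x) \<in> pos P S \<longrightarrow>
          act P \<pi> (block_map g) (phi P S x y) = phi P S' x' (act P S g y)) \<and>
       (\<forall>y. (x, y) \<in> pos P S \<longrightarrow> (\<forall>T\<in>\<pi>.
          act P (elts T) g (psi P S x y T) = psi P S' x' (act P S g y) (block_map g T)))))"

definition unitality :: "('a, 'p) ops_data \<Rightarrow> bool" where
  "unitality P \<longleftrightarrow> (\<forall>s. is_singleton (Field (pos P {s})))"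

text \<open>The identification of \<open>\<pi>\<close> with the partition \<open>{\<pi>'|T, T \<in> \<pi>}\<close> of \<open>\<pi>'\<close> is the bijection
  \<open>T \<mapsto> \<pi>'|T\<close>, through which \<open>P(\<pi>)\<close> is transported in the first condition.\<close>

definition associativity :: "('a, 'p) ops_data \<Rightarrow> bool" where
  "associativity P \<longleftrightarrow> (\<forall>S x x'. fin_set S \<and> (x, x') \<in> pos P S \<longrightarrow>
     (let \<pi> = amap P S x; \<pi>' = amap P S x'; ux = phi P S x' x; xT = psi P S x x';
          \<iota> = (\<lambda>T. block (restr \<pi>' T)) in
       (\<forall>y. (y, x) \<in> pos P S \<longrightarrow>
          phi P \<pi>' ux (phi P S x' y) = act P \<pi> \<iota> (phi P S x y)) \<and>
       (\<forall>y. (x', y) \<in> pos P S \<longrightarrow> (\<forall>T\<in>\<pi>. \<forall>U\<in>restr \<pi>' T.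
          psi P (elts T) (xT T) (psi P S x y T) U = psi P S x' y U)) \<and>
       (\<forall>y. (x, y) \<in> pos P S \<and> (y, x') \<in> pos P S \<longrightarrow> (\<forall>T\<in>\<pi>.
          psi P \<pi>' ux (phi P S x' y) (\<iota> T) = phi P (elts T) (xT T) (psi P S x y T)))))"

definition operadic_poset_species :: "('a, 'p) ops_data \<Rightarrow> bool" where
  "operadic_poset_species P \<longleftrightarrow> poset_species P \<and> species_over_Pi P \<and> structure_maps P \<and>
     equivariance P \<and> unitality P \<and> associativity P"

definition ops_morphism :: "('a, 'p) ops_data \<Rightarrow> ('a, 'q) ops_data \<Rightarrow> ('a pt set \<Rightarrow> 'p \<Rightarrow> 'q) \<Rightarrow> bool" where
  "ops_morphism P Q f \<longleftrightarrow> (\<forall>S. fin_set S \<longrightarrow>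
     poset_hom (pos P S) (pos Q S) (f S) \<and>
     (\<forall>g x. inj_on g S \<and> x \<in> Field (pos P S) \<longrightarrow> f (g ` S) (act P S g x) = act Q S g (f S x)) \<and>
     (\<forall>x\<in>Field (pos P S). amap Q S (f S x) = amap P S x \<and>
        (\<forall>y. (y, x) \<in> pos P S \<longrightarrow> phi Q S (f S x) (f S y) = f (amap P S x) (phi P S x y)) \<and>
        (\<forall>y. (x, y) \<in> pos P S \<longrightarrow> (\<forall>T\<in>amap P S x.
           psi Q S (f S x) (f S y) T = f (elts T) (psi P S x y T)))))"


section \<open>Graded operads and modules\<close>

text \<open>A graded species in \<open>'k\<close>-modules: \<open>gcarrier M S n\<close> is the degree \<open>n\<close> part of \<open>M(S)\<close>, and \<open>gact M S g\<close>
  is \<open>M(g)\<close> from \<open>M(S)\<close> to \<open>M(g ` S)\<close>.\<close>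

record ('a, 'm, 'k) gspecies =
  gcarrier :: "'a pt set \<Rightarrow> nat \<Rightarrow> 'm set"
  gadd :: "'a pt set \<Rightarrow> nat \<Rightarrow> 'm \<Rightarrow> 'm \<Rightarrow> 'm"
  gsmult :: "'a pt set \<Rightarrow> nat \<Rightarrow> 'k \<Rightarrow> 'm \<Rightarrow> 'm"
  gact :: "'a pt set \<Rightarrow> ('a pt \<Rightarrow> 'a pt) \<Rightarrow> nat \<Rightarrow> 'm \<Rightarrow> 'm"

text \<open>Compositions are maps out of a tensor product over the blocks of \<open>\<pi> \<in> \<Pi>(S)\<close>. They are given on
  homogeneous pure tensors as \<open>comp S Ts m a ns bs\<close>, where the list \<open>Ts\<close> enumerates \<open>\<pi>\<close>, \<open>a\<close> has
  degree \<open>m\<close>, and \<open>bs ! i\<close> is the factor of the block \<open>Ts ! i\<close>, of degree \<open>ns ! i\<close>. The unordered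
  tensor product being the ordered one for each enumeration of \<open>\<pi>\<close>, up to Koszul signs, the
  composition is recorded for every enumeration.\<close>

record ('a, 'm, 'k) goperad = "('a, 'm, 'k) gspecies" +
  gunit :: "'a pt \<Rightarrow> 'm"
  gcomp :: "'a pt set \<Rightarrow> 'a pt list \<Rightarrow> nat \<Rightarrow> 'm \<Rightarrow> nat list \<Rightarrow> 'm list \<Rightarrow> 'm"

record ('a, 'o, 'm, 'k) gleft_module = "('a, 'm, 'k) gspecies" +
  lcomp :: "'a pt set \<Rightarrow> 'a pt list \<Rightarrow> nat \<Rightarrow> 'o \<Rightarrow> nat list \<Rightarrow> 'm list \<Rightarrow> 'm"

record ('a, 'o, 'm, 'k) gright_module = "('a, 'm, 'k) gspecies" +
  rcomp :: "'a pt set \<Rightarrow> 'a pt list \<Rightarrow> nat \<Rightarrow> 'm \<Rightarrow> nat list \<Rightarrow> 'o list \<Rightarrow> 'm"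

definition gspecies_morphism :: "('a, 'm, 'k, 'x) gspecies_scheme \<Rightarrow> ('a, 'n, 'k, 'y) gspecies_scheme \<Rightarrow>
    ('a pt set \<Rightarrow> nat \<Rightarrow> 'm \<Rightarrow> 'n) \<Rightarrow> bool" where
  "gspecies_morphism A B F \<longleftrightarrow> (\<forall>S n. fin_set S \<longrightarrow>
     F S n \<in> gcarrier A S n \<rightarrow> gcarrier B S n \<and>
     (\<forall>u\<in>gcarrier A S n. \<forall>v\<in>gcarrier A S n. F S n (gadd A S n u v) = gadd B S n (F S n u) (F S n v)) \<and>
     (\<forall>c. \<forall>u\<in>gcarrier A S n. F S n (gsmult A S n c u) = gsmult B S n c (F S n u)) \<and>
     (\<forall>g. \<forall>u\<in>gcarrier A S n. inj_on g S \<longrightarrow> F (g ` S) n (gact A S g n u) = gact B S g n (F S n u)))"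

definition enumerates_partition :: "'a pt set \<Rightarrow> 'a pt list \<Rightarrow> bool" where
  "enumerates_partition S Ts \<longleftrightarrow> distinct Ts \<and> set Ts \<in> Parts S"

text \<open>\<open>bs\<close> is a tuple of homogeneous elements of degrees \<open>ns\<close> of the components of \<open>B\<close> at the blocks \<open>Ts\<close>.\<close>

definition tensor_factors :: "('a, 'm, 'k, 'x) gspecies_scheme \<Rightarrow> 'a pt list \<Rightarrow> nat list \<Rightarrow> 'm list \<Rightarrow> bool" where
  "tensor_factors B Ts ns bs \<longleftrightarrow> length ns = length Ts \<and> length bs = length Ts \<and>
     (\<forall>i<length Ts. bs ! i \<in> gcarrier B (elts (Ts ! i)) (ns ! i))"

definition map_factors :: "('a pt set \<Rightarrow> nat \<Rightarrow> 'm \<Rightarrow> 'n) \<Rightarrow> 'a pt list \<Rightarrow> nat list \<Rightarrow> 'm list \<Rightarrow> 'n list" where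
  "map_factors F Ts ns bs = map (\<lambda>i. F (elts (Ts ! i)) (ns ! i) (bs ! i)) [0..<length Ts]"

definition goperad_morphism :: "('a, 'm, 'k) goperad \<Rightarrow> ('a, 'n, 'k) goperad \<Rightarrow>
    ('a pt set \<Rightarrow> nat \<Rightarrow> 'm \<Rightarrow> 'n) \<Rightarrow> bool" where
  "goperad_morphism A B F \<longleftrightarrow> gspecies_morphism A B F \<and>
     (\<forall>s. F {s} 0 (gunit A s) = gunit B s) \<and>
     (\<forall>S Ts m a ns bs. fin_set S \<and> enumerates_partition S Ts \<and>
        a \<in> gcarrier A (set Ts) m \<and> tensor_factors A Ts ns bs \<longrightarrow>
        F S (m + sum_list ns) (gcomp A S Ts m a ns bs) =
          gcomp B S Ts m (F (set Ts) m a) ns (map_factors F Ts ns bs))"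

text \<open>Morphisms \<open>G\<close> of modules compatible with the morphism \<open>F\<close> of operads, from the \<open>A\<close>-module \<open>M\<close> to the
  \<open>B\<close>-module \<open>N\<close>.\<close>

definition gleft_module_morphism :: "('a, 'o, 'k) goperad \<Rightarrow> ('a, 'q, 'k) goperad \<Rightarrow>
    ('a pt set \<Rightarrow> nat \<Rightarrow> 'o \<Rightarrow> 'q) \<Rightarrow> ('a, 'o, 'm, 'k) gleft_module \<Rightarrow> ('a, 'q, 'n, 'k) gleft_module \<Rightarrow>
    ('a pt set \<Rightarrow> nat \<Rightarrow> 'm \<Rightarrow> 'n) \<Rightarrow> bool" where
  "gleft_module_morphism A B F M N G \<longleftrightarrow> goperad_morphism A B F \<and> gspecies_morphism M N G \<and>
     (\<forall>S Ts m a ns bs. fin_set S \<and> enumerates_partition S Ts \<and>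
        a \<in> gcarrier A (set Ts) m \<and> tensor_factors M Ts ns bs \<longrightarrow>
        G S (m + sum_list ns) (lcomp M S Ts m a ns bs) =
          lcomp N S Ts m (F (set Ts) m a) ns (map_factors G Ts ns bs))"

definition gright_module_morphism :: "('a, 'o, 'k) goperad \<Rightarrow> ('a, 'q, 'k) goperad \<Rightarrow>
    ('a pt set \<Rightarrow> nat \<Rightarrow> 'o \<Rightarrow> 'q) \<Rightarrow> ('a, 'o, 'm, 'k) gright_module \<Rightarrow> ('a, 'q, 'n, 'k) gright_module \<Rightarrow>
    ('a pt set \<Rightarrow> nat \<Rightarrow> 'm \<Rightarrow> 'n) \<Rightarrow> bool" where
  "gright_module_morphism A B F M N G \<longleftrightarrow> goperad_morphism A B F \<and> gspecies_morphism M N G \<and>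
     (\<forall>S Ts m a ns bs. fin_set S \<and> enumerates_partition S Ts \<and>
        a \<in> gcarrier M (set Ts) m \<and> tensor_factors A Ts ns bs \<longrightarrow>
        G S (m + sum_list ns) (rcomp M S Ts m a ns bs) =
          rcomp N S Ts m (G (set Ts) m a) ns (map_factors F Ts ns bs))"


section \<open>Structures on the cohomology of an operadic poset species\<close>

text \<open>The sum of the composites \<open>\<mu>\<^sub>x \<circ> (\<phi>\<^sub>x\<^sup>* \<otimes> \<psi>\<^sub>x\<^sup>*) \<circ> (id \<otimes> \<kappa>)\<close> on cochains, where \<open>\<pi> = set Ts\<close>. The
  formula is the same for the three structures; only the complexes to which it is applied differ.
  Passing to cohomology once, for the whole sum, gives the usual result when each \<open>\<phi>\<^sub>x\<^sup>*\<close> and \<open>\<psi>\<^sub>x\<^sup>*\<close> is a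
  map of complexes. The axioms alone do not force this (\<open>P(S)\<close> may contain \<open>y < x\<close> with \<open>a(y) = a(x)\<close>),
  but the defects cancel in the sum over \<open>x\<close>.\<close>

definition rho_cochain :: "('a, 'p) ops_data \<Rightarrow> 'a pt set \<Rightarrow> 'a pt list \<Rightarrow> nat \<Rightarrow> ('p list \<Rightarrow> 'k) \<Rightarrow>
    nat list \<Rightarrow> ('p list \<Rightarrow> 'k) list \<Rightarrow> 'p list \<Rightarrow> 'k::{comm_ring,comm_monoid_mult}" where
  "rho_cochain P S Ts m F ns Gs = (\<lambda>zs. \<Sum>x\<in>{x \<in> Field (pos P S). amap P S x = set Ts}.
     concat_at (pos P S) x m (sum_list ns)
       (pull (down (pos P S) x) (pos P (set Ts)) (phi P S x) m F)
       (pull (up (pos P S) x) (blocks_poset P (set Ts)) (psi P S x) (sum_list ns)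
          (kunneth (\<lambda>T. pos P (elts T)) Ts ns Gs)) zs)"

definition rho :: "variant \<Rightarrow> ('a, 'p) ops_data \<Rightarrow> 'a pt set \<Rightarrow> 'a pt list \<Rightarrow> nat \<Rightarrow> ('p list \<Rightarrow> 'k) set \<Rightarrow>
    nat list \<Rightarrow> ('p list \<Rightarrow> 'k) set list \<Rightarrow> ('p list \<Rightarrow> 'k::{comm_ring,comm_monoid_mult}) set" where
  "rho v P S Ts m A ns Bs = (\<Union>F\<in>A. \<Union>Gs\<in>listset Bs.
     coclass v (pos P S) (m + sum_list ns) (rho_cochain P S Ts m F ns Gs))"

text \<open>The covariant action of \<open>g\<close> on \<open>h(P)\<close> is the pullback along the inverse of \<open>P(g)\<close>.\<close>

definition h_species :: "variant \<Rightarrow> 'k itself \<Rightarrow> ('a, 'p) ops_data \<Rightarrow>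
    ('a, ('p list \<Rightarrow> 'k::{comm_ring,comm_monoid_mult}) set, 'k) gspecies" where
  "h_species v K P = \<lparr>
     gcarrier = (\<lambda>S n. cohomology v (pos P S) n),
     gadd = (\<lambda>S n. hadd v (pos P S) n),
     gsmult = (\<lambda>S n. hsmult v (pos P S) n),
     gact = (\<lambda>S g n. hpull v (pos P (g ` S)) (pos P S) (act P (g ` S) (inv_into S g)) n)\<rparr>"

definition h_operad :: "'k itself \<Rightarrow> ('a, 'p) ops_data \<Rightarrow>
    ('a, ('p list \<Rightarrow> 'k::{comm_ring,comm_monoid_mult}) set, 'k) goperad" where
  "h_operad K P = gspecies.extend (h_species Plain K P) (goperad.fields
     (\<lambda>s. coclass Plain (pos P {s}) 0 (basis [the_elem (Field (pos P {s}))]))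
     (rho Plain P))"

definition h_check_module :: "'k itself \<Rightarrow> ('a, 'p) ops_data \<Rightarrow>
    ('a, ('p list \<Rightarrow> 'k) set, ('p list \<Rightarrow> 'k::{comm_ring,comm_monoid_mult}) set, 'k) gleft_module" where
  "h_check_module K P = gspecies.extend (h_species Check K P) (gleft_module.fields (rho Check P))"

definition h_hat_module :: "'k itself \<Rightarrow> ('a, 'p) ops_data \<Rightarrow>
    ('a, ('p list \<Rightarrow> 'k) set, ('p list \<Rightarrow> 'k::{comm_ring,comm_monoid_mult}) set, 'k) gright_module" where
  "h_hat_module K P = gspecies.extend (h_species Hat K P) (gright_module.fields (rho Hat P))"

definition pullback :: "variant \<Rightarrow> ('a, 'p) ops_data \<Rightarrow> ('a, 'q) ops_data \<Rightarrow> ('a pt set \<Rightarrow> 'p \<Rightarrow> 'q) \<Rightarrow>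
    'a pt set \<Rightarrow> nat \<Rightarrow> ('q list \<Rightarrow> 'k) set \<Rightarrow> ('p list \<Rightarrow> 'k::{comm_ring,comm_monoid_mult}) set" where
  "pullback v P Q f S n = hpull v (pos P S) (pos Q S) (f S) n"

end

theory Submission
  imports Defs
begin

text \<open>A cochain is regarded as a function on all lists which vanishes off chains; this turns the
  differential into the alternating sum of faces of a weakly increasing list, the degenerate terms
  cancelling in pairs, and pullbacks into precomposition. The Kuenneth map and the composition are then
  iterated cup products of such functions, so the Leibniz rule for cup products shows that they pass
  to cohomology, and their naturality is checked pointwise. For the composition the Leibniz rule
  has two defects at a chain \<open>z\<^sub>0 < \<dots> < z\<^sub>m < z\<^sub>m\<^sub>+\<^sub>1 < \<dots>\<close>. If only one of \<open>z\<^sub>m\<close>, \<open>z\<^sub>m\<^sub>+\<^sub>1\<close> lies over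
  \<open>\<pi>\<close>, the remaining one vanishes by the condition on maximal, respectively minimal elements; if both
  do, associativity makes \<open>\<phi>\<close> and \<open>\<psi>\<close> at the two elements coincide and the defects cancel.\<close>

text \<open>A poset morphism may identify elements of a chain. On the resulting list with
  repetitions every cochain is zero, which agrees with the pullback formula. Weakly increasing lists
  are stable under faces and under images, so formulas stated on them keep the question of
  collapsing chains out of the naturality arguments. At a list \<open>zs\<close> the sum over
  \<open>x\<close> in the composition has only the term \<open>x = zs ! m\<close>. The composition
  is thus a genuine cup product of a function of the first \<open>m + 1\<close> entries and one of
  the entries from position \<open>m\<close> on, each taking \<open>x\<close> from its own end of
  the list. Defects arise only on comparing with the differentials of the two arguments, since a
  face may remove \<open>x\<close>. Their cancellation requires that chains of the left argument end
  at maximal elements and those of the right one start at minimal elements; this is common to the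
  three structures, so one computation serves all of them. Classes are sets of cocycles and
  operations on them are unions over representatives, so equalities of classes are reduced to one
  choice of representatives.\<close>

section \<open>Lists, finite sums and signs\<close>

lemma sorted_wrt_conj:
  "sorted_wrt (\<lambda>x y. P x y \<and> Q x y) xs \<longleftrightarrow> sorted_wrt P xs \<and> sorted_wrt Q xs"
  by (induction xs) auto

lemma distinct_iff_sorted_wrt: "distinct xs \<longleftrightarrow> sorted_wrt (\<noteq>) xs"
  by (induction xs) auto

lemma listset_iff: "xs \<in> listset As \<longleftrightarrow> list_all2 (\<in>) xs As"
proof (induction As arbitrary: xs)
  case (Cons A As)
  then show ?case by (cases xs) (auto simp: set_Cons_def)
qed simp

lemma finite_listset: "(\<And>A. A \<in> set As \<Longrightarrow> finite A) \<Longrightarrow> finite (listset As)"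
proof (induction As)
  case (Cons A As)
  have "set_Cons A (listset As) = (\<lambda>(x, xs). x # xs) ` (A \<times> listset As)"
    by (auto simp: set_Cons_def)
  then show ?case using Cons by simp
qed simp

lemma prod_list_eq_0:
  "(0 :: 'k::{comm_ring,comm_monoid_mult}) \<in> set xs \<Longrightarrow> prod_list xs = 0"
  by (induction xs) auto

lemma minus_1_mult [simp]: "- 1 * (x :: 'k::{comm_ring,comm_monoid_mult}) = - x"
  by (simp only: mult_minus_left mult_1_left)

lemma sign_mult_self: "(- 1) ^ n * ((- 1) ^ n * (x :: 'k::{comm_ring,comm_monoid_mult})) = x"
  by (induction n) (simp_all add: mult.assoc mult.left_commute)

lemma sum_lessThan_add:
  "(\<Sum>i<a + b. g i) = (\<Sum>i<a. g i) + (\<Sum>j<b. g (a + j :: nat) :: 'k::comm_monoid_add)"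
  by (induction b) (simp_all add: add.assoc)

lemma sum_if_eq:
  assumes "finite A"
  shows "(\<Sum>x\<in>A. if x = a then f x else (0::'k::comm_monoid_add)) = (if a \<in> A then f a else 0)"
  using assms by (simp add: sum.delta)

section \<open>Chains and cochains\<close>

definition fin_poset :: "'p rel \<Rightarrow> bool" where
  "fin_poset r \<longleftrightarrow> finite (Field r) \<and> Partial_order r"

lemma fin_poset_refl: "fin_poset r \<Longrightarrow> x \<in> Field r \<Longrightarrow> (x, x) \<in> r"
  by (auto simp: fin_poset_def order_on_defs refl_on_def)

lemma fin_poset_antisym: "fin_poset r \<Longrightarrow> (x, y) \<in> r \<Longrightarrow> (y, x) \<in> r \<Longrightarrow> x = y"
  by (auto simp: fin_poset_def order_on_defs dest: antisymD)

lemma fin_poset_trans: "fin_poset r \<Longrightarrow> (x, y) \<in> r \<Longrightarrow> (y, z) \<in> r \<Longrightarrow> (x, z) \<in> r"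
  by (auto simp: fin_poset_def order_on_defs dest: transD)

text \<open>All simplices of the nerve, degenerate ones included. Unlike \<open>chains\<close>, this
  family is stable under poset morphisms that are not injective.\<close>

definition wchains :: "'p rel \<Rightarrow> nat \<Rightarrow> 'p list set" where
  "wchains r n = {xs. length xs = Suc n \<and> set xs \<subseteq> Field r \<and> sorted_wrt (\<lambda>x y. (x, y) \<in> r) xs}"

lemma chains_iff: "xs \<in> chains r n \<longleftrightarrow> xs \<in> wchains r n \<and> distinct xs"
  by (auto simp: chains_def wchains_def sorted_wrt_conj distinct_iff_sorted_wrt)

lemma wchains_length: "xs \<in> wchains r n \<Longrightarrow> length xs = Suc n"
  by (simp add: wchains_def)

lemma wchains_nth_in: "xs \<in> wchains r n \<Longrightarrow> i \<le> n \<Longrightarrow> xs ! i \<in> Field r"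
  by (force simp: wchains_def)

lemma wchains_nth_le:
  assumes "fin_poset r" "xs \<in> wchains r n" "i \<le> j" "j \<le> n"
  shows "(xs ! i, xs ! j) \<in> r"
proof (cases "i = j")
  case True
  then show ?thesis using assms fin_poset_refl wchains_nth_in by metis
next
  case False
  then show ?thesis using assms sorted_wrt_nth_less[of _ xs i j] by (auto simp: wchains_def)
qed

lemma wchains_take: "xs \<in> wchains r n \<Longrightarrow> m \<le> n \<Longrightarrow> take (Suc m) xs \<in> wchains r m"
  by (auto simp: wchains_def sorted_wrt_take dest: in_set_takeD)

lemma wchains_drop: "xs \<in> wchains r (m + n) \<Longrightarrow> drop m xs \<in> wchains r n"
  by (auto simp: wchains_def sorted_wrt_drop dest: in_set_dropD)

lemma wchains_map: "poset_hom r s f \<Longrightarrow> xs \<in> wchains r n \<Longrightarrow> map f xs \<in> wchains s n"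
  using sorted_wrt_mono_rel[of xs "\<lambda>x y. (x, y) \<in> r" "\<lambda>x y. (f x, f y) \<in> s"]
  by (auto simp: wchains_def poset_hom_def sorted_wrt_map Pi_iff)

lemma finite_wchains: "fin_poset r \<Longrightarrow> finite (wchains r n)"
  using finite_lists_length_eq[of "Field r" "Suc n"]
  by (auto simp: wchains_def fin_poset_def elim!: rev_finite_subset)

lemma finite_chains: "fin_poset r \<Longrightarrow> finite (chains r n)"
  using finite_wchains[of r n] by (auto simp: chains_iff elim!: rev_finite_subset)

lemma cochains_eq_0: "F \<in> cochains v r n \<Longrightarrow> xs \<notin> chains r n \<Longrightarrow> F xs = 0"
  by (auto simp: cochains_def vchains_def)

lemma cochains_eq_0_not_distinct: "F \<in> cochains v r n \<Longrightarrow> \<not> distinct xs \<Longrightarrow> F xs = 0"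
  by (auto simp: cochains_def vchains_def chains_iff)

lemma cochainsI:
  assumes "\<And>xs. F xs \<noteq> 0 \<Longrightarrow> xs \<in> chains r n"
    and "\<And>xs. F xs \<noteq> 0 \<Longrightarrow> v \<in> {Plain, Check} \<Longrightarrow> hd xs \<in> minimals r"
    and "\<And>xs. F xs \<noteq> 0 \<Longrightarrow> v \<in> {Plain, Hat} \<Longrightarrow> last xs \<in> maximals r"
  shows "F \<in> cochains v r n"
  using assms unfolding cochains_def vchains_def by blast

lemma cochains_hd: "F \<in> cochains v r n \<Longrightarrow> F xs \<noteq> 0 \<Longrightarrow> v \<in> {Plain, Check} \<Longrightarrow> hd xs \<in> minimals r"
  unfolding cochains_def vchains_def by blast

lemma cochains_last: "F \<in> cochains v r n \<Longrightarrow> F xs \<noteq> 0 \<Longrightarrow> v \<in> {Plain, Hat} \<Longrightarrow> last xs \<in> maximals r"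
  unfolding cochains_def vchains_def by blast

text \<open>Off chains both sides vanish, whichever their variants. Comparing on the larger set
  \<open>wchains\<close> matches the form of the pointwise formulas proved below.\<close>

lemma cochains_eqI:
  assumes "F \<in> cochains v r n" "G \<in> cochains w r n" "\<And>xs. xs \<in> wchains r n \<Longrightarrow> F xs = G xs"
  shows "F = G"
proof
  fix xs show "F xs = G xs"
    using assms by (cases "xs \<in> chains r n") (simp_all add: cochains_eq_0 chains_iff)
qed

lemma cochains_0: "0 \<in> cochains v r n"
  by (simp add: cochains_def)

lemma cochains_add: "F \<in> cochains v r n \<Longrightarrow> G \<in> cochains v r n \<Longrightarrow> F + G \<in> cochains v r n"
  by (simp add: cochains_def)

lemma cochains_diff: "F \<in> cochains v r n \<Longrightarrow> G \<in> cochains v r n \<Longrightarrow> F - G \<in> cochains v r n"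
  by (simp add: cochains_def)

lemma cochains_smult: "F \<in> cochains v r n \<Longrightarrow> (\<lambda>xs. c * F xs) \<in> cochains v r n"
  by (simp add: cochains_def)

section \<open>Faces of lists and the differential\<close>

definition del :: "nat \<Rightarrow> 'b list \<Rightarrow> 'b list" where
  "del i xs = take i xs @ drop (Suc i) xs"

text \<open>The simplicial coboundary, with no poset and no degree in it: it applies to any function
  on lists, in particular to products of cochains, and commutes with \<open>map\<close>.\<close>

definition coface_sum :: "('b list \<Rightarrow> 'k) \<Rightarrow> 'b list \<Rightarrow> 'k::{comm_ring,comm_monoid_mult}" where
  "coface_sum F xs = (\<Sum>i<length xs. (- 1) ^ i * F (del i xs))"

lemma length_del: "i < length xs \<Longrightarrow> length (del i xs) = length xs - 1"
  by (simp add: del_def)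

lemma map_del: "map f (del i xs) = del i (map f xs)"
  by (simp add: del_def take_map drop_map)

lemma coface_sum_map: "coface_sum (\<lambda>xs. F (map f xs)) xs = coface_sum F (map f xs)"
  by (simp add: coface_sum_def map_del)

lemma sorted_wrt_del: "sorted_wrt P xs \<Longrightarrow> sorted_wrt P (del i xs)"
proof -
  assume "sorted_wrt P xs"
  then have "sorted_wrt P (take i xs @ drop i xs)" by simp
  then have "\<forall>x\<in>set (take i xs). \<forall>y\<in>set (drop i xs). P x y"
    unfolding sorted_wrt_append by blast
  moreover have "set (drop (Suc i) xs) \<subseteq> set (drop i xs)"
    by (simp add: set_drop_subset_set_drop)
  ultimately show ?thesis
    using \<open>sorted_wrt P xs\<close> by (auto simp: del_def sorted_wrt_append sorted_wrt_take sorted_wrt_drop)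
qed

lemma set_del_subset: "set (del i xs) \<subseteq> set xs"
  by (auto simp: del_def dest: in_set_takeD in_set_dropD)

lemma del_wchains: "xs \<in> wchains r (Suc n) \<Longrightarrow> i \<le> Suc n \<Longrightarrow> del i xs \<in> wchains r n"
  using set_del_subset[of i xs] by (auto simp: wchains_def sorted_wrt_del length_del)

lemma distinct_del: "distinct xs \<Longrightarrow> distinct (del i xs)"
  unfolding distinct_iff_sorted_wrt by (rule sorted_wrt_del)

text \<open>Passes between the two forms of the differential: the definition of \<open>d\<close>
  inserts elements into basis chains, whereas the value of \<open>d\<close> at a chain is computed
  by deleting entries.\<close>

lemma insert_eq_iff_del:
  assumes "length zs = Suc (length xs)" "i \<le> length xs"
  shows "(\<exists>y. zs = take i xs @ y # drop i xs) \<longleftrightarrow> xs = del i zs"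
proof
  assume "\<exists>y. zs = take i xs @ y # drop i xs"
  then obtain y where "zs = take i xs @ y # drop i xs" by blast
  then show "xs = del i zs" using assms by (simp add: del_def min_def)
next
  assume "xs = del i zs"
  then have "take i xs = take i zs" "drop i xs = drop (Suc i) zs"
    using assms by (simp_all add: del_def min_def)
  moreover have "zs = take i zs @ zs ! i # drop (Suc i) zs"
    using assms by (simp add: id_take_nth_drop)
  ultimately show "\<exists>y. zs = take i xs @ y # drop i xs" by metis
qed

lemma basis_sum_eq: "finite X \<Longrightarrow> basis_sum X y = (if y \<in> X then 1 else 0)"
  by (simp add: basis_sum_def basis_def)

lemma d_eq_0:
  assumes "zs \<notin> chains r (Suc n)"
  shows "d r n F zs = (0 :: 'k::{comm_ring,comm_monoid_mult})"
proof -
  have "basis_sum {take i xs @ y # drop i xs |y. take i xs @ y # drop i xs \<in> chains r (Suc n)} zs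
      = (0 :: 'k)" for i xs
    unfolding basis_sum_def basis_def using assms by (intro sum.neutral) auto
  then show ?thesis by (simp only: d_def lin_ext_def) simp
qed

text \<open>For each \<open>i\<close> exactly one basis chain yields \<open>zs\<close> by an
  insertion in position \<open>i\<close>, namely \<open>del i zs\<close>; the double sum over chains
  and positions collapses to the faces of \<open>zs\<close>.\<close>

lemma d_chain:
  fixes F :: "'p list \<Rightarrow> 'k::{comm_ring,comm_monoid_mult}"
  assumes r: "fin_poset r" and F: "F \<in> cochains v r n" and zs: "zs \<in> chains r (Suc n)"
  shows "d r n F zs = coface_sum F zs"
proof -
  have lz: "length zs = Suc (Suc n)" using zs by (simp add: chains_def)
  have del: "del i zs \<in> chains r n" if "i \<le> Suc n" for i
    using zs that by (auto simp: chains_iff del_wchains distinct_del)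
  have ins: "basis_sum {take i xs @ y # drop i xs |y. take i xs @ y # drop i xs \<in> chains r (Suc n)} zs
      = (if xs = del i zs then 1 else (0::'k))" if "xs \<in> chains r n" "i \<le> Suc n" for i xs
  proof -
    have lx: "length xs = Suc n" using that by (simp add: chains_def)
    have "finite {take i xs @ y # drop i xs |y. take i xs @ y # drop i xs \<in> chains r (Suc n)}"
      by (rule finite_subset[OF _ finite_chains[OF r, of "Suc n"]]) auto
    moreover have "zs \<in> {take i xs @ y # drop i xs |y. take i xs @ y # drop i xs \<in> chains r (Suc n)}
        \<longleftrightarrow> (\<exists>y. zs = take i xs @ y # drop i xs)" using zs by auto
    ultimately show ?thesis
      using insert_eq_iff_del[of zs xs i] lx lz that by (simp add: basis_sum_eq)
  qed
  have "d r n F zs = (\<Sum>xs\<in>chains r n. \<Sum>i\<le>Suc n. if xs = del i zs then (- 1) ^ i * F xs else 0)"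
    unfolding d_def lin_ext_def sum_distrib_left
    by (intro sum.cong refl) (auto simp: ins mult.commute)
  also have "\<dots> = (\<Sum>i\<le>Suc n. \<Sum>xs\<in>chains r n. if xs = del i zs then (- 1) ^ i * F xs else 0)"
    by (rule sum.swap)
  also have "\<dots> = (\<Sum>i\<le>Suc n. (- 1) ^ i * F (del i zs))"
    using del by (intro sum.cong refl) (simp add: finite_chains[OF r] sum_if_eq)
  finally show ?thesis by (simp add: coface_sum_def lz lessThan_Suc_atMost)
qed

text \<open>By antisymmetry, everything between two equal entries of a weakly increasing list is
  equal to them.\<close>

lemma not_distinct_adjacent:
  assumes r: "fin_poset r" and zs: "zs \<in> wchains r n" and "\<not> distinct zs"
  obtains k where "Suc k \<le> n" "zs ! k = zs ! Suc k"
proof -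
  obtain i j where ij: "i < j" "j \<le> n" "zs ! i = zs ! j"
    using assms by (auto simp: distinct_conv_nth wchains_def less_Suc_eq_le)
      (metis less_Suc_eq_le linorder_neqE_nat)
  have "(zs ! i, zs ! Suc i) \<in> r" "(zs ! Suc i, zs ! j) \<in> r"
    by (rule wchains_nth_le[OF r zs]; use ij in simp)+
  then have "zs ! i = zs ! Suc i" using ij fin_poset_antisym[OF r] by metis
  then show ?thesis using that ij by force
qed

lemma split_adjacent:
  assumes "Suc k < length zs" "zs ! k = zs ! Suc k"
  shows "zs = take k zs @ zs ! k # zs ! k # drop (Suc (Suc k)) zs"
  using assms by (metis Suc_lessD append_take_drop_id Cons_nth_drop_Suc)

lemma not_distinct_del:
  assumes k: "Suc k < length zs" "zs ! k = zs ! Suc k" and i: "i \<noteq> k" "i \<noteq> Suc k"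
  shows "\<not> distinct (del i zs)"
proof -
  obtain as x bs where zs: "zs = as @ x # x # bs" and "length as = k"
    using split_adjacent[OF k] k by (metis Suc_lessD length_take min.absorb4)
  consider "i < k" | "Suc (Suc k) \<le> i" using i by linarith
  then show ?thesis
  proof cases
    case 1
    then show ?thesis using \<open>length as = k\<close> by (simp add: zs del_def)
  next
    case 2
    then obtain j where "i = Suc (Suc k) + j" using le_iff_add by blast
    then show ?thesis using \<open>length as = k\<close> by (simp add: zs del_def)
  qed
qed

lemma del_adjacent:
  assumes "Suc k < length zs" "zs ! k = zs ! Suc k"
  shows "del k zs = del (Suc k) zs"
  using assms by (simp add: del_def take_Suc_conv_app_nth Cons_nth_drop_Suc[symmetric])

text \<open>On a degenerate list two faces cancel and all others vanish: this is the differential of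
  normalized cochains.\<close>

lemma d_wchain:
  fixes F :: "'p list \<Rightarrow> 'k::{comm_ring,comm_monoid_mult}"
  assumes r: "fin_poset r" and F: "F \<in> cochains v r n" and zs: "zs \<in> wchains r (Suc n)"
  shows "d r n F zs = coface_sum F zs"
proof (cases "distinct zs")
  case True
  then show ?thesis using d_chain[OF r F] zs by (simp add: chains_iff)
next
  case False
  then obtain k where k: "Suc k \<le> Suc n" "zs ! k = zs ! Suc k"
    using not_distinct_adjacent[OF r zs] by blast
  have lz: "length zs = Suc (Suc n)" using zs by (rule wchains_length)
  have "coface_sum F zs = (\<Sum>i\<in>{k, Suc k}. (- 1) ^ i * F (del i zs))"
    unfolding coface_sum_def using k lz cochains_eq_0_not_distinct[OF F not_distinct_del[OF _ k(2)]]
    by (intro sum.mono_neutral_right) auto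
  also have "\<dots> = 0"
    using k lz del_adjacent[of k zs] by simp
  finally show ?thesis using False by (simp add: d_eq_0 chains_iff)
qed

text \<open>The last face of the first coboundary and the first face of the second both give
  \<open>A (take (Suc m) zs) * B (drop (Suc m) zs)\<close>, with signs \<open>(- 1) ^ Suc m\<close>
  and \<open>(- 1) ^ m\<close>, and cancel. What remains are the faces of \<open>zs\<close>: those
  removing a position up to \<open>m\<close> affect only \<open>A\<close>, the later ones only
  \<open>B\<close>.\<close>

lemma coface_sum_cup:
  fixes A B :: "'b list \<Rightarrow> 'k::{comm_ring,comm_monoid_mult}"
  assumes lz: "length zs = Suc (Suc (m + n))"
  shows "coface_sum (\<lambda>zs. A (take (Suc m) zs) * B (drop m zs)) zs =
    coface_sum A (take (Suc (Suc m)) zs) * B (drop (Suc m) zs) +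
    (- 1) ^ m * (A (take (Suc m) zs) * coface_sum B (drop m zs))"
proof -
  let ?C = "A (take (Suc m) zs) * B (drop (Suc m) zs)"
  have A: "coface_sum A (take (Suc (Suc m)) zs) =
      (\<Sum>i<Suc m. (- 1) ^ i * A (take (Suc m) (del i zs))) - (- 1) ^ m * A (take (Suc m) zs)"
  proof -
    have "del i (take (Suc (Suc m)) zs) = take (Suc m) (del i zs)" if "i < Suc m" for i
      using that lz by (auto simp: del_def take_drop min_def)
    moreover have "del (Suc m) (take (Suc (Suc m)) zs) = take (Suc m) zs"
      using lz by (simp add: del_def)
    moreover have "coface_sum A (take (Suc (Suc m)) zs) =
        (\<Sum>i<Suc (Suc m). (- 1) ^ i * A (del i (take (Suc (Suc m)) zs)))"
      using lz by (simp add: coface_sum_def)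
    ultimately show ?thesis
      by (simp only: sum.lessThan_Suc[of _ "Suc m"] lessThan_iff cong: sum.cong) simp
  qed
  have B: "coface_sum B (drop m zs) =
      B (drop (Suc m) zs) - (\<Sum>j<Suc n. (- 1) ^ j * B (drop m (del (Suc m + j) zs)))"
  proof -
    have eq: "del (Suc j) (drop m zs) = drop m (del (Suc m + j) zs)" if "j < Suc n" for j
      using that lz by (simp add: del_def drop_take add.commute)
    have "coface_sum B (drop m zs) = (\<Sum>i<Suc (Suc n). (- 1) ^ i * B (del i (drop m zs)))"
      using lz by (simp add: coface_sum_def)
    also have "\<dots> = B (del 0 (drop m zs)) + (\<Sum>j<Suc n. (- 1) ^ Suc j * B (del (Suc j) (drop m zs)))"
      by (subst sum.lessThan_Suc_shift) simp
    also have "(\<Sum>j<Suc n. (- 1) ^ Suc j * B (del (Suc j) (drop m zs))) =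
        - (\<Sum>j<Suc n. (- 1) ^ j * B (drop m (del (Suc m + j) zs)))"
      unfolding sum_negf[symmetric] by (intro sum.cong refl) (simp add: eq)
    also have "del 0 (drop m zs) = drop (Suc m) zs" by (simp add: del_def)
    finally show ?thesis by simp
  qed
  have dA: "drop m (del i zs) = drop (Suc m) zs" if "i < Suc m" for i
    using that lz by (simp add: del_def)
  have dB: "take (Suc m) (del (Suc m + j) zs) = take (Suc m) zs" if "j < Suc n" for j
    using that lz by (simp add: del_def)
  have "coface_sum (\<lambda>zs. A (take (Suc m) zs) * B (drop m zs)) zs =
      (\<Sum>i<Suc m + Suc n. (- 1) ^ i * (A (take (Suc m) (del i zs)) * B (drop m (del i zs))))"
    by (simp add: coface_sum_def lz)
  also have "\<dots> = (\<Sum>i<Suc m. (- 1) ^ i * (A (take (Suc m) (del i zs)) * B (drop m (del i zs)))) +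
      (\<Sum>j<Suc n. (- 1) ^ (Suc m + j) * (A (take (Suc m) (del (Suc m + j) zs)) * B (drop m (del (Suc m + j) zs))))"
    by (rule sum_lessThan_add)
  also have "(\<Sum>i<Suc m. (- 1) ^ i * (A (take (Suc m) (del i zs)) * B (drop m (del i zs)))) =
      (\<Sum>i<Suc m. (- 1) ^ i * A (take (Suc m) (del i zs))) * B (drop (Suc m) zs)"
    unfolding sum_distrib_right by (intro sum.cong refl) (simp add: dA mult.assoc)
  also have "(\<Sum>j<Suc n. (- 1) ^ (Suc m + j) * (A (take (Suc m) (del (Suc m + j) zs)) * B (drop m (del (Suc m + j) zs)))) =
      - ((- 1) ^ m * (A (take (Suc m) zs) * (\<Sum>j<Suc n. (- 1) ^ j * B (drop m (del (Suc m + j) zs)))))"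
    unfolding sum_distrib_left sum_negf[symmetric]
    by (intro sum.cong refl) (simp add: dB[simplified] power_add mult_ac)
  finally show ?thesis
    unfolding A B by (simp add: algebra_simps del: sum.lessThan_Suc)
qed

section \<open>Cohomology classes\<close>

lemma lin_ext_add: "lin_ext A \<phi> (F + G) = lin_ext A \<phi> F + lin_ext A \<phi> G"
  by (auto simp: lin_ext_def fun_eq_iff distrib_right sum.distrib)

lemma lin_ext_smult: "lin_ext A \<phi> (\<lambda>x. c * F x) = (\<lambda>y. c * lin_ext A \<phi> F y)"
  by (auto simp: lin_ext_def fun_eq_iff sum_distrib_left mult.assoc)

lemma lin_ext_diff: "lin_ext A \<phi> (F - G) = lin_ext A \<phi> F - lin_ext A \<phi> G"
  by (auto simp: lin_ext_def fun_eq_iff left_diff_distrib sum_subtractf)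

lemma lin_ext_0: "lin_ext A \<phi> 0 = 0"
  by (auto simp: lin_ext_def fun_eq_iff)

lemma d_add: "d r n (F + G) = d r n F + d r n G"
  and d_smult: "d r n (\<lambda>xs. c * F xs) = (\<lambda>xs. c * d r n F xs)"
  and d_diff: "d r n (F - G) = d r n F - d r n G"
  and d_0: "d r n 0 = 0"
  unfolding d_def by (rule lin_ext_add lin_ext_smult lin_ext_diff lin_ext_0)+

lemma coboundaries_0: "0 \<in> coboundaries v r n"
  by (cases n) (auto intro!: image_eqI[of _ _ 0] simp: d_0 cochains_0)

lemma coboundaries_add:
  "F \<in> coboundaries v r n \<Longrightarrow> G \<in> coboundaries v r n \<Longrightarrow> F + G \<in> coboundaries v r n"
  by (cases n) (auto simp: d_add[symmetric] cochains_add)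

lemma coboundaries_smult:
  "F \<in> coboundaries v r n \<Longrightarrow> (\<lambda>xs. c * F xs) \<in> coboundaries v r n"
  by (cases n) (auto simp: d_smult[symmetric] cochains_smult zero_fun_def)

lemma coboundaries_diff:
  "F \<in> coboundaries v r n \<Longrightarrow> G \<in> coboundaries v r n \<Longrightarrow> F - G \<in> coboundaries v r n"
  by (cases n) (auto simp: d_diff[symmetric] cochains_diff)

lemma cocycles_cochains: "F \<in> cocycles v r n \<Longrightarrow> F \<in> cochains v r n"
  by (simp add: cocycles_def)

lemma cocycles_add: "F \<in> cocycles v r n \<Longrightarrow> G \<in> cocycles v r n \<Longrightarrow> F + G \<in> cocycles v r n"
  by (simp add: cocycles_def d_add cochains_add)

lemma cocycles_smult: "F \<in> cocycles v r n \<Longrightarrow> (\<lambda>xs. c * F xs) \<in> cocycles v r n"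
  by (simp add: cocycles_def d_smult cochains_smult zero_fun_def)

lemma equiv_cohomologous: "equiv (cocycles v r n) (cohomologous v r n)"
proof (rule equivI)
  show "cohomologous v r n \<subseteq> cocycles v r n \<times> cocycles v r n"
    by (auto simp: cohomologous_def)
  show "refl_on (cocycles v r n) (cohomologous v r n)"
    by (auto simp: refl_on_def cohomologous_def coboundaries_0)
  show "sym (cohomologous v r n)"
    using coboundaries_diff[OF coboundaries_0, of _ v r n]
    by (force simp: sym_def cohomologous_def)
  show "trans (cohomologous v r n)"
    using coboundaries_add[of _ v r n]
    by (force simp: trans_def cohomologous_def)
qed

lemma coclass_self: "F \<in> cocycles v r n \<Longrightarrow> F \<in> coclass v r n F"
  by (simp add: cohomologous_def coboundaries_0)

lemma coclass_in_cohomology: "F \<in> cocycles v r n \<Longrightarrow> coclass v r n F \<in> cohomology v r n"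
  by (auto simp: cohomology_def intro: quotientI)

lemma cohomologyE:
  assumes "A \<in> cohomology v r n"
  obtains F where "F \<in> cocycles v r n" "A = coclass v r n F"
  using assms by (auto simp: cohomology_def elim!: quotientE)

lemma mem_coclass:
  "G \<in> coclass v r n F \<longleftrightarrow> F \<in> cocycles v r n \<and> G \<in> cocycles v r n \<and> F - G \<in> coboundaries v r n"
  by (simp add: cohomologous_def)

lemma coclass_eq: "G \<in> coclass v r n F \<Longrightarrow> coclass v r n G = coclass v r n F"
  using equiv_class_eq[OF equiv_cohomologous, of F G v r n] by simp

text \<open>The union over representatives in \<open>hadd\<close> collapses because all of them give
  the same class, and \<open>coclass_self\<close> shows that there is at least one. The other
  operations on classes are treated in the same way.\<close>

lemma hadd_coclass:
  assumes "F \<in> cocycles v r n" "G \<in> cocycles v r n"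
  shows "hadd v r n (coclass v r n F) (coclass v r n G) = coclass v r n (F + G)"
proof -
  have "coclass v r n (F' + G') = coclass v r n (F + G)"
    if "F' \<in> coclass v r n F" "G' \<in> coclass v r n G" for F' G'
  proof (rule coclass_eq)
    have "(F - F') + (G - G') \<in> coboundaries v r n"
      using that coboundaries_add by (auto simp: mem_coclass simp del: Image_singleton_iff)
    moreover have "(F - F') + (G - G') = F + G - (F' + G')" by (simp add: algebra_simps)
    ultimately show "F' + G' \<in> coclass v r n (F + G)"
      using that cocycles_add by (auto simp: mem_coclass simp del: Image_singleton_iff)
  qed
  then show ?thesis
    using coclass_self[OF assms(1)] coclass_self[OF assms(2)] unfolding hadd_def by blast
qed

lemma hsmult_coclass:
  assumes "F \<in> cocycles v r n"
  shows "hsmult v r n c (coclass v r n F) = coclass v r n (\<lambda>xs. c * F xs)"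
proof -
  have "coclass v r n (\<lambda>xs. c * F' xs) = coclass v r n (\<lambda>xs. c * F xs)"
    if "F' \<in> coclass v r n F" for F'
  proof (rule coclass_eq)
    have "(\<lambda>xs. c * (F - F') xs) \<in> coboundaries v r n"
      using that coboundaries_smult unfolding mem_coclass by blast
    moreover have "(\<lambda>xs. c * (F - F') xs) = (\<lambda>xs. c * F xs) - (\<lambda>xs. c * F' xs)"
      by (auto simp: right_diff_distrib)
    ultimately show "(\<lambda>xs. c * F' xs) \<in> coclass v r n (\<lambda>xs. c * F xs)"
      using that cocycles_smult by (auto simp: mem_coclass simp del: Image_singleton_iff)
  qed
  then show ?thesis
    using coclass_self[OF assms(1)] unfolding hsmult_def by blast
qed

section \<open>Pullbacks\<close>

lemma pull_add: "pull r s f n (F + G) = pull r s f n F + pull r s f n G"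
  and pull_smult: "pull r s f n (\<lambda>xs. c * F xs) = (\<lambda>xs. c * pull r s f n F xs)"
  and pull_diff: "pull r s f n (F - G) = pull r s f n F - pull r s f n G"
  and pull_0: "pull r s f n 0 = 0"
  unfolding pull_def by (rule lin_ext_add lin_ext_smult lin_ext_diff lin_ext_0)+

lemma pull_eq_0:
  assumes "xs \<notin> chains r n"
  shows "pull r s f n F xs = (0 :: 'k::{comm_ring,comm_monoid_mult})"
proof -
  have "basis_sum {xs \<in> chains r n. map f xs = ys} xs = (0 :: 'k)" for ys
    unfolding basis_sum_def basis_def using assms by (intro sum.neutral) auto
  then show ?thesis by (simp only: pull_def lin_ext_def) simp
qed

text \<open>A list with repetitions has an image with repetitions, so both sides vanish there. On a
  chain whose image collapses, no chain of the target contributes to the sum, and \<open>F\<close>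
  is zero on the image.\<close>

lemma pull_wchain:
  fixes F :: "'q list \<Rightarrow> 'k::{comm_ring,comm_monoid_mult}"
  assumes r: "fin_poset r" and s: "fin_poset s" and F: "F \<in> cochains v s n" and xs: "xs \<in> wchains r n"
  shows "pull r s f n F xs = F (map f xs)"
proof (cases "distinct xs")
  case True
  then have xs: "xs \<in> chains r n" using xs by (simp add: chains_iff)
  have "basis_sum {xs \<in> chains r n. map f xs = ys} xs = (if ys = map f xs then 1 else (0 :: 'k))" for ys
    using xs finite_chains[OF r, of n] by (auto simp: basis_sum_eq)
  then have "pull r s f n F xs = (\<Sum>ys\<in>chains s n. if ys = map f xs then F ys else 0)"
    unfolding pull_def lin_ext_def by (intro sum.cong refl) simp
  then show ?thesis
    using finite_chains[OF s, of n] cochains_eq_0[OF F] by (simp add: sum_if_eq)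
next
  case False
  then show ?thesis
    using cochains_eq_0_not_distinct[OF F, of "map f xs"]
    by (simp add: pull_eq_0 chains_iff distinct_map)
qed

text \<open>The reflection of minimal and of maximal elements is what makes pullbacks preserve the
  subcomplexes; imposing both lets one predicate serve all three variants.\<close>

definition cohom_map :: "'p rel \<Rightarrow> 'q rel \<Rightarrow> ('p \<Rightarrow> 'q) \<Rightarrow> bool" where
  "cohom_map r s f \<longleftrightarrow> fin_poset r \<and> fin_poset s \<and> poset_hom r s f \<and>
     (\<forall>x\<in>Field r. (f x \<in> minimals s \<longrightarrow> x \<in> minimals r) \<and> (f x \<in> maximals s \<longrightarrow> x \<in> maximals r))"

lemma cohom_map_comp:
  "cohom_map r s f \<Longrightarrow> cohom_map s t g \<Longrightarrow> cohom_map r t (g \<circ> f)"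
  unfolding cohom_map_def poset_hom_def Pi_iff by (auto split: prod.splits)

lemma chains_hd_last: "xs \<in> chains r n \<Longrightarrow> xs \<noteq> [] \<and> hd xs \<in> Field r \<and> last xs \<in> Field r"
  by (cases xs) (auto simp: chains_def)

lemma pull_cochains:
  assumes f: "cohom_map r s f" and F: "F \<in> cochains v s n"
  shows "pull r s f n F \<in> cochains v r n"
proof -
  have 1: "xs \<in> chains r n \<and> F (map f xs) \<noteq> 0" if "pull r s f n F xs \<noteq> 0" for xs
    using that pull_eq_0[of xs] pull_wchain[OF _ _ F, of r xs] f
    by (metis chains_iff cohom_map_def)
  show ?thesis
  proof (rule cochainsI)
    fix xs assume "pull r s f n F xs \<noteq> 0"
    then have xs: "xs \<in> chains r n" "F (map f xs) \<noteq> 0" using 1 by auto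
    then show "xs \<in> chains r n" by simp
    note hl = chains_hd_last[OF xs(1)]
    show "hd xs \<in> minimals r" if "v \<in> {Plain, Check}"
      using cochains_hd[OF F xs(2) that] hl f by (simp add: hd_map cohom_map_def)
    show "last xs \<in> maximals r" if "v \<in> {Plain, Hat}"
      using cochains_last[OF F xs(2) that] hl f by (simp add: last_map cohom_map_def)
  qed
qed

lemma coface_sum_cong:
  assumes "\<And>i. i < length xs \<Longrightarrow> F (del i xs) = G (del i xs)"
  shows "coface_sum F xs = coface_sum G xs"
  using assms by (simp add: coface_sum_def)

lemma minimals_below: "x \<in> minimals r \<Longrightarrow> (y, x) \<in> r \<Longrightarrow> y \<in> minimals r"
  unfolding minimals_def by blast

lemma maximals_above: "x \<in> maximals r \<Longrightarrow> (x, y) \<in> r \<Longrightarrow> y \<in> maximals r"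
  unfolding maximals_def by blast

text \<open>A nonzero value at \<open>zs\<close> comes from a nonzero face, whose end is extremal;
  the corresponding end of \<open>zs\<close> lies weakly below, respectively above it, hence is
  extremal too.\<close>

lemma d_cochains:
  assumes r: "fin_poset r" and F: "F \<in> cochains v r n"
  shows "d r n F \<in> cochains v r (Suc n)"
proof -
  have *: "zs \<in> chains r (Suc n) \<and> (\<exists>i\<le>Suc n. F (del i zs) \<noteq> 0)" if "d r n F zs \<noteq> 0" for zs
  proof -
    have zs: "zs \<in> chains r (Suc n)" using that d_eq_0 by metis
    then have "coface_sum F zs \<noteq> 0" using that d_chain[OF r F] by metis
    then have "\<not> (\<forall>i<length zs. F (del i zs) = 0)"
      unfolding coface_sum_def by (metis (no_types, lifting) lessThan_iff mult_zero_right sum.neutral)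
    then show ?thesis using zs wchains_length[of zs r "Suc n"] by (auto simp: chains_iff less_Suc_eq_le)
  qed
  show ?thesis
  proof (rule cochainsI)
    fix zs assume "d r n F zs \<noteq> 0"
    then obtain i where zs: "zs \<in> chains r (Suc n)" and i: "i \<le> Suc n" "F (del i zs) \<noteq> 0"
      using * by blast
    then show "zs \<in> chains r (Suc n)" by blast
    have w: "zs \<in> wchains r (Suc n)" using zs by (simp add: chains_iff)
    note le = wchains_nth_le[OF r w]
    have lz: "length zs = Suc (Suc n)" using w by (rule wchains_length)
    have h: "hd zs = zs ! 0" "hd (del i zs) = zs ! (if i = 0 then 1 else 0)"
      using lz by (auto simp: hd_conv_nth hd_append hd_drop_conv_nth del_def length_0_conv[symmetric] simp del: length_0_conv)
    have l: "last zs = zs ! Suc n" "last (del i zs) = zs ! (if i = Suc n then n else Suc n)"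
      using lz i by (auto simp: last_conv_nth del_def nth_append length_0_conv[symmetric] simp del: length_0_conv)
    show "hd zs \<in> minimals r" if "v \<in> {Plain, Check}"
      using minimals_below[OF cochains_hd[OF F i(2) that], of "hd zs"] le[of 0 0] le[of 0 1] h
      by (cases "i = 0") auto
    show "last zs \<in> maximals r" if "v \<in> {Plain, Hat}"
      using maximals_above[OF cochains_last[OF F i(2) that], of "last zs"] le[of n "Suc n"] le[of "Suc n" "Suc n"] l
      by (cases "i = Suc n") auto
  qed
qed

lemma pull_d:
  assumes f: "cohom_map r s f" and F: "F \<in> cochains v s n"
  shows "pull r s f (Suc n) (d s n F) = d r n (pull r s f n F)"
proof
  fix xs
  have r: "fin_poset r" "fin_poset s" "poset_hom r s f" using f by (auto simp: cohom_map_def)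
  note dF = d_cochains[OF r(2) F]
  show "pull r s f (Suc n) (d s n F) xs = d r n (pull r s f n F) xs"
  proof (cases "xs \<in> chains r (Suc n)")
    case True
    then have xs: "xs \<in> wchains r (Suc n)" by (simp add: chains_iff)
    have "pull r s f (Suc n) (d s n F) xs = coface_sum F (map f xs)"
      using pull_wchain[OF r(1,2) dF xs] d_wchain[OF r(2) F wchains_map[OF r(3) xs]] by simp
    also have "\<dots> = coface_sum (\<lambda>xs. F (map f xs)) xs"
      by (rule coface_sum_map[symmetric])
    also have "\<dots> = coface_sum (pull r s f n F) xs"
      by (rule coface_sum_cong)
        (metis pull_wchain[OF r(1,2) F] del_wchains[OF xs] wchains_length[OF xs] less_Suc_eq_le)
    also have "\<dots> = d r n (pull r s f n F) xs"
      by (rule d_wchain[OF r(1) pull_cochains[OF f F] xs, symmetric])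
    finally show ?thesis .
  qed (simp add: d_eq_0 pull_eq_0)
qed

lemma pull_cocycles:
  assumes f: "cohom_map r s f" and F: "F \<in> cocycles v s n"
  shows "pull r s f n F \<in> cocycles v r n"
proof -
  have "F \<in> cochains v s n" "d s n F = 0" using F by (auto simp: cocycles_def)
  then show ?thesis
    using pull_cochains[OF f, of F v n] pull_d[OF f, of F v n] by (simp add: cocycles_def pull_0)
qed

lemma pull_coboundaries:
  assumes f: "cohom_map r s f" and F: "F \<in> coboundaries v s n"
  shows "pull r s f n F \<in> coboundaries v r n"
proof (cases n)
  case 0
  then show ?thesis using F by (simp add: pull_0)
next
  case (Suc k)
  then obtain H where "H \<in> cochains v s k" "F = d s k H" using F by auto
  then show ?thesis using Suc pull_cochains[OF f, of H v k] pull_d[OF f, of H v k] by simp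
qed

lemma hpull_coclass:
  assumes f: "cohom_map r s f" and F: "F \<in> cocycles v s n"
  shows "hpull v r s f n (coclass v s n F) = coclass v r n (pull r s f n F)"
proof -
  have "coclass v r n (pull r s f n F') = coclass v r n (pull r s f n F)"
    if "F' \<in> coclass v s n F" for F'
    using that pull_cocycles[OF f] pull_coboundaries[OF f, of "F - F'"]
    by (intro coclass_eq) (auto simp: mem_coclass pull_diff simp del: Image_singleton_iff)
  then show ?thesis
    using coclass_self[OF F] unfolding hpull_def by blast
qed

lemma pull_id:
  assumes r: "fin_poset r" and F: "F \<in> cochains v r n"
  shows "pull r r id n F = F"
  using pull_eq_0 cochains_eq_0[OF F] pull_wchain[OF r r F]
  by (metis chains_iff ext list.map_id)

lemma pull_comp:
  assumes f: "cohom_map r s f" and g: "cohom_map s t g" and F: "F \<in> cochains v t n"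
  shows "pull r s f n (pull s t g n F) = pull r t (g \<circ> f) n F"
proof (rule cochains_eqI)
  show "pull r s f n (pull s t g n F) \<in> cochains v r n"
    by (intro pull_cochains f g F)
  show "pull r t (g \<circ> f) n F \<in> cochains v r n"
    by (intro pull_cochains cohom_map_comp[OF f g] F)
  fix xs assume xs: "xs \<in> wchains r n"
  have p: "fin_poset r" "fin_poset s" "fin_poset t" "poset_hom r s f"
    using f g by (auto simp: cohom_map_def)
  show "pull r s f n (pull s t g n F) xs = pull r t (g \<circ> f) n F xs"
    using pull_wchain[OF p(1,2) pull_cochains[OF g F] xs] pull_wchain[OF p(2,3) F wchains_map[OF p(4) xs]]
      pull_wchain[OF p(1,3) F xs] by simp
qed

lemma hpull_comp:
  assumes f: "cohom_map r s f" and g: "cohom_map s t g" and A: "A \<in> cohomology v t n"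
  shows "hpull v r s f n (hpull v s t g n A) = hpull v r t (g \<circ> f) n A"
proof -
  obtain F where F: "F \<in> cocycles v t n" "A = coclass v t n F" using A by (rule cohomologyE)
  show ?thesis
    by (simp only: F(2) hpull_coclass[OF g F(1)] hpull_coclass[OF f pull_cocycles[OF g F(1)]]
        hpull_coclass[OF cohom_map_comp[OF f g] F(1)] pull_comp[OF f g cocycles_cochains[OF F(1)]])
qed

lemma hpull_cohomology:
  assumes f: "cohom_map r s f" and A: "A \<in> cohomology v s n"
  shows "hpull v r s f n A \<in> cohomology v r n"
  using A hpull_coclass[OF f] coclass_in_cohomology[OF pull_cocycles[OF f]] by (metis cohomologyE)

section \<open>Products of posets\<close>

lemma Field_prod_poset:
  assumes "\<And>i. i \<in> I \<Longrightarrow> fin_poset (r i)"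
  shows "Field (prod_poset I r) = (\<Pi>\<^sub>E i\<in>I. Field (r i))"
proof
  show "(\<Pi>\<^sub>E i\<in>I. Field (r i)) \<subseteq> Field (prod_poset I r)"
  proof
    fix u assume "u \<in> (\<Pi>\<^sub>E i\<in>I. Field (r i))"
    then have "(u, u) \<in> prod_poset I r"
      using assms fin_poset_refl by (fastforce simp: prod_poset_def)
    then show "u \<in> Field (prod_poset I r)" by (rule FieldI1)
  qed
qed (auto simp: Field_def prod_poset_def)

lemma prod_poset_le: "(u, v) \<in> prod_poset I r \<Longrightarrow> i \<in> I \<Longrightarrow> (u i, v i) \<in> r i"
  by (simp add: prod_poset_def)

lemma prod_poset_ext:
  assumes "(u, v) \<in> prod_poset I r" "\<And>i. i \<in> I \<Longrightarrow> u i = v i"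
  shows "u = v"
proof (rule PiE_ext)
  show "u \<in> (\<Pi>\<^sub>E i\<in>I. Field (r i))" "v \<in> (\<Pi>\<^sub>E i\<in>I. Field (r i))"
    using assms(1) by (auto simp: prod_poset_def)
qed (rule assms(2))

lemma fin_poset_prod_poset:
  assumes I: "finite I" and r: "\<And>i. i \<in> I \<Longrightarrow> fin_poset (r i)"
  shows "fin_poset (prod_poset I r)"
proof -
  have F: "Field (prod_poset I r) = (\<Pi>\<^sub>E i\<in>I. Field (r i))"
    by (rule Field_prod_poset[OF r])
  have "finite (Field (prod_poset I r))"
    unfolding F using I r by (intro finite_PiE) (auto simp: fin_poset_def)
  moreover have "refl_on (Field (prod_poset I r)) (prod_poset I r)"
    unfolding F refl_on_def using fin_poset_refl[OF r] by (fastforce simp: prod_poset_def)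
  moreover have "trans (prod_poset I r)"
    using fin_poset_trans[OF r] unfolding trans_def prod_poset_def by blast
  moreover have "antisym (prod_poset I r)"
  proof (rule antisymI)
    fix u v assume uv: "(u, v) \<in> prod_poset I r" "(v, u) \<in> prod_poset I r"
    show "u = v"
      using fin_poset_antisym[OF r] prod_poset_le[OF uv(1)] prod_poset_le[OF uv(2)]
      by (intro prod_poset_ext[OF uv(1)]) blast
  qed
  moreover have "prod_poset I r \<subseteq> Field (prod_poset I r) \<times> Field (prod_poset I r)"
    by (auto simp: Field_def)
  ultimately show ?thesis by (simp add: fin_poset_def order_on_defs)
qed

lemma minimals_prod_poset:
  assumes "u \<in> Field (prod_poset I r)" "\<And>i. i \<in> I \<Longrightarrow> u i \<in> minimals (r i)"
  shows "u \<in> minimals (prod_poset I r)"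
  unfolding minimals_def
proof (intro CollectI conjI allI impI assms(1))
  fix v assume "(v, u) \<in> prod_poset I r"
  then show "v = u" using assms(2) by (auto intro!: prod_poset_ext dest: prod_poset_le simp: minimals_def)
qed

lemma maximals_prod_poset:
  assumes "u \<in> Field (prod_poset I r)" "\<And>i. i \<in> I \<Longrightarrow> u i \<in> maximals (r i)"
  shows "u \<in> maximals (prod_poset I r)"
  unfolding maximals_def
proof (intro CollectI conjI allI impI assms(1))
  fix v assume v: "(u, v) \<in> prod_poset I r"
  have "v i = u i" if "i \<in> I" for i
    using assms(2)[OF that] prod_poset_le[OF v that] by (simp add: maximals_def)
  then show "v = u" using prod_poset_ext[OF v] by metis
qed

text \<open>Moving one coordinate while fixing the others is how extremality of a tuple passes to
  each of its coordinates.\<close>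

lemma fun_upd_prod_poset:
  assumes r: "\<And>j. j \<in> I \<Longrightarrow> fin_poset (r j)" and u: "u \<in> (\<Pi>\<^sub>E j\<in>I. Field (r j))" and i: "i \<in> I"
  shows "(x, u i) \<in> r i \<Longrightarrow> (u(i := x), u) \<in> prod_poset I r"
    and "(u i, x) \<in> r i \<Longrightarrow> (u, u(i := x)) \<in> prod_poset I r"
proof -
  have refl: "(u j, u j) \<in> r j" if "j \<in> I" for j
    using u that by (intro fin_poset_refl[OF r]) auto
  have upd: "u(i := x) \<in> (\<Pi>\<^sub>E j\<in>I. Field (r j))" if "x \<in> Field (r i)"
    using u i that by (auto simp: PiE_iff extensional_def)
  show "(x, u i) \<in> r i \<Longrightarrow> (u(i := x), u) \<in> prod_poset I r"
    using u upd[OF FieldI1] refl unfolding prod_poset_def by simp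
  show "(u i, x) \<in> r i \<Longrightarrow> (u, u(i := x)) \<in> prod_poset I r"
    using u upd[OF FieldI2] refl unfolding prod_poset_def by simp
qed

lemma minimals_prod_posetD:
  assumes r: "\<And>j. j \<in> I \<Longrightarrow> fin_poset (r j)" and u: "u \<in> minimals (prod_poset I r)" and i: "i \<in> I"
  shows "u i \<in> minimals (r i)"
proof -
  have F: "u \<in> (\<Pi>\<^sub>E j\<in>I. Field (r j))"
    using u Field_prod_poset[of I r, OF r] by (simp add: minimals_def)
  have "x = u i" if "(x, u i) \<in> r i" for x
  proof -
    have "u(i := x) = u"
      using fun_upd_prod_poset(1)[of I r, OF r F i that] u by (simp add: minimals_def)
    then show ?thesis by (metis fun_upd_same)
  qed
  then show ?thesis using F i by (auto simp: minimals_def)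
qed

lemma maximals_prod_posetD:
  assumes r: "\<And>j. j \<in> I \<Longrightarrow> fin_poset (r j)" and u: "u \<in> maximals (prod_poset I r)" and i: "i \<in> I"
  shows "u i \<in> maximals (r i)"
proof -
  have F: "u \<in> (\<Pi>\<^sub>E j\<in>I. Field (r j))"
    using u Field_prod_poset[of I r, OF r] by (simp add: maximals_def)
  have "x = u i" if "(u i, x) \<in> r i" for x
  proof -
    have "u(i := x) = u"
      using fun_upd_prod_poset(2)[of I r, OF r F i that] u by (simp add: maximals_def)
    then show ?thesis by (metis fun_upd_same)
  qed
  then show ?thesis using F i by (auto simp: maximals_def)
qed

lemma prod_poset_projection:
  assumes "T \<in> I"
  shows "poset_hom (prod_poset I r) (r T) (\<lambda>z. z T)"
  using assms by (auto simp: poset_hom_def prod_poset_def Field_def)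

lemma poset_hom_prod_poset:
  assumes r: "\<And>i. i \<in> I \<Longrightarrow> fin_poset (r i)" and s: "\<And>i. i \<in> I \<Longrightarrow> fin_poset (s i)"
    and f: "\<And>i. i \<in> I \<Longrightarrow> poset_hom (r i) (s i) (f i)"
  shows "poset_hom (prod_poset I r) (prod_poset I s) (\<lambda>u. \<lambda>i\<in>I. f i (u i))"
proof -
  have F: "f i x \<in> Field (s i)" if "i \<in> I" "x \<in> Field (r i)" for i x
    using f[OF that(1)] that(2) by (auto simp: poset_hom_def)
  have L: "(f i x, f i y) \<in> s i" if "i \<in> I" "(x, y) \<in> r i" for i x y
    using f[OF that(1)] that(2) by (auto simp: poset_hom_def)
  have Fu: "(\<lambda>i\<in>I. f i (u i)) \<in> (\<Pi>\<^sub>E i\<in>I. Field (s i))" if "u \<in> (\<Pi>\<^sub>E i\<in>I. Field (r i))" for u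
    using that F by (auto simp: PiE_iff)
  show ?thesis
    unfolding poset_hom_def
  proof (intro conjI ballI Pi_I)
    fix u assume "u \<in> Field (prod_poset I r)"
    then show "(\<lambda>i\<in>I. f i (u i)) \<in> Field (prod_poset I s)"
      using Fu Field_prod_poset[of I r, OF r] Field_prod_poset[of I s, OF s] by simp
  next
    fix p assume "p \<in> prod_poset I r"
    then show "case p of (u, v) \<Rightarrow> (\<lambda>i\<in>I. f i (u i), \<lambda>i\<in>I. f i (v i)) \<in> prod_poset I s"
      using Fu L by (simp add: prod_poset_def split: prod.splits)
  qed
qed

section \<open>Kuenneth maps\<close>

text \<open>A common shape for tuples of cochains, of cocycles and of pairs of cohomologous
  cocycles, according to the family \<open>X\<close>, with an induction that runs through blocks,
  degrees and entries at once.\<close>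

inductive factors :: "('i \<Rightarrow> nat \<Rightarrow> 'c set) \<Rightarrow> 'i list \<Rightarrow> nat list \<Rightarrow> 'c list \<Rightarrow> bool" for X where
  Nil: "factors X [] [] []"
| Cons: "G \<in> X T n \<Longrightarrow> factors X Ts ns Gs \<Longrightarrow> factors X (T # Ts) (n # ns) (G # Gs)"

lemma factors_mono:
  "factors X Ts ns Gs \<Longrightarrow> (\<And>T n G. T \<in> set Ts \<Longrightarrow> G \<in> X T n \<Longrightarrow> h G \<in> Y T n) \<Longrightarrow> factors Y Ts ns (map h Gs)"
  by (induction rule: factors.induct) (auto intro: factors.intros)

lemma factors_append:
  "factors X Ts ns Gs \<Longrightarrow> factors X Ts' ns' Gs' \<Longrightarrow> factors X (Ts @ Ts') (ns @ ns') (Gs @ Gs')"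
  by (induction rule: factors.induct) (auto intro: factors.intros)

lemma factors_iff:
  "factors X Ts ns Gs \<longleftrightarrow> length ns = length Ts \<and> length Gs = length Ts \<and>
     (\<forall>i<length Ts. Gs ! i \<in> X (Ts ! i) (ns ! i))"
proof
  assume "factors X Ts ns Gs"
  then show "length ns = length Ts \<and> length Gs = length Ts \<and> (\<forall>i<length Ts. Gs ! i \<in> X (Ts ! i) (ns ! i))"
    by (induction rule: factors.induct) (auto simp: nth_Cons split: nat.split)
next
  assume *: "length ns = length Ts \<and> length Gs = length Ts \<and> (\<forall>i<length Ts. Gs ! i \<in> X (Ts ! i) (ns ! i))"
  then have "length Ts = length ns" "length ns = length Gs" by auto
  then show "factors X Ts ns Gs" using *
    by (induction Ts ns Gs rule: list_induct3) (auto intro!: factors.intros simp: All_less_Suc2)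
qed

text \<open>Unlike \<open>kunneth\<close>, this product makes sense on lists which are not chains, hence it is an iterated
  cup product of unnormalized cochains.\<close>

fun kprod :: "'i list \<Rightarrow> nat list \<Rightarrow> ('p list \<Rightarrow> 'k) list \<Rightarrow> ('i \<Rightarrow> 'p) list \<Rightarrow> 'k::{comm_ring,comm_monoid_mult}" where
  "kprod (T # Ts) (n # ns) (G # Gs) ws =
     G (map (\<lambda>w. w T) (take (Suc n) ws)) * kprod Ts ns Gs (drop n ws)"
| "kprod _ _ _ ws = 1"

text \<open>The expected coboundary of \<open>kprod\<close>, unfolded by the Leibniz rule one factor
  at a time. In the first summand the remaining segments start one position later, because the head
  has gone up one degree.\<close>

fun dkprod :: "'i list \<Rightarrow> nat list \<Rightarrow> ('p list \<Rightarrow> 'k) list \<Rightarrow> ('i \<Rightarrow> 'p) list \<Rightarrow> 'k::{comm_ring,comm_monoid_mult}" where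
  "dkprod (T # Ts) (n # ns) (G # Gs) ws =
     coface_sum G (map (\<lambda>w. w T) (take (Suc (Suc n)) ws)) * kprod Ts ns Gs (drop (Suc n) ws) +
     (- 1) ^ n * (G (map (\<lambda>w. w T) (take (Suc n) ws)) * dkprod Ts ns Gs (drop n ws))"
| "dkprod _ _ _ ws = 0"

text \<open>Reads off from \<open>zs\<close> the only tuple of coordinate chains whose Kuenneth
  image can contain \<open>zs\<close>.\<close>

fun segs :: "'i list \<Rightarrow> nat list \<Rightarrow> ('i \<Rightarrow> 'p) list \<Rightarrow> 'p list list" where
  "segs (T # Ts) (n # ns) zs = map (\<lambda>z. z T) (take (Suc n) zs) # segs Ts ns (drop n zs)"
| "segs _ _ zs = []"

lemma length_segs: "length ns = length Ts \<Longrightarrow> length (segs Ts ns zs) = length Ts"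
  by (induction Ts ns zs rule: segs.induct) auto

lemma segs_nth:
  "length ns = length Ts \<Longrightarrow> i < length Ts \<Longrightarrow>
     segs Ts ns zs ! i = map (\<lambda>z. z (Ts ! i)) (take (Suc (ns ! i)) (drop (\<Sum>j<i. ns ! j) zs))"
proof (induction Ts ns zs arbitrary: i rule: segs.induct)
  case (1 T Ts n ns zs)
  then show ?case
    by (cases i) (simp_all add: sum.lessThan_Suc_shift add.commute del: sum.lessThan_Suc)
qed auto

lemma kprod_segs:
  "factors X Ts ns Gs \<Longrightarrow> kprod Ts ns Gs zs = prod_list (map2 (\<lambda>G ys. G ys) Gs (segs Ts ns zs))"
  by (induction arbitrary: zs rule: factors.induct) auto

lemma kunneth_eq_0:
  assumes "length Ts = length ns" "zs \<notin> chains (prod_poset (set Ts) r) (sum_list ns)"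
  shows "kunneth r Ts ns Gs zs = (0 :: 'k::{comm_ring,comm_monoid_mult})"
proof -
  have "zs \<notin> kunneth_chains r Ts yss"
    if "yss \<in> listset (map2 (\<lambda>T n. chains (r T) n) Ts ns)" for yss
  proof -
    have "(\<Sum>i<length Ts. length (yss ! i) - 1) = (\<Sum>i<length Ts. ns ! i)"
      using that assms by (intro sum.cong refl) (auto simp: listset_iff list_all2_conv_all_nth chains_def)
    also have "\<dots> = sum_list ns"
      using assms by (simp add: sum_list_sum_nth atLeast0LessThan)
    finally show ?thesis using assms by (simp add: kunneth_chains_def)
  qed
  then have "basis_sum (kunneth_chains r Ts yss) zs = (0 :: 'k)"
    if "yss \<in> listset (map2 (\<lambda>T n. chains (r T) n) Ts ns)" for yss
    using that unfolding basis_sum_def basis_def by (intro sum.neutral) auto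
  then show ?thesis unfolding kunneth_def by (intro sum.neutral) auto
qed

text \<open>For fixed \<open>zs\<close> the condition in \<open>kunneth_chains\<close> determines
  the tuple of chains, so the sum over tuples has at most one nonzero term.\<close>

lemma kunneth_chain:
  fixes Gs :: "('p list \<Rightarrow> 'k::{comm_ring,comm_monoid_mult}) list"
  assumes r: "\<And>T. T \<in> set Ts \<Longrightarrow> fin_poset (r T)"
    and Gs: "factors (\<lambda>T. cochains v (r T)) Ts ns Gs"
    and zs: "zs \<in> chains (prod_poset (set Ts) r) (sum_list ns)"
  shows "kunneth r Ts ns Gs zs = kprod Ts ns Gs zs"
proof -
  let ?L = "listset (map2 (\<lambda>T n. chains (r T) n) Ts ns)"
  let ?p = "\<lambda>yss. prod_list (map2 (\<lambda>G ys. G ys) Gs yss)"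
  have len: "length ns = length Ts" "length Gs = length Ts" using Gs by (auto simp: factors_iff)
  have L: "yss \<in> ?L \<longleftrightarrow> length yss = length Ts \<and> (\<forall>i<length Ts. yss ! i \<in> chains (r (Ts ! i)) (ns ! i))" for yss
    using len by (auto simp: listset_iff list_all2_conv_all_nth)
  have fin: "finite ?L"
    using r by (intro finite_listset) (auto simp: set_zip intro!: finite_chains)
  have "basis_sum (kunneth_chains r Ts yss) zs = (if yss = segs Ts ns zs then 1 else (0 :: 'k))"
    if yss: "yss \<in> ?L" for yss
  proof -
    have l: "length (yss ! i) = Suc (ns ! i)" if "i < length Ts" for i
      using yss that L by (auto simp: chains_def)
    have "(\<Sum>i<length Ts. length (yss ! i) - 1) = (\<Sum>i<length Ts. ns ! i)"
      using l by (intro sum.cong) auto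
    also have "\<dots> = sum_list ns"
      using len by (simp add: sum_list_sum_nth atLeast0LessThan)
    finally have s: "(\<Sum>i<length Ts. length (yss ! i) - 1) = sum_list ns" .
    have s': "(\<Sum>j<i. length (yss ! j) - 1) = (\<Sum>j<i. ns ! j)" if "i < length Ts" for i
      using l that by (intro sum.cong) auto
    have e: "map (\<lambda>z. z (Ts ! i)) (take (length (yss ! i)) (drop (\<Sum>j<i. length (yss ! j) - 1) zs)) =
        segs Ts ns zs ! i" if "i < length Ts" for i
      by (simp only: l[OF that] s'[OF that] segs_nth[OF len(1) that])
    have "finite (kunneth_chains r Ts yss)"
      unfolding kunneth_chains_def
      by (intro finite_Collect_conjI disjI1) (simp add: finite_chains fin_poset_prod_poset r)
    moreover have "zs \<in> kunneth_chains r Ts yss \<longleftrightarrow> (\<forall>i<length Ts. segs Ts ns zs ! i = yss ! i)"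
      unfolding kunneth_chains_def s mem_Collect_eq by (simp only: zs e simp_thms cong: imp_cong)
    moreover have "\<dots> \<longleftrightarrow> yss = segs Ts ns zs"
      using length_segs[OF len(1), of zs] conjunct1[OF iffD1[OF L yss]] unfolding list_eq_iff_nth_eq by metis
    ultimately show ?thesis by (simp add: basis_sum_eq)
  qed
  then have "kunneth r Ts ns Gs zs = (\<Sum>yss\<in>?L. if yss = segs Ts ns zs then ?p yss else 0)"
    unfolding kunneth_def by (intro sum.cong refl) simp
  also have "\<dots> = (if segs Ts ns zs \<in> ?L then ?p (segs Ts ns zs) else 0)"
    using fin by (simp add: sum_if_eq)
  also have "\<dots> = ?p (segs Ts ns zs)"
  \<comment> \<open>If some segment is not a chain, the tuple is missing from the sum; the product
    vanishes as well, because the cochain at that segment does.\<close>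
  proof (cases "segs Ts ns zs \<in> ?L")
    case False
    then obtain i where i: "i < length Ts" "segs Ts ns zs ! i \<notin> chains (r (Ts ! i)) (ns ! i)"
      using L length_segs[OF len(1), of zs] by auto
    have "(Gs ! i) (segs Ts ns zs ! i) = 0"
      using Gs i by (intro cochains_eq_0[of _ v "r (Ts ! i)" "ns ! i"]) (auto simp: factors_iff)
    then have "map2 (\<lambda>G ys. G ys) Gs (segs Ts ns zs) ! i = 0"
      using i len length_segs[OF len(1), of zs] by simp
    then have "0 \<in> set (map2 (\<lambda>G ys. G ys) Gs (segs Ts ns zs))"
      using i len length_segs[OF len(1), of zs] by (metis length_map map_fst_zip nth_mem)
    then show ?thesis using False by (simp only: prod_list_eq_0 if_False)
  qed simp
  finally show ?thesis by (simp only: kprod_segs[OF Gs])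
qed

text \<open>Consecutive segments overlap in one position, so each step from \<open>k\<close> to
  \<open>Suc k\<close> lies within a single segment. Equal entries there make the coordinate list of
  that segment repeat, and its factor is zero.\<close>

lemma kprod_eq_0_adjacent:
  assumes "factors X Ts ns Gs" "\<And>T n G xs. T \<in> set Ts \<Longrightarrow> G \<in> X T n \<Longrightarrow> \<not> distinct xs \<Longrightarrow> G xs = 0"
    and "length zs = Suc (sum_list ns)" "Suc k < length zs" "zs ! k = zs ! Suc k"
  shows "kprod Ts ns Gs zs = 0"
  using assms
proof (induction arbitrary: zs k rule: factors.induct)
  case (Cons G T n Ts ns Gs)
  show ?case
  proof (cases "k < n")
    case True
    let ?xs = "map (\<lambda>w. w T) (take (Suc n) zs)"
    have "?xs ! k = ?xs ! Suc k" "Suc k < length ?xs" using Cons.prems True by auto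
    then have "\<not> distinct ?xs" by (metis Suc_lessD n_not_Suc_n nth_eq_iff_index_eq)
    then have "G ?xs = 0" by (rule Cons.prems(1)[rotated 2]) (use Cons.hyps in auto)
    then show ?thesis by simp
  next
    case False
    then have "kprod Ts ns Gs (drop n zs) = 0"
      using Cons.prems by (intro Cons.IH[of "drop n zs" "k - n"]) auto
    then show ?thesis by simp
  qed
qed simp

lemma kunneth_wchain:
  assumes r: "\<And>T. T \<in> set Ts \<Longrightarrow> fin_poset (r T)"
    and Gs: "factors (\<lambda>T. cochains v (r T)) Ts ns Gs"
    and zs: "zs \<in> wchains (prod_poset (set Ts) r) (sum_list ns)"
  shows "kunneth r Ts ns Gs zs = kprod Ts ns Gs zs"
proof (cases "distinct zs")
  case True
  then show ?thesis using kunneth_chain[OF r Gs] zs by (simp add: chains_iff)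
next
  case False
  obtain k where "Suc k \<le> sum_list ns" "zs ! k = zs ! Suc k"
    using not_distinct_adjacent[OF fin_poset_prod_poset[OF _ r] zs False] by blast
  then have "kprod Ts ns Gs zs = 0"
    using wchains_length[OF zs] cochains_eq_0_not_distinct
    by (intro kprod_eq_0_adjacent[OF Gs]) auto
  moreover have "kunneth r Ts ns Gs zs = 0"
    using False Gs by (intro kunneth_eq_0) (auto simp: chains_iff factors_iff)
  ultimately show ?thesis by simp
qed

text \<open>Tests only the coordinates in \<open>Ts\<close> and asks for no elements of a product
  poset, so that it passes to the tail of \<open>Ts\<close> in inductions over the factors.\<close>

definition cwchains :: "('i \<Rightarrow> 'p rel) \<Rightarrow> 'i list \<Rightarrow> nat \<Rightarrow> ('i \<Rightarrow> 'p) list set" where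
  "cwchains r Ts n = {ws. length ws = Suc n \<and> (\<forall>T\<in>set Ts. map (\<lambda>w. w T) ws \<in> wchains (r T) n)}"

lemma wchains_cwchains: "ws \<in> wchains (prod_poset (set Ts) r) n \<Longrightarrow> ws \<in> cwchains r Ts n"
  by (auto simp: cwchains_def wchains_length intro!: wchains_map prod_poset_projection)

lemma cwchains_drop: "ws \<in> cwchains r Ts (m + n) \<Longrightarrow> drop m ws \<in> cwchains r Ts n"
  by (auto simp: cwchains_def drop_map[symmetric] intro: wchains_drop)

lemma cwchains_Cons:
  "ws \<in> cwchains r (T # Ts) n \<longleftrightarrow> map (\<lambda>w. w T) ws \<in> wchains (r T) n \<and> ws \<in> cwchains r Ts n"
  by (auto simp: cwchains_def wchains_length)

lemma cwchains_le:
  assumes "T \<in> set Ts" "fin_poset (r T)" "ws \<in> cwchains r Ts n" "i \<le> j" "j \<le> n"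
  shows "((ws ! i) T, (ws ! j) T) \<in> r T"
proof -
  have "map (\<lambda>w. w T) ws \<in> wchains (r T) n" and "length ws = Suc n"
    using assms by (auto simp: cwchains_def)
  then show ?thesis using wchains_nth_le[OF assms(2) _ assms(4,5)] assms by fastforce
qed

text \<open>The chain of the head coordinate starts at position 0. The other coordinates are minimal
  at the later position \<open>n\<close> by induction, hence already at 0, where they are weakly
  smaller.\<close>

lemma kprod_hd:
  assumes "factors (\<lambda>T. cochains v (r T)) Ts ns Gs" "\<And>T. T \<in> set Ts \<Longrightarrow> fin_poset (r T)"
    and "v \<in> {Plain, Check}" "ws \<in> cwchains r Ts (sum_list ns)" "kprod Ts ns Gs ws \<noteq> 0"
  shows "\<forall>T\<in>set Ts. (ws ! 0) T \<in> minimals (r T)"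
  using assms
proof (induction arbitrary: ws rule: factors.induct)
  case (Cons G T n Ts ns Gs)
  have lw: "length ws = Suc (n + sum_list ns)" using Cons.prems by (simp add: cwchains_def)
  have nz: "G (map (\<lambda>w. w T) (take (Suc n) ws)) \<noteq> 0" "kprod Ts ns Gs (drop n ws) \<noteq> 0"
    using Cons.prems by auto
  have G: "hd (map (\<lambda>w. w T) (take (Suc n) ws)) \<in> minimals (r T)"
    using cochains_hd[OF Cons.hyps(1) nz(1)] Cons.prems by simp
  have "drop n ws \<in> cwchains r Ts (sum_list ns)"
    using Cons.prems by (intro cwchains_drop) (simp add: cwchains_Cons)
  then have K: "\<forall>U\<in>set Ts. (drop n ws ! 0) U \<in> minimals (r U)"
    using Cons.IH[of "drop n ws"] Cons.prems nz(2) by simp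
  have "(ws ! 0) T \<in> minimals (r T)"
    using G lw by (cases ws) auto
  moreover have "(ws ! 0) U \<in> minimals (r U)" if "U \<in> set Ts" for U
  proof (rule minimals_below)
    show "(ws ! n) U \<in> minimals (r U)" using K that lw by simp
    show "((ws ! 0) U, (ws ! n) U) \<in> r U"
      using that Cons.prems(1,3) by (intro cwchains_le[of U "T # Ts" r ws "n + sum_list ns"]) simp_all
  qed
  ultimately show ?case by auto
qed simp

text \<open>The head coordinate is maximal at position \<open>n\<close>, where its segment ends, and
  stays maximal up to the end of the list. The induction covers the other coordinates.\<close>

lemma kprod_last:
  assumes "factors (\<lambda>T. cochains v (r T)) Ts ns Gs" "\<And>T. T \<in> set Ts \<Longrightarrow> fin_poset (r T)"
    and "v \<in> {Plain, Hat}" "ws \<in> cwchains r Ts (sum_list ns)" "kprod Ts ns Gs ws \<noteq> 0"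
  shows "\<forall>T\<in>set Ts. (ws ! sum_list ns) T \<in> maximals (r T)"
  using assms
proof (induction arbitrary: ws rule: factors.induct)
  case (Cons G T n Ts ns Gs)
  have lw: "length ws = Suc (n + sum_list ns)" using Cons.prems by (simp add: cwchains_def)
  have nz: "G (map (\<lambda>w. w T) (take (Suc n) ws)) \<noteq> 0" "kprod Ts ns Gs (drop n ws) \<noteq> 0"
    using Cons.prems by auto
  have G: "last (map (\<lambda>w. w T) (take (Suc n) ws)) \<in> maximals (r T)"
    using cochains_last[OF Cons.hyps(1) nz(1)] Cons.prems by simp
  have "drop n ws \<in> cwchains r Ts (sum_list ns)"
    using Cons.prems by (intro cwchains_drop) (simp add: cwchains_Cons)
  then have K: "\<forall>U\<in>set Ts. (drop n ws ! sum_list ns) U \<in> maximals (r U)"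
    using Cons.IH[of "drop n ws"] Cons.prems nz(2) by simp
  have "(ws ! n) T \<in> maximals (r T)"
    using G lw by (simp add: take_Suc_conv_app_nth)
  moreover have "((ws ! n) T, (ws ! (n + sum_list ns)) T) \<in> r T"
    using Cons.prems(1,3) by (intro cwchains_le[of T "T # Ts" r ws "n + sum_list ns"]) simp_all
  ultimately have "(ws ! (n + sum_list ns)) T \<in> maximals (r T)"
    by (rule maximals_above)
  then show ?case using K lw by auto
qed simp

lemma kunneth_cochains:
  assumes r: "\<And>T. T \<in> set Ts \<Longrightarrow> fin_poset (r T)"
    and Gs: "factors (\<lambda>T. cochains v (r T)) Ts ns Gs"
  shows "kunneth r Ts ns Gs \<in> cochains v (prod_poset (set Ts) r) (sum_list ns)"
proof -
  have len: "length Ts = length ns" using Gs by (simp add: factors_iff)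
  show ?thesis
  proof (rule cochainsI)
    fix zs assume nz: "kunneth r Ts ns Gs zs \<noteq> 0"
    then show zs: "zs \<in> chains (prod_poset (set Ts) r) (sum_list ns)"
      using kunneth_eq_0[OF len] by blast
    have kz: "kprod Ts ns Gs zs \<noteq> 0"
      using nz kunneth_chain[OF r Gs zs] by simp
    have w: "zs \<in> wchains (prod_poset (set Ts) r) (sum_list ns)" using zs by (simp add: chains_iff)
    note cw = wchains_cwchains[OF w] and lz = wchains_length[OF w]
    have "zs \<noteq> []" using lz by auto
    then have hl: "hd zs = zs ! 0" "last zs = zs ! sum_list ns"
      using lz by (auto simp: hd_conv_nth last_conv_nth)
    have f: "hd zs \<in> Field (prod_poset (set Ts) r)" "last zs \<in> Field (prod_poset (set Ts) r)"
      using chains_hd_last[OF zs] by simp_all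
    show "hd zs \<in> minimals (prod_poset (set Ts) r)" if "v \<in> {Plain, Check}"
      using kprod_hd[OF Gs r that cw kz] hl by (intro minimals_prod_poset f) simp
    show "last zs \<in> maximals (prod_poset (set Ts) r)" if "v \<in> {Plain, Hat}"
      using kprod_last[OF Gs r that cw kz] hl by (intro maximals_prod_poset f) simp
  qed
qed

lemma coface_sum_kprod:
  fixes Gs :: "('p list \<Rightarrow> 'k::{comm_ring,comm_monoid_mult}) list"
  assumes "factors X Ts ns Gs" "length ws = Suc (Suc (sum_list ns))"
  shows "coface_sum (kprod Ts ns Gs) ws = dkprod Ts ns Gs ws"
  using assms
proof (induction arbitrary: ws rule: factors.induct)
  case Nil
  \<comment> \<open>The empty product is constantly 1 and \<open>ws\<close> has two entries, so its
    two faces cancel.\<close>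
  then show ?case by (simp add: coface_sum_def)
next
  case (Cons G T n Ts ns Gs)
  have "coface_sum (kprod (T # Ts) (n # ns) (G # Gs)) ws =
      coface_sum (\<lambda>ws. (\<lambda>xs. G (map (\<lambda>w. w T) xs)) (take (Suc n) ws) * kprod Ts ns Gs (drop n ws)) ws"
    by (rule coface_sum_cong) simp
  also have "\<dots> = dkprod (T # Ts) (n # ns) (G # Gs) ws"
    using Cons by (subst coface_sum_cup[of _ n "sum_list ns"]) (simp_all add: coface_sum_map)
  finally show ?case .
qed

section \<open>Kuenneth products of cocycles and of cohomologous factors\<close>

lemma coface_sum_cocycle:
  "fin_poset r \<Longrightarrow> F \<in> cocycles v r n \<Longrightarrow> xs \<in> wchains r (Suc n) \<Longrightarrow> coface_sum F xs = 0"
  using d_wchain[of r F v n xs] by (simp add: cocycles_def)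

lemma cwchains_take: "ws \<in> cwchains r (T # Ts) n \<Longrightarrow> m \<le> n \<Longrightarrow>
    map (\<lambda>w. w T) (take (Suc m) ws) \<in> wchains (r T) m"
  by (auto simp: cwchains_def take_map[symmetric] intro: wchains_take)

text \<open>Every term of the Leibniz expansion contains the coboundary of one of the
  factors.\<close>

lemma dkprod_cocycles:
  assumes "factors (\<lambda>T. cocycles v (r T)) Ts ns Gs" "\<And>T. T \<in> set Ts \<Longrightarrow> fin_poset (r T)"
    and "ws \<in> cwchains r Ts (Suc (sum_list ns))"
  shows "dkprod Ts ns Gs ws = 0"
  using assms
proof (induction arbitrary: ws rule: factors.induct)
  case (Cons G T n Ts ns Gs)
  have "coface_sum G (map (\<lambda>w. w T) (take (Suc (Suc n)) ws)) = 0"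
    using Cons.prems by (intro coface_sum_cocycle[OF _ Cons.hyps(1)] cwchains_take) auto
  moreover have "dkprod Ts ns Gs (drop n ws) = 0"
    using Cons.prems by (intro Cons.IH cwchains_drop) (auto simp: cwchains_Cons)
  ultimately show ?case by simp
qed simp

text \<open>With cocycles in all other slots only the term that differentiates \<open>H\<close>
  survives; moving past the factors \<open>As\<close> produces the sign. The degree of the slot is
  \<open>k\<close> on the left and \<open>Suc k\<close> on the right, where it holds the
  differential of \<open>H\<close>.\<close>

lemma dkprod_slot:
  assumes "factors (\<lambda>T. cocycles v (r T)) Ts1 ns1 As" "\<And>U. U \<in> set (Ts1 @ T # Ts2) \<Longrightarrow> fin_poset (r U)"
    and "H \<in> cochains v (r T) k" "factors (\<lambda>T. cocycles v (r T)) Ts2 ns2 Bs"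
    and "ws \<in> cwchains r (Ts1 @ T # Ts2) (sum_list ns1 + Suc k + sum_list ns2)"
  shows "dkprod (Ts1 @ T # Ts2) (ns1 @ k # ns2) (As @ H # Bs) ws =
    (- 1) ^ sum_list ns1 * kprod (Ts1 @ T # Ts2) (ns1 @ Suc k # ns2) (As @ d (r T) k H # Bs) ws"
  using assms
proof (induction arbitrary: ws rule: factors.induct)
  case Nil
  have "coface_sum H (map (\<lambda>w. w T) (take (Suc (Suc k)) ws)) =
      d (r T) k H (map (\<lambda>w. w T) (take (Suc (Suc k)) ws))"
    using Nil by (intro d_wchain[symmetric] cwchains_take) auto
  moreover have "dkprod Ts2 ns2 Bs (drop k ws) = 0"
    using Nil by (intro dkprod_cocycles[OF Nil(3)] cwchains_drop) (auto simp: cwchains_Cons)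
  ultimately show ?case by simp
next
  case (Cons G U n Ts ns Gs)
  have "coface_sum G (map (\<lambda>w. w U) (take (Suc (Suc n)) ws)) = 0"
    using Cons.prems by (intro coface_sum_cocycle[OF _ Cons.hyps(1)] cwchains_take) auto
  moreover have "dkprod (Ts @ T # Ts2) (ns @ k # ns2) (Gs @ H # Bs) (drop n ws) =
    (- 1) ^ sum_list ns * kprod (Ts @ T # Ts2) (ns @ Suc k # ns2) (Gs @ d (r T) k H # Bs) (drop n ws)"
    using Cons.prems by (intro Cons.IH cwchains_drop) (auto simp: cwchains_Cons add.assoc)
  ultimately show ?case by (simp add: power_add mult_ac)
qed

lemma d_kunneth:
  assumes r: "\<And>T. T \<in> set Ts \<Longrightarrow> fin_poset (r T)"
    and Gs: "factors (\<lambda>T. cochains v (r T)) Ts ns Gs"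
    and zs: "zs \<in> wchains (prod_poset (set Ts) r) (Suc (sum_list ns))"
  shows "d (prod_poset (set Ts) r) (sum_list ns) (kunneth r Ts ns Gs) zs = dkprod Ts ns Gs zs"
proof -
  have p: "fin_poset (prod_poset (set Ts) r)" by (rule fin_poset_prod_poset[OF _ r]) simp
  have "d (prod_poset (set Ts) r) (sum_list ns) (kunneth r Ts ns Gs) zs = coface_sum (kunneth r Ts ns Gs) zs"
    by (rule d_wchain[OF p kunneth_cochains[OF r Gs] zs])
  also have "\<dots> = coface_sum (kprod Ts ns Gs) zs"
    using wchains_length[OF zs] del_wchains[OF zs] kunneth_wchain[OF r Gs] by (intro coface_sum_cong) auto
  also have "\<dots> = dkprod Ts ns Gs zs"
    using wchains_length[OF zs] by (intro coface_sum_kprod[OF Gs])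
  finally show ?thesis .
qed

lemma factors_cocycles_cochains:
  "factors (\<lambda>T. cocycles v (r T)) Ts ns Gs \<Longrightarrow> factors (\<lambda>T. cochains v (r T)) Ts ns Gs"
  by (auto simp: factors_iff intro: cocycles_cochains)

lemma kunneth_cocycles:
  assumes r: "\<And>T. T \<in> set Ts \<Longrightarrow> fin_poset (r T)"
    and Gs: "factors (\<lambda>T. cocycles v (r T)) Ts ns Gs"
  shows "kunneth r Ts ns Gs \<in> cocycles v (prod_poset (set Ts) r) (sum_list ns)"
proof -
  note Gs' = factors_cocycles_cochains[OF Gs]
  have "d (prod_poset (set Ts) r) (sum_list ns) (kunneth r Ts ns Gs) zs = 0" for zs
    using d_eq_0[of zs] d_kunneth[OF r Gs', of zs] dkprod_cocycles[OF Gs r wchains_cwchains, of zs]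
    by (metis chains_iff)
  then show ?thesis using kunneth_cochains[OF r Gs'] by (auto simp: cocycles_def)
qed

lemma kprod_diff_slot:
  assumes "factors X Ts1 ns1 As"
  shows "kprod (Ts1 @ T # Ts2) (ns1 @ n # ns2) (As @ (G - G') # Bs) ws =
    kprod (Ts1 @ T # Ts2) (ns1 @ n # ns2) (As @ G # Bs) ws -
    kprod (Ts1 @ T # Ts2) (ns1 @ n # ns2) (As @ G' # Bs) ws"
  using assms by (induction arbitrary: ws rule: factors.induct) (simp_all add: left_diff_distrib right_diff_distrib)

lemma kprod_0_slot:
  assumes "factors X Ts1 ns1 As"
  shows "kprod (Ts1 @ T # Ts2) (ns1 @ n # ns2) (As @ 0 # Bs) ws = 0"
  using assms by (induction arbitrary: ws rule: factors.induct) simp_all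

text \<open>If one factor changes by the differential of \<open>H\<close>, the product changes by
  the differential of the product with \<open>H\<close> in that slot, up to the sign of
  \<open>dkprod_slot\<close>.\<close>

lemma kunneth_cohomologous_slot:
  assumes r: "\<And>U. U \<in> set (Ts1 @ T # Ts2) \<Longrightarrow> fin_poset (r U)"
    and As: "factors (\<lambda>T. cocycles v (r T)) Ts1 ns1 As" and Bs: "factors (\<lambda>T. cocycles v (r T)) Ts2 ns2 Bs"
    and G: "(G, G') \<in> cohomologous v (r T) n"
  defines "Ts \<equiv> Ts1 @ T # Ts2" and "ns \<equiv> ns1 @ n # ns2"
  shows "kunneth r Ts ns (As @ G # Bs) - kunneth r Ts ns (As @ G' # Bs)
    \<in> coboundaries v (prod_poset (set Ts) r) (sum_list ns)"
proof -
  let ?p = "prod_poset (set Ts) r"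
  have r: "\<And>T. T \<in> set Ts \<Longrightarrow> fin_poset (r T)" using r by (simp add: Ts_def)
  have G': "G \<in> cochains v (r T) n" "G' \<in> cochains v (r T) n" "G - G' \<in> coboundaries v (r T) n"
    using G by (auto simp: cohomologous_def cocycles_cochains)
  have fac: "factors (\<lambda>T. cochains v (r T)) Ts (ns1 @ k # ns2) (As @ H # Bs)"
    if "H \<in> cochains v (r T) k" for H k
    unfolding Ts_def using that As Bs by (intro factors_append factors.Cons factors_cocycles_cochains)
  note C = kunneth_cochains[OF r fac] and W = kunneth_wchain[OF r fac]
  have diff: "kunneth r Ts ns (As @ G # Bs) - kunneth r Ts ns (As @ G' # Bs) = kunneth r Ts ns (As @ (G - G') # Bs)"
  proof (rule cochains_eqI)
    show "kunneth r Ts ns (As @ G # Bs) - kunneth r Ts ns (As @ G' # Bs) \<in> cochains v ?p (sum_list ns)"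
      unfolding ns_def by (intro cochains_diff C G')
    show "kunneth r Ts ns (As @ (G - G') # Bs) \<in> cochains v ?p (sum_list ns)"
      unfolding ns_def by (intro cochains_diff C G')
    fix xs assume "xs \<in> wchains ?p (sum_list ns)"
    note W = W[OF _ _ this[unfolded ns_def], folded ns_def]
    show "(kunneth r Ts ns (As @ G # Bs) - kunneth r Ts ns (As @ G' # Bs)) xs = kunneth r Ts ns (As @ (G - G') # Bs) xs"
      using kprod_diff_slot[OF As, of T Ts2 n ns2 G G' Bs xs]
      by (simp add: W G' cochains_diff) (simp add: Ts_def ns_def)
  qed
  show ?thesis
  proof (cases n)
    \<comment> \<open>In degree 0 the only coboundary is 0, so the two factors are equal.\<close>
    case 0
    then have "G - G' = 0" using G' by simp
    then have "kunneth r Ts ns (As @ (G - G') # Bs) = 0"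
      using kprod_0_slot[OF As, of T Ts2 n ns2 Bs] C[OF _ cochains_0] W[OF _ cochains_0] cochains_0
      by (intro cochains_eqI[of _ v ?p "sum_list ns"]) (auto simp: ns_def Ts_def)
    then show ?thesis using diff by (simp add: coboundaries_0)
  next
    case (Suc k)
    then obtain H where H: "H \<in> cochains v (r T) k" "G - G' = d (r T) k H" using G' by auto
    let ?ns = "ns1 @ k # ns2"
    have s: "sum_list ns = Suc (sum_list ?ns)" by (simp add: ns_def Suc)
    have d: "d ?p (sum_list ?ns) (kunneth r Ts ?ns (As @ H # Bs)) =
        (\<lambda>xs. (- 1) ^ sum_list ns1 * kunneth r Ts ns (As @ (G - G') # Bs) xs)"
    proof (rule cochains_eqI)
      show "d ?p (sum_list ?ns) (kunneth r Ts ?ns (As @ H # Bs)) \<in> cochains v ?p (sum_list ns)"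
        unfolding s by (intro d_cochains fin_poset_prod_poset C r H) simp
      show "(\<lambda>xs. (- 1) ^ sum_list ns1 * kunneth r Ts ns (As @ (G - G') # Bs) xs) \<in> cochains v ?p (sum_list ns)"
        unfolding ns_def by (intro cochains_smult C cochains_diff G')
      fix xs assume xs: "xs \<in> wchains ?p (sum_list ns)"
      have "d ?p (sum_list ?ns) (kunneth r Ts ?ns (As @ H # Bs)) xs = dkprod Ts ?ns (As @ H # Bs) xs"
        by (rule d_kunneth[OF r fac[OF H(1)] xs[unfolded s]])
      also have "\<dots> = (- 1) ^ sum_list ns1 * kprod Ts ns (As @ (G - G') # Bs) xs"
        using wchains_cwchains[OF xs] r unfolding Ts_def ns_def H(2) Suc
        by (intro dkprod_slot[OF As _ H(1) Bs]) (simp_all add: add.assoc)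
      also have "kprod Ts ns (As @ (G - G') # Bs) xs = kunneth r Ts ns (As @ (G - G') # Bs) xs"
        using W[OF _ cochains_diff[OF G'(1,2)]] xs by (simp add: ns_def)
      finally show "d ?p (sum_list ?ns) (kunneth r Ts ?ns (As @ H # Bs)) xs =
        (- 1) ^ sum_list ns1 * kunneth r Ts ns (As @ (G - G') # Bs) xs" .
    qed
    have "d ?p (sum_list ?ns) (kunneth r Ts ?ns (As @ H # Bs)) \<in> coboundaries v ?p (sum_list ns)"
      unfolding s using C[OF _ H(1)] by auto
    \<comment> \<open>The sign squares to 1, so multiplying by it once more removes it.\<close>
    from coboundaries_smult[OF this, of "(- 1) ^ sum_list ns1"]
    show ?thesis unfolding diff d by (simp add: sign_mult_self)
  qed
qed

text \<open>The factors are exchanged one at a time from left to right, and the differences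
  telescope. The prefix \<open>As\<close> of cocycles that are already in place is kept arbitrary
  for the induction.\<close>

lemma kunneth_cohomologous:
  assumes "factors (\<lambda>T. cohomologous v (r T)) Ts2 ns2 GGs"
    and "factors (\<lambda>T. cocycles v (r T)) Ts1 ns1 As" "\<And>T. T \<in> set (Ts1 @ Ts2) \<Longrightarrow> fin_poset (r T)"
  shows "kunneth r (Ts1 @ Ts2) (ns1 @ ns2) (As @ map fst GGs) - kunneth r (Ts1 @ Ts2) (ns1 @ ns2) (As @ map snd GGs)
    \<in> coboundaries v (prod_poset (set (Ts1 @ Ts2)) r) (sum_list (ns1 @ ns2))"
  using assms
proof (induction arbitrary: Ts1 ns1 As rule: factors.induct)
  case Nil
  then show ?case by (simp only: list.map diff_self coboundaries_0)
next
  case (Cons GG T n Ts ns GGs)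
  obtain G G' where GG: "GG = (G, G')" by (cases GG)
  let ?K = "kunneth r (Ts1 @ T # Ts) (ns1 @ n # ns)"
  have G': "G' \<in> cocycles v (r T) n" using Cons.hyps(1) GG by (simp add: cohomologous_def)
  have "factors (\<lambda>T. cocycles v (r T)) Ts ns (map fst GGs)"
    by (rule factors_mono[OF Cons.hyps(2)]) (auto simp: cohomologous_def)
  then have "?K (As @ G # map fst GGs) - ?K (As @ G' # map fst GGs)
      \<in> coboundaries v (prod_poset (set (Ts1 @ T # Ts)) r) (sum_list (ns1 @ n # ns))"
    using Cons.hyps(1) Cons.prems unfolding GG by (intro kunneth_cohomologous_slot) simp_all
  moreover have "?K (As @ G' # map fst GGs) - ?K (As @ G' # map snd GGs)
      \<in> coboundaries v (prod_poset (set (Ts1 @ T # Ts)) r) (sum_list (ns1 @ n # ns))"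
  proof -
    \<comment> \<open>The exchanged factor \<open>G'\<close> joins the fixed prefix before the
      induction hypothesis is applied to the remaining ones.\<close>
    have "factors (\<lambda>T. cocycles v (r T)) (Ts1 @ [T]) (ns1 @ [n]) (As @ [G'])"
      using Cons.prems G' by (auto intro!: factors_append factors.intros)
    moreover have "fin_poset (r U)" if "U \<in> set ((Ts1 @ [T]) @ Ts)" for U
      using that Cons.prems(2) by simp
    ultimately show ?thesis
      using Cons.IH[of "Ts1 @ [T]" "ns1 @ [n]" "As @ [G']"] by (simp only: append_assoc append.simps)
  qed
  ultimately have "(?K (As @ G # map fst GGs) - ?K (As @ G' # map fst GGs)) +
      (?K (As @ G' # map fst GGs) - ?K (As @ G' # map snd GGs))
      \<in> coboundaries v (prod_poset (set (Ts1 @ T # Ts)) r) (sum_list (ns1 @ n # ns))"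
    by (rule coboundaries_add)
  then show ?case by (simp only: GG list.map fst_conv snd_conv add_diff_eq diff_add_cancel)
qed

lemma pull_kunneth:
  assumes f: "\<And>T. T \<in> set Ts \<Longrightarrow> cohom_map (r T) (s T) (f T)"
    and Gs: "factors (\<lambda>T. cochains v (s T)) Ts ns Gs"
    and zs: "zs \<in> wchains (prod_poset (set Ts) r) (sum_list ns)"
  shows "kunneth s Ts ns Gs (map (\<lambda>u. \<lambda>T\<in>set Ts. f T (u T)) zs) =
    kunneth r Ts ns (map (\<lambda>i. pull (r (Ts ! i)) (s (Ts ! i)) (f (Ts ! i)) (ns ! i) (Gs ! i)) [0..<length Ts]) zs"
    (is "kunneth s Ts ns Gs (map ?f zs) = kunneth r Ts ns ?Gs zs")
proof -
  have r: "fin_poset (r T)" "fin_poset (s T)" "poset_hom (r T) (s T) (f T)" if "T \<in> set Ts" for T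
    using f[OF that] by (auto simp: cohom_map_def)
  have Gs': "factors (\<lambda>T. cochains v (r T)) Ts ns ?Gs"
    using Gs f by (auto simp: factors_iff intro: pull_cochains)
  have "poset_hom (prod_poset (set Ts) r) (prod_poset (set Ts) s) ?f"
    by (rule poset_hom_prod_poset[OF r])
  then have "map ?f zs \<in> wchains (prod_poset (set Ts) s) (sum_list ns)"
    using zs by (rule wchains_map)
  then have "kunneth s Ts ns Gs (map ?f zs) = kprod Ts ns Gs (map ?f zs)"
    using kunneth_wchain[of Ts s, OF r(2) Gs] by simp
  also have "\<dots> = kprod Ts ns ?Gs zs"
  proof -
    \<comment> \<open>The induction runs over \<open>Ts'\<close>, while \<open>?f\<close> stays
      restricted to the whole of \<open>set Ts\<close>; on the coordinates in \<open>Ts'\<close>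
      this restriction is invisible.\<close>
    have "kprod Ts' ns Gs (map ?f zs) =
      kprod Ts' ns (map (\<lambda>i. pull (r (Ts' ! i)) (s (Ts' ! i)) (f (Ts' ! i)) (ns ! i) (Gs ! i)) [0..<length Ts']) zs"
      if "factors (\<lambda>T. cochains v (s T)) Ts' ns Gs" "set Ts' \<subseteq> set Ts" "zs \<in> cwchains r Ts' (sum_list ns)" for Ts'
      using that
    proof (induction arbitrary: zs rule: factors.induct)
      case (Cons G T n Ts' ns Gs)
      have "pull (r T) (s T) (f T) n G (map (\<lambda>w. w T) (take (Suc n) zs)) = G (map (\<lambda>w. w T) (take (Suc n) (map ?f zs)))"
        using Cons.prems Cons.hyps(1) r[of T] cwchains_take[of zs r T Ts' "n + sum_list ns" n]
        by (subst pull_wchain[of _ _ _ v]) (auto simp: take_map comp_def)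
      moreover have "kprod Ts' ns Gs (map ?f (drop n zs)) =
          kprod Ts' ns (map (\<lambda>i. pull (r (Ts' ! i)) (s (Ts' ! i)) (f (Ts' ! i)) (ns ! i) (Gs ! i)) [0..<length Ts']) (drop n zs)"
        using Cons.prems by (intro Cons.IH cwchains_drop) (auto simp: cwchains_Cons)
      moreover have "map (\<lambda>i. pull (r ((T # Ts') ! i)) (s ((T # Ts') ! i)) (f ((T # Ts') ! i)) ((n # ns) ! i) ((G # Gs) ! i)) [0..<length (T # Ts')] =
          pull (r T) (s T) (f T) n G # map (\<lambda>i. pull (r (Ts' ! i)) (s (Ts' ! i)) (f (Ts' ! i)) (ns ! i) (Gs ! i)) [0..<length Ts']"
        by (simp add: upt_conv_Cons map_Suc_upt[symmetric] del: upt_Suc)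
      ultimately show ?case by (simp only: kprod.simps drop_map)
    qed simp
    then show ?thesis using Gs wchains_cwchains[OF zs] by blast
  qed
  also have "\<dots> = kunneth r Ts ns ?Gs zs"
    by (rule kunneth_wchain[OF r(1) Gs' zs, symmetric])
  finally show ?thesis .
qed

section \<open>Partitions\<close>

lemma elts_block: "finite A \<Longrightarrow> elts (block A) = A"
  by (simp add: block_def Abs_fset_inverse)

lemma block_elts: "T \<in> range Block \<Longrightarrow> block (elts T) = T"
  by (auto simp: block_def fset_inverse)

lemma elts_inj: "T \<in> range Block \<Longrightarrow> U \<in> range Block \<Longrightarrow> elts T = elts U \<Longrightarrow> T = U"
  by (metis block_elts)

lemma finite_elts: "finite (elts T)"
  by (cases T) auto

lemma PartsD:
  assumes "\<pi> \<in> Parts S"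
  shows "\<pi> \<subseteq> range Block" "partition_on S (elts ` \<pi>)" "\<Union> (elts ` \<pi>) = S"
  using assms by (auto simp: Parts_def partition_on_def)

lemma Parts_nonempty: "\<pi> \<in> Parts S \<Longrightarrow> T \<in> \<pi> \<Longrightarrow> elts T \<noteq> {}"
  unfolding Parts_def partition_on_def by (metis (mono_tags, lifting) imageI mem_Collect_eq)

lemma Parts_disjoint: "\<pi> \<in> Parts S \<Longrightarrow> T \<in> \<pi> \<Longrightarrow> U \<in> \<pi> \<Longrightarrow> s \<in> elts T \<Longrightarrow> s \<in> elts U \<Longrightarrow> T = U"
  by (intro elts_inj) (auto simp: Parts_def partition_on_def disjoint_def)

text \<open>A block of \<sigma> meets some block of \<pi>, which is also a block of \<sigma>, and
  disjointness makes the two equal. In the lemmas below one inclusion is therefore enough to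
  identify two partitions.\<close>

lemma Parts_subset_eq:
  assumes p: "\<pi> \<in> Parts S" "\<sigma> \<in> Parts S" and "\<pi> \<subseteq> \<sigma>"
  shows "\<pi> = \<sigma>"
proof
  show "\<sigma> \<subseteq> \<pi>"
  proof
    fix T assume T: "T \<in> \<sigma>"
    obtain s where s: "s \<in> elts T" using Parts_nonempty[OF p(2) T] by blast
    then have "s \<in> S" using PartsD(3)[OF p(2)] T by blast
    then obtain U where U: "U \<in> \<pi>" "s \<in> elts U" using PartsD(3)[OF p(1)] by blast
    then have "T = U" using Parts_disjoint[OF p(2) T _ s] \<open>\<pi> \<subseteq> \<sigma>\<close> by blast
    then show "T \<in> \<pi>" using U by simp
  qed
qed fact

lemma Parts_fin_set: "fin_set S \<Longrightarrow> \<pi> \<in> Parts S \<Longrightarrow> fin_set \<pi>"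
proof -
  assume S: "fin_set S" and p: "\<pi> \<in> Parts S"
  have "finite (elts ` \<pi>)"
    using S PartsD(3)[OF p] by (metis fin_set_def finite_UnionD)
  moreover have "inj_on elts \<pi>"
    using PartsD(1)[OF p] elts_inj by (meson inj_onI subsetD)
  ultimately have "finite \<pi>" by (simp add: finite_image_iff)
  moreover have "\<pi> \<noteq> {}" using S PartsD(3)[OF p] by (auto simp: fin_set_def)
  ultimately show ?thesis by (simp add: fin_set_def)
qed

lemma Parts_fin_set_elts: "fin_set S \<Longrightarrow> \<pi> \<in> Parts S \<Longrightarrow> T \<in> \<pi> \<Longrightarrow> fin_set (elts T)"
  using Parts_nonempty finite_elts by (auto simp: fin_set_def)

section \<open>Least and greatest partition\<close>

definition indiscrete :: "'a pt set \<Rightarrow> 'a pt set" where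
  "indiscrete S = {block S}"

definition discrete :: "'a pt set \<Rightarrow> 'a pt set" where
  "discrete S = (\<lambda>s. block {s}) ` S"

lemma block_range: "block A \<in> range Block"
  by (simp add: block_def)

lemma indiscrete_Parts: "fin_set S \<Longrightarrow> indiscrete S \<in> Parts S"
  by (auto simp: indiscrete_def Parts_def fin_set_def elts_block block_range partition_on_def disjoint_def)

lemma discrete_Parts: "fin_set S \<Longrightarrow> discrete S \<in> Parts S"
  by (auto simp: discrete_def Parts_def fin_set_def elts_block block_range partition_on_def disjoint_def image_image)

lemma Pi_order_iff:
  "(\<alpha>, \<beta>) \<in> Pi_order S \<longleftrightarrow> \<alpha> \<in> Parts S \<and> \<beta> \<in> Parts S \<and> (\<forall>U\<in>\<beta>. \<exists>T\<in>\<alpha>. elts U \<subseteq> elts T)"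
  by (auto simp: Pi_order_def refines_def Parts_def)

lemma Pi_order_antisym:
  assumes "(\<alpha>, \<beta>) \<in> Pi_order S" "(\<beta>, \<alpha>) \<in> Pi_order S"
  shows "\<alpha> = \<beta>"
proof -
  have "refines S (elts ` \<alpha>) (elts ` \<beta>)" "refines S (elts ` \<beta>) (elts ` \<alpha>)"
    using assms by (auto simp: Pi_order_def)
  then have "elts ` \<alpha> = elts ` \<beta>" by (rule refines_asym)
  moreover have "inj_on elts (\<alpha> \<union> \<beta>)"
  proof (rule inj_onI)
    fix T U assume TU: "T \<in> \<alpha> \<union> \<beta>" "U \<in> \<alpha> \<union> \<beta>" "elts T = elts U"
    have "\<alpha> \<in> Parts S" "\<beta> \<in> Parts S" using assms by (simp_all add: Pi_order_def)
    then have "T \<in> range Block" "U \<in> range Block" using TU(1,2) PartsD(1) by blast+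
    then show "T = U" using TU(3) by (rule elts_inj)
  qed
  ultimately show ?thesis
    using inj_on_image_eq_iff[of elts "\<alpha> \<union> \<beta>" \<alpha> \<beta>] by simp
qed

lemma Field_Pi_order: "Field (Pi_order S) = Parts S"
proof
  show "Parts S \<subseteq> Field (Pi_order S)"
  proof
    fix \<pi> assume "\<pi> \<in> Parts S"
    then have "(\<pi>, \<pi>) \<in> Pi_order S" by (auto simp: Pi_order_iff)
    then show "\<pi> \<in> Field (Pi_order S)" by (rule FieldI1)
  qed
qed (auto simp: Field_def Pi_order_iff)

lemma minimals_least:
  assumes "b \<in> Field r" "\<And>x. x \<in> Field r \<Longrightarrow> (b, x) \<in> r" "\<And>x. (x, b) \<in> r \<Longrightarrow> x = b"
  shows "minimals r = {b}"
  using assms unfolding minimals_def by auto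

lemma maximals_greatest:
  assumes "b \<in> Field r" "\<And>x. x \<in> Field r \<Longrightarrow> (x, b) \<in> r" "\<And>x. (b, x) \<in> r \<Longrightarrow> x = b"
  shows "maximals r = {b}"
  using assms unfolding maximals_def by auto

lemma minimals_Pi_order:
  assumes S: "fin_set S"
  shows "minimals (Pi_order S) = {indiscrete S}"
proof (rule minimals_least)
  have "finite S" using S by (simp add: fin_set_def)
  show le: "(indiscrete S, \<pi>) \<in> Pi_order S" if "\<pi> \<in> Field (Pi_order S)" for \<pi>
    using that indiscrete_Parts[OF S] PartsD(3)[of \<pi> S] \<open>finite S\<close>
    unfolding Pi_order_iff indiscrete_def Field_Pi_order by (auto simp: elts_block)
  show F: "indiscrete S \<in> Field (Pi_order S)"
    by (simp add: Field_Pi_order indiscrete_Parts[OF S])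
  show "\<pi> = indiscrete S" if "(\<pi>, indiscrete S) \<in> Pi_order S" for \<pi>
    using Pi_order_antisym[OF that le] that by (auto intro: FieldI1)
qed

lemma maximals_Pi_order:
  assumes S: "fin_set S"
  shows "maximals (Pi_order S) = {discrete S}"
proof (rule maximals_greatest)
  show le: "(\<pi>, discrete S) \<in> Pi_order S" if "\<pi> \<in> Field (Pi_order S)" for \<pi>
    using that discrete_Parts[OF S] PartsD(3)[of \<pi> S]
    unfolding Pi_order_iff discrete_def Field_Pi_order by (auto simp: elts_block)
  show "discrete S \<in> Field (Pi_order S)"
    by (simp add: Field_Pi_order discrete_Parts[OF S])
  show "\<pi> = discrete S" if "(discrete S, \<pi>) \<in> Pi_order S" for \<pi>
    using Pi_order_antisym[OF that le] that by (auto intro: FieldI2)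
qed

section \<open>Extremal values of the structure maps on partitions\<close>

lemma restr_self:
  assumes "\<pi> \<in> Parts S" "T \<in> \<pi>"
  shows "restr \<pi> T = {T}"
  using assms Parts_disjoint[OF assms(1)] Parts_nonempty[OF assms(1)] unfolding restr_def by blast

lemma Pi_phi_self: "\<pi> \<in> Parts S \<Longrightarrow> Pi_phi \<pi> \<pi> = discrete \<pi>"
  by (auto simp: Pi_phi_def discrete_def restr_self)

text \<open>A block of \<pi> that meets \<open>T\<close> lies in some block of \<alpha> by
  refinement, and this block can only be \<open>T\<close>.\<close>

lemma elts_restr:
  assumes "(\<alpha>, \<pi>) \<in> Pi_order S" "T \<in> \<alpha>"
  shows "\<Union> (elts ` restr \<pi> T) = elts T"
proof
  show "elts T \<subseteq> \<Union> (elts ` restr \<pi> T)"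
  proof
    fix s assume s: "s \<in> elts T"
    have p: "\<alpha> \<in> Parts S" "\<pi> \<in> Parts S" using assms by (auto simp: Pi_order_iff)
    have "s \<in> S" using s PartsD(3)[OF p(1)] assms(2) by blast
    then obtain U where U: "U \<in> \<pi>" "s \<in> elts U" using PartsD(3)[OF p(2)] by blast
    then obtain T' where T': "T' \<in> \<alpha>" "elts U \<subseteq> elts T'" using assms by (auto simp: Pi_order_iff)
    then have "T' = T" using Parts_disjoint[OF p(1)] s U assms(2) by blast
    then show "s \<in> \<Union> (elts ` restr \<pi> T)" using U T' by (auto simp: restr_def)
  qed
qed (auto simp: restr_def)

text \<open>A block of \<alpha> that contains just one block of \<pi> is equal to it. With
  \<open>Pi_phi_self\<close>, this shows that \<pi> is the only partition in its lower interval that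
  \<open>Pi_phi \<pi>\<close> sends to the greatest one.\<close>

lemma Pi_phi_discrete:
  assumes le: "(\<alpha>, \<pi>) \<in> Pi_order S" and S: "fin_set S" and e: "Pi_phi \<pi> \<alpha> = discrete \<pi>"
  shows "\<alpha> = \<pi>"
proof (rule Parts_subset_eq)
  show p: "\<alpha> \<in> Parts S" "\<pi> \<in> Parts S" using le by (auto simp: Pi_order_iff)
  have f: "finite \<pi>" using Parts_fin_set[OF S p(2)] by (simp add: fin_set_def)
  show "\<alpha> \<subseteq> \<pi>"
  proof
    fix T assume T: "T \<in> \<alpha>"
    then have "block (restr \<pi> T) \<in> discrete \<pi>" using e by (auto simp: Pi_phi_def)
    then obtain U where U: "U \<in> \<pi>" "block (restr \<pi> T) = block {U}" by (auto simp: discrete_def)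
    moreover have "finite (restr \<pi> T)" using f by (simp add: restr_def)
    ultimately have "restr \<pi> T = {U}" using elts_block by (metis finite.emptyI finite.insertI)
    then have "elts U = elts T" using elts_restr[OF le T] by simp
    then have "U = T" using PartsD(1)[OF p(1)] PartsD(1)[OF p(2)] T U by (intro elts_inj) auto
    then show "T \<in> \<pi>" using U by simp
  qed
qed

lemma Pi_phi_indiscrete:
  assumes le: "(\<alpha>, \<pi>) \<in> Pi_order S" and S: "fin_set S" and e: "Pi_phi \<pi> \<alpha> = indiscrete \<pi>"
  shows "\<alpha> = indiscrete S"
proof -
  have p: "\<alpha> \<in> Parts S" "\<pi> \<in> Parts S" using le by (auto simp: Pi_order_iff)
  have f: "finite \<pi>" using Parts_fin_set[OF S p(2)] by (simp add: fin_set_def)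
  have "T = block S" if T: "T \<in> \<alpha>" for T
  proof -
    have "block (restr \<pi> T) = block \<pi>" using T e by (auto simp: Pi_phi_def indiscrete_def)
    moreover have "finite (restr \<pi> T)" using f by (simp add: restr_def)
    ultimately have "restr \<pi> T = \<pi>" using elts_block[of "restr \<pi> T"] elts_block[OF f] by simp
    then have "elts T = S" using elts_restr[OF le T] PartsD(3)[OF p(2)] by simp
    moreover have "block (elts T) = T" using PartsD(1)[OF p(1)] T by (intro block_elts) blast
    ultimately show ?thesis by simp
  qed
  then have "\<alpha> \<subseteq> indiscrete S" by (auto simp: indiscrete_def)
  then show ?thesis by (rule Parts_subset_eq[OF p(1) indiscrete_Parts[OF S]])
qed

lemma restr_indiscrete:
  assumes p: "\<pi> \<in> Parts S" "\<beta> \<in> Parts S" and e: "\<And>T. T \<in> \<pi> \<Longrightarrow> restr \<beta> T = indiscrete (elts T)"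
  shows "\<beta> = \<pi>"
proof (rule Parts_subset_eq[OF p, symmetric], rule subsetI)
  fix T assume T: "T \<in> \<pi>"
  then have "block (elts T) \<in> restr \<beta> T" using e by (simp add: indiscrete_def)
  moreover have "block (elts T) = T" using PartsD(1)[OF p(1)] T by (intro block_elts) blast
  ultimately show "T \<in> \<beta>" by (simp add: restr_def)
qed

lemma restr_discrete:
  assumes S: "fin_set S" and p: "\<pi> \<in> Parts S" "\<beta> \<in> Parts S" and e: "\<And>T. T \<in> \<pi> \<Longrightarrow> restr \<beta> T = discrete (elts T)"
  shows "\<beta> = discrete S"
proof (rule Parts_subset_eq[OF discrete_Parts[OF S] p(2), symmetric], rule subsetI)
  fix U assume "U \<in> discrete S"
  then obtain s where s: "s \<in> S" "U = block {s}" by (auto simp: discrete_def)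
  then obtain T where "T \<in> \<pi>" "s \<in> elts T" using PartsD(3)[OF p(1)] by blast
  then have "U \<in> restr \<beta> T" using e s by (auto simp: discrete_def)
  then show "U \<in> \<beta>" by (simp add: restr_def)
qed

section \<open>Operadic poset species\<close>

context
  fixes P :: "('a, 'p) ops_data" and S :: "'a pt set"
  assumes P: "operadic_poset_species P" and S: "fin_set S"
begin

lemma species_fin_poset: "fin_poset (pos P S)"
  using P S by (simp add: operadic_poset_species_def poset_species_def fin_poset_def)

lemma act_hom: "inj_on g S \<Longrightarrow> poset_hom (pos P S) (pos P (g ` S)) (act P S g)"
  using P S by (simp add: operadic_poset_species_def poset_species_def)

lemma act_inverse:
  assumes "inj_on g S" "x \<in> Field (pos P S)"
  shows "act P (g ` S) (inv_into S g) (act P S g x) = x"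
proof -
  have sp: "poset_species P" using P by (simp add: operadic_poset_species_def)
  note sp = sp[unfolded poset_species_def, rule_format, OF S]
  have id: "act P S id x = x"
    using sp assms(2) by simp
  have cong: "act P S h x = act P S h' x" if "inj_on h S" "\<forall>s\<in>S. h s = h' s" for h h'
    using conjunct1[OF conjunct2[OF conjunct2[OF conjunct2[OF sp]]]] that assms(2) by simp
  have comp: "act P S (h \<circ> g) x = act P (g ` S) h (act P S g x)" if "inj_on h (g ` S)" for h
    using conjunct2[OF conjunct2[OF conjunct2[OF conjunct2[OF conjunct2[OF sp]]]]] that assms by simp
  have inj: "inj_on (inv_into S g) (g ` S)" by (simp add: inj_on_inv_into)
  have "act P (g ` S) (inv_into S g) (act P S g x) = act P S (inv_into S g \<circ> g) x"
    by (rule comp[OF inj, symmetric])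
  \<comment> \<open>\<open>inv_into S g\<close> inverts \<open>g\<close> on \<open>S\<close> only;
    the action depends only on the values there.\<close>
  also have "\<dots> = act P S id x"
    using assms(1) by (intro cong comp_inj_on inj) simp_all
  finally show ?thesis by (simp only: id)
qed

lemma amap_hom: "poset_hom (pos P S) (Pi_order S) (amap P S)"
  using P S by (simp add: operadic_poset_species_def species_over_Pi_def)

lemma amap_Parts: "x \<in> Field (pos P S) \<Longrightarrow> amap P S x \<in> Parts S"
  using amap_hom by (auto simp: poset_hom_def Field_Pi_order)

lemma amap_mono: "(x, y) \<in> pos P S \<Longrightarrow> (amap P S x, amap P S y) \<in> Pi_order S"
  using amap_hom by (auto simp: poset_hom_def)

text \<open>Extremality in \<open>P\<close> is decided after applying \<open>a\<close>; the
  statements on \<open>phi\<close> and \<open>psi\<close> below are reduced to partitions in this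
  way.\<close>

lemma minimals_iff_amap:
  assumes "x \<in> Field (pos P S)"
  shows "x \<in> minimals (pos P S) \<longleftrightarrow> amap P S x = indiscrete S"
proof -
  have "{x \<in> Field (pos P S). amap P S x \<in> minimals (Pi_order S)} = minimals (pos P S)"
    using P S by (simp add: operadic_poset_species_def species_over_Pi_def)
  then show ?thesis using assms by (auto simp: minimals_Pi_order[OF S])
qed

lemma maximals_iff_amap:
  assumes "x \<in> Field (pos P S)"
  shows "x \<in> maximals (pos P S) \<longleftrightarrow> amap P S x = discrete S"
proof -
  have "{x \<in> Field (pos P S). amap P S x \<in> maximals (Pi_order S)} = maximals (pos P S)"
    using P S by (simp add: operadic_poset_species_def species_over_Pi_def)
  then show ?thesis using assms by (auto simp: maximals_Pi_order[OF S])
qed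

lemma structure_maps_at:
  assumes "x \<in> Field (pos P S)"
  shows "poset_hom (down (pos P S) x) (pos P (amap P S x)) (phi P S x)"
    and "poset_hom (up (pos P S) x) (blocks_poset P (amap P S x)) (psi P S x)"
    and "(y, x) \<in> pos P S \<Longrightarrow> amap P (amap P S x) (phi P S x y) = Pi_phi (amap P S x) (amap P S y)"
    and "(x, y) \<in> pos P S \<Longrightarrow> T \<in> amap P S x \<Longrightarrow> amap P (elts T) (psi P S x y T) = restr (amap P S y) T"
proof -
  have *: "structure_maps P" using P by (simp add: operadic_poset_species_def)
  note ** = *[unfolded structure_maps_def, rule_format, OF conjI[OF S assms]]
  show "poset_hom (down (pos P S) x) (pos P (amap P S x)) (phi P S x)"
    using ** by blast
  show "poset_hom (up (pos P S) x) (blocks_poset P (amap P S x)) (psi P S x)"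
    using ** by blast
  show "(y, x) \<in> pos P S \<Longrightarrow> amap P (amap P S x) (phi P S x y) = Pi_phi (amap P S x) (amap P S y)"
    using ** by blast
  show "(x, y) \<in> pos P S \<Longrightarrow> T \<in> amap P S x \<Longrightarrow> amap P (elts T) (psi P S x y T) = restr (amap P S y) T"
    using ** by blast
qed

end

section \<open>Intervals below and above an element\<close>

lemma down_iff: "(y, z) \<in> down r x \<longleftrightarrow> (y, z) \<in> r \<and> (y, x) \<in> r \<and> (z, x) \<in> r"
  by (auto simp: down_def under_def)

lemma up_iff: "(y, z) \<in> up r x \<longleftrightarrow> (y, z) \<in> r \<and> (x, y) \<in> r \<and> (x, z) \<in> r"
  by (auto simp: up_def above_def)

lemma Field_down: "fin_poset r \<Longrightarrow> y \<in> Field (down r x) \<longleftrightarrow> (y, x) \<in> r"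
  using fin_poset_refl[of r y] by (fastforce simp: Field_def down_iff)

lemma Field_up: "fin_poset r \<Longrightarrow> y \<in> Field (up r x) \<longleftrightarrow> (x, y) \<in> r"
  using fin_poset_refl[of r y] by (fastforce simp: Field_def up_iff)

lemma fin_poset_Restr:
  assumes "fin_poset r"
  shows "fin_poset (Restr r A)"
proof -
  have "Field (Restr r A) \<subseteq> Field r" by (auto simp: Field_def)
  then show ?thesis
    using assms unfolding fin_poset_def by (simp add: Partial_order_Restr finite_subset)
qed

lemma fin_poset_down: "fin_poset r \<Longrightarrow> fin_poset (down r x)"
  and fin_poset_up: "fin_poset r \<Longrightarrow> fin_poset (up r x)"
  by (simp_all add: down_def up_def fin_poset_Restr)

section \<open>The structure maps on comparable elements\<close>

context
  fixes P :: "('a, 'p) ops_data" and S :: "'a pt set"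
  assumes P: "operadic_poset_species P" and S: "fin_set S"
begin

lemmas fin_poset_P = species_fin_poset[OF P S]

lemma phi_hom:
  assumes x: "x \<in> Field (pos P S)"
  shows "(y, x) \<in> pos P S \<Longrightarrow> phi P S x y \<in> Field (pos P (amap P S x))"
    and "(y, z) \<in> pos P S \<Longrightarrow> (z, x) \<in> pos P S \<Longrightarrow> (phi P S x y, phi P S x z) \<in> pos P (amap P S x)"
proof -
  note h = structure_maps_at(1)[OF P S x, unfolded poset_hom_def]
  show "(y, x) \<in> pos P S \<Longrightarrow> phi P S x y \<in> Field (pos P (amap P S x))"
    using h by (auto simp: Field_down[OF fin_poset_P])
  show "(phi P S x y, phi P S x z) \<in> pos P (amap P S x)" if "(y, z) \<in> pos P S" "(z, x) \<in> pos P S"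
  proof -
    have "(y, z) \<in> down (pos P S) x" using that fin_poset_trans[OF fin_poset_P that] by (simp add: down_iff)
    then show ?thesis using h by auto
  qed
qed

lemma psi_hom:
  assumes x: "x \<in> Field (pos P S)"
  shows "(x, y) \<in> pos P S \<Longrightarrow> psi P S x y \<in> Field (blocks_poset P (amap P S x))"
    and "(x, y) \<in> pos P S \<Longrightarrow> (y, z) \<in> pos P S \<Longrightarrow> (psi P S x y, psi P S x z) \<in> blocks_poset P (amap P S x)"
proof -
  note h = structure_maps_at(2)[OF P S x, unfolded poset_hom_def]
  show "(x, y) \<in> pos P S \<Longrightarrow> psi P S x y \<in> Field (blocks_poset P (amap P S x))"
    using h by (auto simp: Field_up[OF fin_poset_P])
  show "(psi P S x y, psi P S x z) \<in> blocks_poset P (amap P S x)" if "(x, y) \<in> pos P S" "(y, z) \<in> pos P S"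
  proof -
    have "(y, z) \<in> up (pos P S) x" using that fin_poset_trans[OF fin_poset_P that] by (simp add: up_iff)
    then show ?thesis using h by auto
  qed
qed

lemma amap_fin_set:
  assumes "x \<in> Field (pos P S)"
  shows "fin_set (amap P S x)" "T \<in> amap P S x \<Longrightarrow> fin_set (elts T)"
  using amap_Parts[OF P S assms] Parts_fin_set[OF S] Parts_fin_set_elts[OF S] by auto

lemma fin_poset_blocks:
  assumes "\<pi> \<in> Parts S"
  shows "fin_poset (pos P \<pi>)" "T \<in> \<pi> \<Longrightarrow> fin_poset (pos P (elts T))" "fin_poset (blocks_poset P \<pi>)"
proof -
  have f: "fin_set \<pi>" "\<And>T. T \<in> \<pi> \<Longrightarrow> fin_set (elts T)"
    using assms Parts_fin_set[OF S] Parts_fin_set_elts[OF S] by auto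
  then show "fin_poset (pos P \<pi>)" "T \<in> \<pi> \<Longrightarrow> fin_poset (pos P (elts T))"
    using species_fin_poset[OF P] by auto
  show "fin_poset (blocks_poset P \<pi>)"
    using f species_fin_poset[OF P] by (intro fin_poset_prod_poset) (auto simp: fin_set_def)
qed

lemma psi_in_Field:
  assumes x: "x \<in> Field (pos P S)" "(x, y) \<in> pos P S" "T \<in> amap P S x"
  shows "psi P S x y T \<in> Field (pos P (elts T))"
  using psi_hom(1)[OF x(1,2)] x(3) by (auto simp: Field_def prod_poset_def)

text \<open>Since \<open>a\<close> carries \<open>\<phi>\<^sub>x\<close> to the corresponding map of
  partitions, maximality means that the partition of \<open>y\<close> is sent to the discrete one,
  and this happens only for the partition of \<open>x\<close>. The equivalence decides whether the
  last face of the left argument contributes to the Leibniz rule.\<close>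

lemma phi_maximal_iff:
  assumes "(y, x) \<in> pos P S"
  shows "phi P S x y \<in> maximals (pos P (amap P S x)) \<longleftrightarrow> amap P S y = amap P S x"
proof -
  have x: "x \<in> Field (pos P S)" using assms by (rule FieldI2)
  have "phi P S x y \<in> maximals (pos P (amap P S x)) \<longleftrightarrow> Pi_phi (amap P S x) (amap P S y) = discrete (amap P S x)"
    using maximals_iff_amap[OF P amap_fin_set(1)[OF x] phi_hom(1)[OF x assms]]
      structure_maps_at(3)[OF P S x assms] by simp
  also have "\<dots> \<longleftrightarrow> amap P S y = amap P S x"
    using Pi_phi_discrete[OF amap_mono[OF P S assms] S] Pi_phi_self[OF amap_Parts[OF P S x]] by metis
  finally show ?thesis .
qed

text \<open>Together with \<open>psi_maximal\<close>, this brings the conditions on the outer ends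
  of a chain back from the arguments of the composition to the composition itself.\<close>

lemma phi_minimal:
  assumes "(y, x) \<in> pos P S" "phi P S x y \<in> minimals (pos P (amap P S x))"
  shows "y \<in> minimals (pos P S)"
proof -
  have x: "x \<in> Field (pos P S)" and y: "y \<in> Field (pos P S)" using assms by (auto intro: FieldI1 FieldI2)
  have "Pi_phi (amap P S x) (amap P S y) = indiscrete (amap P S x)"
    using minimals_iff_amap[OF P amap_fin_set(1)[OF x] phi_hom(1)[OF x assms(1)]]
      structure_maps_at(3)[OF P S x assms(1)] assms(2) by simp
  then show ?thesis
    using Pi_phi_indiscrete[OF amap_mono[OF P S assms(1)] S] minimals_iff_amap[OF P S y] by simp
qed

text \<open>The counterpart of \<open>phi_maximal_iff\<close> for the first face of the right
  argument, stated coordinate by coordinate because \<open>a\<close> is applied in each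
  block.\<close>

lemma psi_minimal_iff:
  assumes "(x, y) \<in> pos P S"
  shows "(\<forall>T\<in>amap P S x. psi P S x y T \<in> minimals (pos P (elts T))) \<longleftrightarrow> amap P S y = amap P S x"
proof -
  have x: "x \<in> Field (pos P S)" and y: "y \<in> Field (pos P S)" using assms by (auto intro: FieldI1 FieldI2)
  note p = amap_Parts[OF P S x] amap_Parts[OF P S y]
  have "psi P S x y T \<in> minimals (pos P (elts T)) \<longleftrightarrow> restr (amap P S y) T = indiscrete (elts T)"
    if T: "T \<in> amap P S x" for T
    using minimals_iff_amap[OF P amap_fin_set(2)[OF x T] psi_in_Field[OF x assms T]]
      structure_maps_at(4)[OF P S x assms T] by simp
  then have "(\<forall>T\<in>amap P S x. psi P S x y T \<in> minimals (pos P (elts T))) \<longleftrightarrow>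
      (\<forall>T\<in>amap P S x. restr (amap P S y) T = indiscrete (elts T))" by simp
  also have "\<dots> \<longleftrightarrow> amap P S y = amap P S x"
  proof
    assume e: "amap P S y = amap P S x"
    have "indiscrete (elts T) = {T}" if "T \<in> amap P S x" for T
      using PartsD(1)[OF p(1)] that block_elts[of T] by (auto simp: indiscrete_def)
    then show "\<forall>T\<in>amap P S x. restr (amap P S y) T = indiscrete (elts T)"
      using restr_self[OF p(1)] e by simp
  qed (rule restr_indiscrete[OF p], blast)
  finally show ?thesis .
qed

lemma psi_maximal:
  assumes "(x, y) \<in> pos P S" "\<And>T. T \<in> amap P S x \<Longrightarrow> psi P S x y T \<in> maximals (pos P (elts T))"
  shows "y \<in> maximals (pos P S)"
proof -
  have x: "x \<in> Field (pos P S)" and y: "y \<in> Field (pos P S)" using assms by (auto intro: FieldI1 FieldI2)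
  have "restr (amap P S y) T = discrete (elts T)" if T: "T \<in> amap P S x" for T
    using maximals_iff_amap[OF P amap_fin_set(2)[OF x T] psi_in_Field[OF x assms(1) T]]
      structure_maps_at(4)[OF P S x assms(1) T] assms(2)[OF T] by simp
  then have "amap P S y = discrete S"
    by (rule restr_discrete[OF S amap_Parts[OF P S x] amap_Parts[OF P S y]])
  then show ?thesis using maximals_iff_amap[OF P S y] by simp
qed

lemma associativity_at:
  assumes "(x, x') \<in> pos P S"
  shows "(y, x) \<in> pos P S \<Longrightarrow> phi P (amap P S x') (phi P S x' x) (phi P S x' y) =
      act P (amap P S x) (\<lambda>T. block (restr (amap P S x') T)) (phi P S x y)"
    and "(x', y) \<in> pos P S \<Longrightarrow> T \<in> amap P S x \<Longrightarrow> U \<in> restr (amap P S x') T \<Longrightarrow>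
      psi P (elts T) (psi P S x x' T) (psi P S x y T) U = psi P S x' y U"
proof -
  have "associativity P" using P by (simp add: operadic_poset_species_def)
  note a = this[unfolded associativity_def Let_def, rule_format, OF conjI[OF S assms]]
  show "phi P (amap P S x') (phi P S x' x) (phi P S x' y) =
      act P (amap P S x) (\<lambda>T. block (restr (amap P S x') T)) (phi P S x y)" if "(y, x) \<in> pos P S"
    using that by (rule conjunct1[OF a, rule_format])
  show "psi P (elts T) (psi P S x x' T) (psi P S x y T) U = psi P S x' y U"
    if "(x', y) \<in> pos P S" "T \<in> amap P S x" "U \<in> restr (amap P S x') T"
    using that by (rule conjunct1[OF conjunct2[OF a], rule_format])
qed

text \<open>\<open>\<phi>\<^sub>x\<^sub>'(x)\<close> and \<open>\<phi>\<^sub>x\<^sub>'(x')\<close> are comparable maximal elements, hence equal; so associativity for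
  \<open>x \<le> x'\<close> and for \<open>x' \<le> x'\<close> have the same left-hand side.\<close>

lemma phi_eq:
  assumes le: "(x, x') \<in> pos P S" and e: "amap P S x = amap P S x'" and y: "(y, x) \<in> pos P S"
  shows "phi P S x y = phi P S x' y"
proof -
  have x: "x \<in> Field (pos P S)" and x': "x' \<in> Field (pos P S)" using le by (auto intro: FieldI1 FieldI2)
  note r = fin_poset_refl[OF fin_poset_P x']
  have y': "(y, x') \<in> pos P S" using fin_poset_trans[OF fin_poset_P y le] .
  let ?\<pi> = "amap P S x'"
  let ?\<iota> = "\<lambda>T. block (restr ?\<pi> T)"
  have p: "?\<pi> \<in> Parts S" by (rule amap_Parts[OF P S x'])
  have "phi P S x' x \<in> maximals (pos P ?\<pi>)" using phi_maximal_iff[OF le] e by simp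
  moreover have "(phi P S x' x, phi P S x' x') \<in> pos P ?\<pi>" using phi_hom(2)[OF x' le r] .
  ultimately have u: "phi P S x' x' = phi P S x' x" by (simp add: maximals_def)
  have act_eq: "act P ?\<pi> ?\<iota> (phi P S x y) = act P ?\<pi> ?\<iota> (phi P S x' y)"
    using associativity_at(1)[OF le y] associativity_at(1)[OF r y'] unfolding e u by (rule trans[OF sym])
  \<comment> \<open>As \<open>restr\<close> returns the singleton of \<open>T\<close>, the transport
    is along \<open>T \<mapsto> {T}\<close>; by injectivity, functoriality undoes it.\<close>
  have inj: "inj_on ?\<iota> ?\<pi>"
  proof (rule inj_onI)
    fix T U assume TU: "T \<in> ?\<pi>" "U \<in> ?\<pi>" "?\<iota> T = ?\<iota> U"
    have "{T} = elts (?\<iota> T)" by (simp add: restr_self[OF p TU(1)] elts_block)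
    also have "\<dots> = {U}" by (simp add: TU(3) restr_self[OF p TU(2)] elts_block)
    finally show "T = U" by simp
  qed
  note inv = act_inverse[OF P amap_fin_set(1)[OF x'] inj]
  have "phi P S x y = act P (?\<iota> ` ?\<pi>) (inv_into ?\<pi> ?\<iota>) (act P ?\<pi> ?\<iota> (phi P S x y))"
    using phi_hom(1)[OF x y] unfolding e by (rule inv[symmetric])
  also have "\<dots> = phi P S x' y"
    unfolding act_eq by (rule inv[OF phi_hom(1)[OF x' y']])
  finally show ?thesis .
qed

text \<open>Here the minimal element is \<open>psi P S x x' T\<close>, which lies above
  \<open>psi P S x x T\<close> and so equals it. The second associativity condition for
  \<open>x \<le> x'\<close> and for \<open>x \<le> x\<close> then compares the two maps; no
  transport occurs, as \<open>T\<close> is itself the only block in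
  \<open>restr ?\<pi> T\<close>.\<close>

lemma psi_eq:
  assumes le: "(x, x') \<in> pos P S" and e: "amap P S x = amap P S x'" and y: "(x', y) \<in> pos P S"
  shows "psi P S x y = psi P S x' y"
proof -
  have x: "x \<in> Field (pos P S)" and x': "x' \<in> Field (pos P S)" using le by (auto intro: FieldI1 FieldI2)
  note r = fin_poset_refl[OF fin_poset_P x]
  have y': "(x, y) \<in> pos P S" using fin_poset_trans[OF fin_poset_P le y] .
  let ?\<pi> = "amap P S x"
  have p: "?\<pi> \<in> Parts S" by (rule amap_Parts[OF P S x])
  have "psi P S x y T = psi P S x' y T" if T: "T \<in> ?\<pi>" for T
  proof -
    have "psi P S x x' T \<in> minimals (pos P (elts T))" using psi_minimal_iff[OF le] e T by simp
    moreover have "(psi P S x x T, psi P S x x' T) \<in> pos P (elts T)"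
      using prod_poset_le[OF psi_hom(2)[OF x r le] T] .
    ultimately have u: "psi P S x x T = psi P S x x' T" by (simp add: minimals_def)
    have R: "T \<in> restr ?\<pi> T" using restr_self[OF p T] by simp
    show ?thesis
      using associativity_at(2)[OF le y T] associativity_at(2)[OF r y' T R] R u e by simp
  qed
  moreover have "psi P S x y \<in> (\<Pi>\<^sub>E T\<in>?\<pi>. Field (pos P (elts T)))"
    and "psi P S x' y \<in> (\<Pi>\<^sub>E T\<in>?\<pi>. Field (pos P (elts T)))"
    using psi_hom(1)[OF x y'] psi_hom(1)[OF x' y] e
      Field_prod_poset[of ?\<pi> "\<lambda>T. pos P (elts T)", OF fin_poset_blocks(2)[OF p]] by auto
  ultimately show ?thesis by (intro PiE_ext)
qed

end

section \<open>Concatenation\<close>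

lemma chain_take_drop:
  assumes r: "fin_poset r" and zs: "zs \<in> wchains r (m + n)" and x: "zs ! m = x"
  shows "take (Suc m) zs \<in> wchains (down r x) m" "drop m zs \<in> wchains (up r x) n"
    "last (take (Suc m) zs) = x" "hd (drop m zs) = x"
proof -
  have lz: "length zs = Suc (m + n)" using zs by (rule wchains_length)
  note le = wchains_nth_le[OF r zs]
  have t: "(zs ! i, x) \<in> r" if "i \<le> m" for i using le[of i m] that x by simp
  have d: "(x, zs ! i) \<in> r" if "m \<le> i" "i \<le> m + n" for i using le[of m i] that x by simp
  show "take (Suc m) zs \<in> wchains (down r x) m"
    using lz t le by (auto simp: wchains_def sorted_wrt_iff_nth_less in_set_conv_nth Field_down[OF r] down_iff)
  show "drop m zs \<in> wchains (up r x) n"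
    using lz d le by (auto simp: wchains_def sorted_wrt_iff_nth_less in_set_conv_nth Field_up[OF r] up_iff)
  show "last (take (Suc m) zs) = x" using lz x by (simp add: take_Suc_conv_app_nth)
  show "hd (drop m zs) = x" using lz x by (simp add: hd_drop_conv_nth)
qed

lemma chain_append:
  assumes r: "fin_poset r" and xs: "xs \<in> chains (down r x) m" "last xs = x"
    and ys: "ys \<in> chains (up r x) n" "hd ys = x"
  shows "xs @ tl ys \<in> chains r (m + n)" "(xs @ tl ys) ! m = x"
    "take (Suc m) (xs @ tl ys) = xs" "drop m (xs @ tl ys) = ys"
proof -
  have l: "length xs = Suc m" "length ys = Suc n" using xs ys by (auto simp: chains_def)
  obtain ys' where ys': "ys = x # ys'" using l(2) ys(2) by (cases ys) auto
  obtain xs' where xs': "xs = xs' @ [x]" using l(1) xs(2) by (cases xs rule: rev_cases) auto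
  have X: "(y, x) \<in> r" if "y \<in> set xs" for y
    using that xs(1) Field_down[OF r] by (auto simp: chains_def)
  have Y: "(x, y) \<in> r \<and> x \<noteq> y" if "y \<in> set ys'" for y
    using that ys(1) by (auto simp: chains_def ys' up_iff)
  have XY: "(y, z) \<in> r \<and> y \<noteq> z" if "y \<in> set xs" "z \<in> set ys'" for y z
    using X[OF that(1)] Y[OF that(2)] fin_poset_trans[OF r] fin_poset_antisym[OF r] by blast
  have F: "set xs \<union> set ys' \<subseteq> Field r"
    using X Y by (auto intro: FieldI1 FieldI2)
  have sx: "sorted_wrt (\<lambda>x y. (x, y) \<in> r \<and> x \<noteq> y) xs"
    using xs(1) unfolding chains_def by (auto simp: down_iff elim: sorted_wrt_mono_rel[rotated])
  have sy: "sorted_wrt (\<lambda>x y. (x, y) \<in> r \<and> x \<noteq> y) ys'"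
    using ys(1) unfolding chains_def ys' by (auto simp: up_iff elim: sorted_wrt_mono_rel[rotated])
  show "xs @ tl ys \<in> chains r (m + n)"
    using l F sx sy XY unfolding chains_def ys' by (simp add: sorted_wrt_append)
  show "(xs @ tl ys) ! m = x" using l(1) unfolding xs' by (simp add: nth_append)
  show "take (Suc m) (xs @ tl ys) = xs" using l(1) by simp
  show "drop m (xs @ tl ys) = ys" using l(1) unfolding xs' ys' by simp
qed

text \<open>A chain with \<open>x\<close> in position \<open>m\<close> splits there in exactly one
  way, so at most one pair of basis chains contributes. If one half of \<open>zs\<close> is not a
  chain, both sides are zero, the right one because \<open>A\<close> and \<open>B\<close> vanish off
  chains; this covers lists with repetitions.\<close>

lemma concat_at_eq:
  fixes A B :: "'p list \<Rightarrow> 'k::{comm_ring,comm_monoid_mult}"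
  assumes r: "fin_poset r"
    and A: "\<And>xs. xs \<notin> chains (down r x) m \<Longrightarrow> A xs = 0"
    and B: "\<And>xs. xs \<notin> chains (up r x) n \<Longrightarrow> B xs = 0"
    and zs: "zs \<in> wchains r (m + n)"
  shows "concat_at r x m n A B zs = (if zs ! m = x then A (take (Suc m) zs) * B (drop m zs) else 0)"
proof -
  let ?X = "{xs \<in> chains (down r x) m. last xs = x}" and ?Y = "{ys \<in> chains (up r x) n. hd ys = x}"
  have fin: "finite ?X" "finite ?Y"
    using finite_chains[OF fin_poset_down[OF r]] finite_chains[OF fin_poset_up[OF r]] by simp_all
  show ?thesis
  proof (cases "zs ! m = x \<and> take (Suc m) zs \<in> ?X \<and> drop m zs \<in> ?Y")
    case True
    then have t: "take (Suc m) zs \<in> ?X" and d: "drop m zs \<in> ?Y" by simp_all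
    have lz: "length zs = Suc (m + n)" using zs by (rule wchains_length)
    have eq: "take (Suc m) zs @ tl (drop m zs) = zs"
      by (simp add: tl_drop drop_Suc flip: drop_Suc)
    have "F * basis (xs @ tl ys) zs = (if xs = take (Suc m) zs then if ys = drop m zs then F else 0 else (0::'k))"
      if "xs \<in> ?X" "ys \<in> ?Y" for xs ys F
      using chain_append(3,4)[OF r, of xs x m ys n] that eq by (auto simp: basis_def)
    then have "concat_at r x m n A B zs =
        (\<Sum>xs\<in>?X. \<Sum>ys\<in>?Y. if xs = take (Suc m) zs then if ys = drop m zs then A xs * B ys else 0 else 0)"
      unfolding concat_at_def by (intro sum.cong refl) blast
    also have "\<dots> = (\<Sum>xs\<in>?X. if xs = take (Suc m) zs then \<Sum>ys\<in>?Y. if ys = drop m zs then A xs * B ys else 0 else 0)"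
      by (intro sum.cong refl) simp
    also have "\<dots> = (\<Sum>ys\<in>?Y. if ys = drop m zs then A (take (Suc m) zs) * B ys else 0)"
      using t by (simp only: sum_if_eq[OF fin(1)] if_True)
    also have "\<dots> = A (take (Suc m) zs) * B (drop m zs)"
      using d by (simp only: sum_if_eq[OF fin(2)] if_True)
    finally show ?thesis using True by simp
  next
    case False
    have "basis (xs @ tl ys) zs = (0 :: 'k)" if xy: "xs \<in> ?X" "ys \<in> ?Y" for xs ys
    proof -
      have "zs \<noteq> xs @ tl ys"
        using False chain_append(2,3,4)[OF r, of xs x m ys n] xy by auto
      then show ?thesis by (simp add: basis_def)
    qed
    then have "concat_at r x m n A B zs = 0"
      unfolding concat_at_def by (intro sum.neutral ballI) simp
    moreover have "A (take (Suc m) zs) * B (drop m zs) = 0" if "zs ! m = x"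
    proof -
      have "take (Suc m) zs \<notin> chains (down r x) m \<or> drop m zs \<notin> chains (up r x) n"
        using False that chain_take_drop(3,4)[OF r zs that] by simp
      then show ?thesis using A B by auto
    qed
    ultimately show ?thesis by simp
  qed
qed

lemma concat_at_eq_0:
  fixes A B :: "'p list \<Rightarrow> 'k::{comm_ring,comm_monoid_mult}"
  assumes r: "fin_poset r" and zs: "zs \<notin> chains r (m + n)"
  shows "concat_at r x m n A B zs = 0"
proof -
  have "basis (xs @ tl ys) zs = (0 :: 'k)"
    if "xs \<in> {xs \<in> chains (down r x) m. last xs = x}" "ys \<in> {ys \<in> chains (up r x) n. hd ys = x}" for xs ys
    using chain_append(1)[OF r, of xs x m ys n] that zs by (auto simp: basis_def)
  then show ?thesis
    unfolding concat_at_def by (intro sum.neutral ballI) simp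
qed

section \<open>Composition of cochains\<close>

text \<open>The composition with the Kuenneth map split off. For an arbitrary cochain
  \<open>K\<close> on the product of the blocks it is an operation in two arguments, for which a
  Leibniz rule can be stated.\<close>

definition twist :: "('a, 'p) ops_data \<Rightarrow> 'a pt set \<Rightarrow> 'a pt set \<Rightarrow> nat \<Rightarrow> nat \<Rightarrow> ('p list \<Rightarrow> 'k) \<Rightarrow>
    (('a pt \<Rightarrow> 'p) list \<Rightarrow> 'k) \<Rightarrow> 'p list \<Rightarrow> 'k::{comm_ring,comm_monoid_mult}" where
  "twist P S \<pi> m n F K = (\<lambda>zs. \<Sum>x\<in>{x \<in> Field (pos P S). amap P S x = \<pi>}.
     concat_at (pos P S) x m n (pull (down (pos P S) x) (pos P \<pi>) (phi P S x) m F)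
       (pull (up (pos P S) x) (blocks_poset P \<pi>) (psi P S x) n K) zs)"

lemma rho_cochain_twist:
  "rho_cochain P S Ts m F ns Gs =
    twist P S (set Ts) m (sum_list ns) F (kunneth (\<lambda>T. pos P (elts T)) Ts ns Gs)"
  by (simp only: rho_cochain_def twist_def)

text \<open>The element over \<pi> is taken from the list itself, here as its last entry and in
  \<open>rpart\<close> as its first. A face that removes this entry changes the structure map
  applied to the rest, which is the source of the defects in the Leibniz rule.\<close>

definition lpart :: "('a, 'p) ops_data \<Rightarrow> 'a pt set \<Rightarrow> 'a pt set \<Rightarrow> ('p list \<Rightarrow> 'k) \<Rightarrow> 'p list \<Rightarrow> 'k::{comm_ring,comm_monoid_mult}" where
  "lpart P S \<pi> F xs = (if amap P S (last xs) = \<pi> then F (map (phi P S (last xs)) xs) else 0)"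

definition rpart :: "('a, 'p) ops_data \<Rightarrow> 'a pt set \<Rightarrow> 'a pt set \<Rightarrow> (('a pt \<Rightarrow> 'p) list \<Rightarrow> 'k) \<Rightarrow> 'p list \<Rightarrow> 'k::{comm_ring,comm_monoid_mult}" where
  "rpart P S \<pi> K ys = (if amap P S (hd ys) = \<pi> then K (map (psi P S (hd ys)) ys) else 0)"

context
  fixes P :: "('a, 'p) ops_data" and S \<pi> :: "'a pt set"
  assumes P: "operadic_poset_species P" and S: "fin_set S" and \<pi>: "\<pi> \<in> Parts S"
begin

lemmas fin_posets = species_fin_poset[OF P S] fin_poset_blocks(1)[OF P S \<pi>] fin_poset_blocks(3)[OF P S \<pi>]

text \<open>Concatenation at \<open>x\<close> can be nonzero at \<open>zs\<close> only for
  \<open>x = zs ! m\<close>, the entry shared by the two halves, so the sum over \<open>x\<close>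
  becomes a single product.\<close>

lemma twist_wchain:
  assumes F: "F \<in> cochains u (pos P \<pi>) m" and K: "K \<in> cochains w (blocks_poset P \<pi>) n"
    and zs: "zs \<in> wchains (pos P S) (m + n)"
  shows "twist P S \<pi> m n F K zs = lpart P S \<pi> F (take (Suc m) zs) * rpart P S \<pi> K (drop m zs)"
proof -
  let ?r = "pos P S" and ?x = "zs ! m"
  note ctd = chain_take_drop[OF fin_posets(1) zs refl]
  have x: "?x \<in> Field ?r" using zs by (rule wchains_nth_in) simp
  have fin: "finite {x \<in> Field ?r. amap P S x = \<pi>}" using fin_posets(1) by (simp add: fin_poset_def)
  have "twist P S \<pi> m n F K zs = (\<Sum>x\<in>{x \<in> Field ?r. amap P S x = \<pi>}. if x = ?x then
      pull (down ?r x) (pos P \<pi>) (phi P S x) m F (take (Suc m) zs) *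
      pull (up ?r x) (blocks_poset P \<pi>) (psi P S x) n K (drop m zs) else 0)"
    unfolding twist_def
  proof (intro sum.cong refl)
    fix x
    show "concat_at ?r x m n (pull (down ?r x) (pos P \<pi>) (phi P S x) m F)
       (pull (up ?r x) (blocks_poset P \<pi>) (psi P S x) n K) zs = (if x = ?x then
      pull (down ?r x) (pos P \<pi>) (phi P S x) m F (take (Suc m) zs) *
      pull (up ?r x) (blocks_poset P \<pi>) (psi P S x) n K (drop m zs) else 0)"
      by (subst concat_at_eq[OF fin_posets(1) _ _ zs]) (auto simp: pull_eq_0)
  qed
  also have "\<dots> = (if amap P S ?x = \<pi> then
      pull (down ?r ?x) (pos P \<pi>) (phi P S ?x) m F (take (Suc m) zs) *
      pull (up ?r ?x) (blocks_poset P \<pi>) (psi P S ?x) n K (drop m zs) else 0)"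
    unfolding sum_if_eq[OF fin] using x by simp
  also have "pull (down ?r ?x) (pos P \<pi>) (phi P S ?x) m F (take (Suc m) zs) =
      F (map (phi P S ?x) (take (Suc m) zs))"
    by (rule pull_wchain[OF fin_poset_down[OF fin_posets(1)] fin_posets(2) F ctd(1)])
  also have "pull (up ?r ?x) (blocks_poset P \<pi>) (psi P S ?x) n K (drop m zs) =
      K (map (psi P S ?x) (drop m zs))"
    by (rule pull_wchain[OF fin_poset_up[OF fin_posets(1)] fin_posets(3) K ctd(2)])
  finally show ?thesis
    unfolding lpart_def rpart_def ctd(3,4) by (cases "amap P S ?x = \<pi>") simp_all
qed

lemma twist_eq_0: "zs \<notin> chains (pos P S) (m + n) \<Longrightarrow> twist P S \<pi> m n F K zs = 0"
  unfolding twist_def by (intro sum.neutral ballI concat_at_eq_0[OF fin_posets(1)])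

lemma map_phi_wchains:
  assumes xs: "xs \<in> wchains (pos P S) n" and x: "amap P S (last xs) = \<pi>"
  shows "map (phi P S (last xs)) xs \<in> wchains (pos P \<pi>) n"
proof -
  have l: "length xs = Suc n" using xs by (rule wchains_length)
  then have last: "last xs = xs ! n" by (cases xs rule: rev_cases) (auto simp: nth_append)
  have F: "last xs \<in> Field (pos P S)" unfolding last by (rule wchains_nth_in[OF xs]) simp
  \<comment> \<open>Cutting at the last entry makes the whole list the lower half.\<close>
  have "take (Suc n) xs \<in> wchains (down (pos P S) (last xs)) n"
    by (rule chain_take_drop(1)[OF fin_posets(1), of _ n 0]) (simp_all add: xs last)
  then have "xs \<in> wchains (down (pos P S) (last xs)) n" using l by simp
  then show ?thesis using wchains_map[OF structure_maps_at(1)[OF P S F]] x by simp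
qed

lemma map_psi_wchains:
  assumes ys: "ys \<in> wchains (pos P S) n" and x: "amap P S (hd ys) = \<pi>"
  shows "map (psi P S (hd ys)) ys \<in> wchains (blocks_poset P \<pi>) n"
proof -
  have l: "length ys = Suc n" using ys by (rule wchains_length)
  then have hd: "hd ys = ys ! 0" by (cases ys) auto
  have F: "hd ys \<in> Field (pos P S)" unfolding hd by (rule wchains_nth_in[OF ys]) simp
  have "drop 0 ys \<in> wchains (up (pos P S) (hd ys)) n"
    by (rule chain_take_drop(2)[OF fin_posets(1), of _ 0 n]) (simp_all add: ys hd)
  then have "ys \<in> wchains (up (pos P S) (hd ys)) n" by simp
  then show ?thesis using wchains_map[OF structure_maps_at(2)[OF P S F]] x by simp
qed

end

text \<open>The arguments are the variants of \<open>\<rho>(F \<otimes> K)\<close>, \<open>F\<close> and \<open>K\<close>, in this order.\<close>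

definition rho_variants :: "variant \<Rightarrow> variant \<Rightarrow> variant \<Rightarrow> bool" where
  "rho_variants v u w \<longleftrightarrow> (v, u, w) \<in> {(Plain, Plain, Plain), (Check, Plain, Check), (Hat, Hat, Plain)}"

text \<open>These facts about the three cases enter the computation: at the junction, chains of the
  left argument end at maximal and chains of the right one start at minimal elements, and each
  condition on an outer end of the result is also imposed on the argument containing that
  end.\<close>

lemma rho_variantsD:
  assumes "rho_variants v u w"
  shows "u \<in> {Plain, Hat}" "w \<in> {Plain, Check}"
    "v \<in> {Plain, Check} \<Longrightarrow> u \<in> {Plain, Check}" "v \<in> {Plain, Hat} \<Longrightarrow> w \<in> {Plain, Hat}"
  using assms by (auto simp: rho_variants_def)

lemma mult_nonzeroD: "(a :: 'k::{comm_ring,comm_monoid_mult}) * b \<noteq> 0 \<Longrightarrow> a \<noteq> 0 \<and> b \<noteq> 0"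
  by auto

lemma wchains_hd_last:
  assumes "xs \<in> wchains r n"
  shows "hd xs = xs ! 0" "last xs = xs ! n" "xs \<noteq> []"
proof -
  have l: "length xs = Suc n" using assms by (rule wchains_length)
  show "xs \<noteq> []" using l by auto
  then show "hd xs = xs ! 0" "last xs = xs ! n" using l by (simp_all add: hd_conv_nth last_conv_nth)
qed

section \<open>The Leibniz rule for the composition\<close>

context
  fixes P :: "('a, 'p) ops_data" and S \<pi> :: "'a pt set"
  assumes P: "operadic_poset_species P" and S: "fin_set S" and \<pi>: "\<pi> \<in> Parts S"
begin

lemmas fin_poset_S = species_fin_poset[OF P S]
  and fin_poset_\<pi> = fin_poset_blocks(1)[OF P S \<pi>]
  and fin_poset_prod = fin_poset_blocks(3)[OF P S \<pi>]

lemma twist_cochains: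
  assumes v: "rho_variants v u w"
    and F: "F \<in> cochains u (pos P \<pi>) m" and K: "K \<in> cochains w (blocks_poset P \<pi>) n"
  shows "twist P S \<pi> m n F K \<in> cochains v (pos P S) (m + n)"
proof (rule cochainsI)
  fix zs assume nz: "twist P S \<pi> m n F K zs \<noteq> 0"
  then show "zs \<in> chains (pos P S) (m + n)" using twist_eq_0[OF P S \<pi>] by blast
  then have zs: "zs \<in> wchains (pos P S) (m + n)" by (simp add: chains_iff)
  let ?x = "zs ! m"
  let ?xs = "take (Suc m) zs" and ?ys = "drop m zs"
  note ctd = chain_take_drop[OF fin_poset_S zs refl] and le = wchains_nth_le[OF fin_poset_S zs]
  have x: "?x \<in> Field (pos P S)" using zs by (rule wchains_nth_in) simp
  have "lpart P S \<pi> F ?xs \<noteq> 0" "rpart P S \<pi> K ?ys \<noteq> 0"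
    using nz mult_nonzeroD unfolding twist_wchain[OF P S \<pi> F K zs] by blast+
  then have a: "amap P S ?x = \<pi>" and nF: "F (map (phi P S ?x) ?xs) \<noteq> 0" and nK: "K (map (psi P S ?x) ?ys) \<noteq> 0"
    unfolding lpart_def rpart_def ctd(3,4) by (auto split: if_splits)
  note hl = wchains_hd_last[OF zs]
  have ne: "?xs \<noteq> []" "?ys \<noteq> []" using hl(3) wchains_length[OF zs] by simp_all
  have hx: "hd ?xs = hd zs" and ly: "last ?ys = last zs"
    using wchains_length[OF zs] hl(3) by (simp_all add: hd_take)
  show "hd zs \<in> minimals (pos P S)" if "v \<in> {Plain, Check}"
  proof -
    have "hd (map (phi P S ?x) ?xs) \<in> minimals (pos P \<pi>)"
      by (rule cochains_hd[OF F nF rho_variantsD(3)[OF v that]])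
    then have "phi P S ?x (hd zs) \<in> minimals (pos P (amap P S ?x))" by (simp only: hd_map[OF ne(1)] hx a)
    then show ?thesis using le[of 0 m] by (intro phi_minimal[OF P S, of _ ?x]) (simp_all add: hl(1))
  qed
  show "last zs \<in> maximals (pos P S)" if "v \<in> {Plain, Hat}"
  proof -
    have xl: "(?x, last zs) \<in> pos P S" using le[of m "m + n"] by (simp add: hl(2))
    have "last (map (psi P S ?x) ?ys) \<in> maximals (blocks_poset P \<pi>)"
      by (rule cochains_last[OF K nK rho_variantsD(4)[OF v that]])
    then have mx: "psi P S ?x (last zs) \<in> maximals (blocks_poset P \<pi>)" by (simp only: last_map[OF ne(2)] ly)
    show ?thesis
    proof (rule psi_maximal[OF P S xl])
      fix T assume "T \<in> amap P S ?x"
      then show "psi P S ?x (last zs) T \<in> maximals (pos P (elts T))"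
        using maximals_prod_posetD[OF _ mx, of T] fin_poset_blocks(2)[OF P S \<pi>] a by simp
    qed
  qed
qed

text \<open>Every face but the last keeps the final entry \<open>x'\<close>. For the last face
  either \<open>phi_eq\<close> applies, or both sides vanish: the left one because the new final
  entry is not over \<pi>, the right one because \<open>F\<close> lives on chains ending at maximal
  elements.\<close>

lemma coface_sum_lpart:
  assumes F: "F \<in> cochains u (pos P \<pi>) m" and u: "u \<in> {Plain, Hat}"
    and xs: "xs \<in> wchains (pos P S) (Suc m)" and a: "amap P S (last xs) = \<pi>"
  shows "coface_sum (lpart P S \<pi> F) xs = lpart P S \<pi> (d (pos P \<pi>) m F) xs"
proof -
  let ?x' = "last xs" and ?x = "xs ! m"
  note hl = wchains_hd_last[OF xs] and lx = wchains_length[OF xs]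
  have le: "(?x, ?x') \<in> pos P S"
    unfolding hl(2) by (rule wchains_nth_le[OF fin_poset_S xs]) simp_all
  have "lpart P S \<pi> F (del i xs) = F (map (phi P S ?x') (del i xs))" if i: "i < length xs" for i
  proof (cases "i = Suc m")
    case False
    have "last (del i xs) = ?x'"
      using False i lx by (simp add: del_def last_drop)
    then show ?thesis by (simp add: lpart_def a)
  next
    case True
    have b: "del i xs = take (Suc m) xs" using lx True by (simp add: del_def)
    have w: "del i xs \<in> wchains (pos P S) m" by (rule del_wchains[OF xs]) (simp add: True)
    have l: "last (del i xs) = ?x"
      unfolding b using lx by (simp add: take_Suc_conv_app_nth)
    show ?thesis
    proof (cases "amap P S ?x = \<pi>")
      case True
      have "map (phi P S ?x) (del i xs) = map (phi P S ?x') (del i xs)"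
      proof (rule map_cong[OF refl])
        fix y assume "y \<in> set (del i xs)"
        then obtain j where "j \<le> m" "y = del i xs ! j"
          using wchains_length[OF w] by (auto simp: in_set_conv_nth less_Suc_eq_le)
        then have "(y, ?x) \<in> pos P S"
          using wchains_nth_le[OF fin_poset_S w, of j m] wchains_hd_last(2)[OF w] l by simp
        then show "phi P S ?x y = phi P S ?x' y"
          using True a by (intro phi_eq[OF P S le]) simp_all
      qed
      then show ?thesis using True by (simp only: lpart_def l if_True refl)
    next
      case False
      have "phi P S ?x' ?x \<notin> maximals (pos P \<pi>)"
        using phi_maximal_iff[OF P S le] a False by simp
      moreover have "last (map (phi P S ?x') (del i xs)) = phi P S ?x' ?x"
        using wchains_hd_last(3)[OF w] l by (simp add: last_map)
      ultimately have "F (map (phi P S ?x') (del i xs)) = 0"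
        using cochains_last[OF F _ u] by metis
      then show ?thesis using False by (simp only: lpart_def l if_False)
    qed
  qed
  then have "coface_sum (lpart P S \<pi> F) xs = coface_sum (\<lambda>xs. F (map (phi P S ?x') xs)) xs"
    by (rule coface_sum_cong)
  also have "\<dots> = coface_sum F (map (phi P S ?x') xs)" by (rule coface_sum_map)
  also have "\<dots> = d (pos P \<pi>) m F (map (phi P S ?x') xs)"
    by (rule d_wchain[OF fin_poset_\<pi> F map_phi_wchains[OF P S \<pi> xs a], symmetric])
  finally show ?thesis by (simp only: lpart_def a if_True refl)
qed

text \<open>The mirror image of \<open>coface_sum_lpart\<close>: now only the first face changes the
  element over \<pi>, and \<open>psi_eq\<close> or minimality in a product takes care of it.\<close>

lemma coface_sum_rpart:
  assumes K: "K \<in> cochains w (blocks_poset P \<pi>) n" and w: "w \<in> {Plain, Check}"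
    and ys: "ys \<in> wchains (pos P S) (Suc n)" and a: "amap P S (hd ys) = \<pi>"
  shows "coface_sum (rpart P S \<pi> K) ys = rpart P S \<pi> (d (blocks_poset P \<pi>) n K) ys"
proof -
  let ?x = "hd ys" and ?x' = "ys ! Suc 0"
  note hl = wchains_hd_last[OF ys] and ly = wchains_length[OF ys]
  have le: "(?x, ?x') \<in> pos P S"
    unfolding hl(1) by (rule wchains_nth_le[OF fin_poset_S ys]) simp_all
  have "rpart P S \<pi> K (del i ys) = K (map (psi P S ?x) (del i ys))" if i: "i < length ys" for i
  proof (cases "i = 0")
    case False
    have "hd (del i ys) = ?x"
      using False hl(3) by (cases ys; cases i) (simp_all add: del_def)
    then show ?thesis by (simp add: rpart_def a)
  next
    case True
    have w': "del i ys \<in> wchains (pos P S) n" by (rule del_wchains[OF ys]) (simp add: True)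
    have l: "hd (del i ys) = ?x'"
      using ly by (simp add: True del_def hd_drop_conv_nth)
    show ?thesis
    proof (cases "amap P S ?x' = \<pi>")
      case True
      have "map (psi P S ?x') (del i ys) = map (psi P S ?x) (del i ys)"
      proof (rule map_cong[OF refl])
        fix y assume "y \<in> set (del i ys)"
        then obtain j where "j \<le> n" "y = del i ys ! j"
          using wchains_length[OF w'] by (auto simp: in_set_conv_nth less_Suc_eq_le)
        then have "(?x', y) \<in> pos P S"
          using wchains_nth_le[OF fin_poset_S w', of 0 j] wchains_hd_last(1)[OF w'] l by simp
        then show "psi P S ?x' y = psi P S ?x y"
          using True a by (intro psi_eq[OF P S le, symmetric]) simp_all
      qed
      then show ?thesis using True by (simp only: rpart_def l if_True refl)
    next
      case False
      have "\<not> (\<forall>T\<in>\<pi>. psi P S ?x ?x' T \<in> minimals (pos P (elts T)))"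
        using psi_minimal_iff[OF P S le] a False by simp
      \<comment> \<open>Minimality in the product is traded for minimality of all coordinates, which
        is what \<open>psi_minimal_iff\<close> speaks of.\<close>
      moreover have "psi P S ?x ?x' T \<in> minimals (pos P (elts T))"
        if "psi P S ?x ?x' \<in> minimals (blocks_poset P \<pi>)" "T \<in> \<pi>" for T
        by (rule minimals_prod_posetD[of \<pi> "\<lambda>T. pos P (elts T)", OF fin_poset_blocks(2)[OF P S \<pi>] that])
      ultimately have "psi P S ?x ?x' \<notin> minimals (blocks_poset P \<pi>)" by blast
      moreover have "hd (map (psi P S ?x) (del i ys)) = psi P S ?x ?x'"
        using wchains_hd_last(3)[OF w'] l by (simp add: hd_map)
      ultimately have "K (map (psi P S ?x) (del i ys)) = 0"
        using cochains_hd[OF K _ w] by metis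
      then show ?thesis using False by (simp only: rpart_def l if_False)
    qed
  qed
  then have "coface_sum (rpart P S \<pi> K) ys = coface_sum (\<lambda>ys. K (map (psi P S ?x) ys)) ys"
    by (rule coface_sum_cong)
  also have "\<dots> = coface_sum K (map (psi P S ?x) ys)" by (rule coface_sum_map)
  also have "\<dots> = d (blocks_poset P \<pi>) n K (map (psi P S ?x) ys)"
    by (rule d_wchain[OF fin_poset_prod K map_psi_wchains[OF P S \<pi> ys a], symmetric])
  finally show ?thesis by (simp only: rpart_def a if_True refl)
qed

lemma d_twist:
  assumes v: "rho_variants v u w"
    and F: "F \<in> cochains u (pos P \<pi>) m" and K: "K \<in> cochains w (blocks_poset P \<pi>) n"
    and zs: "zs \<in> wchains (pos P S) (Suc (m + n))"
  shows "d (pos P S) (m + n) (twist P S \<pi> m n F K) zs =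
    twist P S \<pi> (Suc m) n (d (pos P \<pi>) m F) K zs +
    (- 1) ^ m * twist P S \<pi> m (Suc n) F (d (blocks_poset P \<pi>) n K) zs"
proof -
  let ?A = "lpart P S \<pi> F" and ?B = "rpart P S \<pi> K"
  let ?dA = "lpart P S \<pi> (d (pos P \<pi>) m F)" and ?dB = "rpart P S \<pi> (d (blocks_poset P \<pi>) n K)"
  have lz: "length zs = Suc (Suc (m + n))" using zs by (rule wchains_length)
  have zs1: "zs \<in> wchains (pos P S) (Suc m + n)" and zs2: "zs \<in> wchains (pos P S) (m + Suc n)"
    using zs by simp_all
  note c1 = chain_take_drop[OF fin_poset_S zs1 refl] and c2 = chain_take_drop[OF fin_poset_S zs2 refl]
  have t: "take (Suc (Suc m)) zs \<in> wchains (pos P S) (Suc m)" by (rule wchains_take[OF zs1]) simp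
  have dr: "drop m zs \<in> wchains (pos P S) (Suc n)" by (rule wchains_drop[OF zs2])
  have "d (pos P S) (m + n) (twist P S \<pi> m n F K) zs = coface_sum (twist P S \<pi> m n F K) zs"
    by (rule d_wchain[OF fin_poset_S twist_cochains[OF v F K] zs])
  also have "\<dots> = coface_sum (\<lambda>zs. ?A (take (Suc m) zs) * ?B (drop m zs)) zs"
  proof (rule coface_sum_cong)
    fix i assume "i < length zs"
    then have "del i zs \<in> wchains (pos P S) (m + n)" using lz by (intro del_wchains[OF zs]) simp
    then show "twist P S \<pi> m n F K (del i zs) = ?A (take (Suc m) (del i zs)) * ?B (drop m (del i zs))"
      by (rule twist_wchain[OF P S \<pi> F K])
  qed
  also have "\<dots> = coface_sum ?A (take (Suc (Suc m)) zs) * ?B (drop (Suc m) zs) +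
      (- 1) ^ m * (?A (take (Suc m) zs) * coface_sum ?B (drop m zs))"
    by (rule coface_sum_cup[OF lz])
  also have "coface_sum ?A (take (Suc (Suc m)) zs) * ?B (drop (Suc m) zs) =
      ?dA (take (Suc (Suc m)) zs) * ?B (drop (Suc m) zs)"
  \<comment> \<open>\<open>coface_sum_lpart\<close> applies only to lists ending over \<pi>.
    Otherwise the other factor, whose list starts at the same element, is zero.\<close>
  proof (cases "amap P S (zs ! Suc m) = \<pi>")
    case True
    then show ?thesis using coface_sum_lpart[OF F rho_variantsD(1)[OF v] t] c1(3) by simp
  next
    case False
    then have "?B (drop (Suc m) zs) = 0" unfolding rpart_def c1(4) by simp
    then show ?thesis by simp
  qed
  also have "\<dots> = twist P S \<pi> (Suc m) n (d (pos P \<pi>) m F) K zs"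
    by (rule twist_wchain[OF P S \<pi> d_cochains[OF fin_poset_\<pi> F] K zs1, symmetric])
  also have "?A (take (Suc m) zs) * coface_sum ?B (drop m zs) = ?A (take (Suc m) zs) * ?dB (drop m zs)"
  proof (cases "amap P S (zs ! m) = \<pi>")
    case True
    then show ?thesis using coface_sum_rpart[OF K rho_variantsD(2)[OF v] dr] c2(4) by simp
  next
    case False
    then have "?A (take (Suc m) zs) = 0" unfolding lpart_def c2(3) by simp
    then show ?thesis by simp
  qed
  also have "\<dots> = twist P S \<pi> m (Suc n) F (d (blocks_poset P \<pi>) n K) zs"
    by (rule twist_wchain[OF P S \<pi> F d_cochains[OF fin_poset_prod K] zs2, symmetric])
  finally show ?thesis .
qed

section \<open>The composition on cocycles and on cohomology classes\<close>

lemma twist_0_left: "twist P S \<pi> m n 0 K = 0"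
  by (simp add: twist_def pull_0 concat_at_def fun_eq_iff)

lemma twist_0_right: "twist P S \<pi> m n F 0 = 0"
  by (simp add: twist_def pull_0 concat_at_def fun_eq_iff)

lemma twist_diff:
  assumes v: "rho_variants v u w"
    and F: "F \<in> cochains u (pos P \<pi>) m" "F' \<in> cochains u (pos P \<pi>) m"
    and K: "K \<in> cochains w (blocks_poset P \<pi>) n" "K' \<in> cochains w (blocks_poset P \<pi>) n"
  shows "twist P S \<pi> m n F K - twist P S \<pi> m n F' K' =
    twist P S \<pi> m n (F - F') K + twist P S \<pi> m n F' (K - K')"
proof (rule cochains_eqI)
  note tw = twist_cochains[OF v]
  show "twist P S \<pi> m n F K - twist P S \<pi> m n F' K' \<in> cochains v (pos P S) (m + n)"
    by (intro cochains_diff tw F K)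
  show "twist P S \<pi> m n (F - F') K + twist P S \<pi> m n F' (K - K') \<in> cochains v (pos P S) (m + n)"
    by (intro cochains_diff cochains_add tw F K)
  fix zs assume zs: "zs \<in> wchains (pos P S) (m + n)"
  note W = twist_wchain[OF P S \<pi> _ _ zs]
  have "lpart P S \<pi> (F - F') xs = lpart P S \<pi> F xs - lpart P S \<pi> F' xs"
    and "rpart P S \<pi> (K - K') ys = rpart P S \<pi> K ys - rpart P S \<pi> K' ys" for xs ys
    by (simp_all add: lpart_def rpart_def)
  then show "(twist P S \<pi> m n F K - twist P S \<pi> m n F' K') zs =
      (twist P S \<pi> m n (F - F') K + twist P S \<pi> m n F' (K - K')) zs"
    unfolding minus_apply plus_fun_def W[OF F(1) K(1)] W[OF F(2) K(2)] W[OF cochains_diff[OF F] K(1)]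
      W[OF F(2) cochains_diff[OF K]]
    by (simp add: left_diff_distrib right_diff_distrib)
qed

lemma d_twist_eq:
  assumes v: "rho_variants v u w"
    and F: "F \<in> cochains u (pos P \<pi>) m" and K: "K \<in> cochains w (blocks_poset P \<pi>) n"
  shows "d (pos P S) (m + n) (twist P S \<pi> m n F K) =
    (\<lambda>zs. twist P S \<pi> (Suc m) n (d (pos P \<pi>) m F) K zs +
    (- 1) ^ m * twist P S \<pi> m (Suc n) F (d (blocks_poset P \<pi>) n K) zs)"
proof
  fix zs
  show "d (pos P S) (m + n) (twist P S \<pi> m n F K) zs =
    twist P S \<pi> (Suc m) n (d (pos P \<pi>) m F) K zs +
    (- 1) ^ m * twist P S \<pi> m (Suc n) F (d (blocks_poset P \<pi>) n K) zs"
  proof (cases "zs \<in> wchains (pos P S) (Suc (m + n))")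
    case True
    then show ?thesis by (rule d_twist[OF v F K])
  next
    case False
    then have n: "zs \<notin> chains (pos P S) (Suc (m + n))" by (simp add: chains_iff)
    then have "zs \<notin> chains (pos P S) (Suc m + n)" "zs \<notin> chains (pos P S) (m + Suc n)" by simp_all
    note n' = twist_eq_0[OF P S \<pi> this(1)] twist_eq_0[OF P S \<pi> this(2)]
    show ?thesis by (simp only: n' d_eq_0[OF n] mult_zero_right add_0_left)
  qed
qed

lemma twist_cocycles:
  assumes v: "rho_variants v u w"
    and F: "F \<in> cocycles u (pos P \<pi>) m" and K: "K \<in> cocycles w (blocks_poset P \<pi>) n"
  shows "twist P S \<pi> m n F K \<in> cocycles v (pos P S) (m + n)"
proof -
  have F': "F \<in> cochains u (pos P \<pi>) m" "d (pos P \<pi>) m F = 0"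
    and K': "K \<in> cochains w (blocks_poset P \<pi>) n" "d (blocks_poset P \<pi>) n K = 0"
    using F K by (simp_all add: cocycles_def)
  have "d (pos P S) (m + n) (twist P S \<pi> m n F K) = 0"
    unfolding d_twist_eq[OF v F'(1) K'(1)] F'(2) K'(2) twist_0_left twist_0_right by (simp add: zero_fun_def)
  then show ?thesis
    using twist_cochains[OF v F'(1) K'(1)] by (simp add: cocycles_def)
qed

text \<open>By \<open>twist_diff\<close>, first \<open>F\<close> changes with \<open>K\<close> held
  fixed, then \<open>K\<close> with \<open>F'\<close> held fixed. The fixed argument is a cocycle
  each time, so the Leibniz rule exhibits the change as a coboundary, in the second step up to
  sign.\<close>

lemma twist_cohomologous:
  assumes v: "rho_variants v u w"
    and F: "(F, F') \<in> cohomologous u (pos P \<pi>) m" and K: "(K, K') \<in> cohomologous w (blocks_poset P \<pi>) n"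
  shows "(twist P S \<pi> m n F K, twist P S \<pi> m n F' K') \<in> cohomologous v (pos P S) (m + n)"
proof -
  have Fz: "F \<in> cocycles u (pos P \<pi>) m" "F' \<in> cocycles u (pos P \<pi>) m" "F - F' \<in> coboundaries u (pos P \<pi>) m"
    and Kz: "K \<in> cocycles w (blocks_poset P \<pi>) n" "K' \<in> cocycles w (blocks_poset P \<pi>) n"
      "K - K' \<in> coboundaries w (blocks_poset P \<pi>) n"
    using F K by (simp_all add: cohomologous_def)
  note Fc = cocycles_cochains[OF Fz(1)] cocycles_cochains[OF Fz(2)]
    and Kc = cocycles_cochains[OF Kz(1)] cocycles_cochains[OF Kz(2)]
  have 1: "twist P S \<pi> m n (F - F') K \<in> coboundaries v (pos P S) (m + n)"
  proof (cases m)
    case 0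
    then have "F - F' = 0" using Fz(3) by simp
    then show ?thesis by (simp only: twist_0_left coboundaries_0)
  next
    case (Suc k)
    then obtain H where H: "H \<in> cochains u (pos P \<pi>) k" "F - F' = d (pos P \<pi>) k H" using Fz(3) by auto
    have "d (blocks_poset P \<pi>) n K = 0" using Kz(1) by (simp add: cocycles_def)
    then have "d (pos P S) (k + n) (twist P S \<pi> k n H K) = twist P S \<pi> m n (F - F') K"
      using d_twist_eq[OF v H(1) Kc(1)] by (simp add: H(2) Suc twist_0_right)
    then show ?thesis
      using twist_cochains[OF v H(1) Kc(1)] unfolding Suc by (auto intro!: rev_image_eqI)
  qed
  have 2: "twist P S \<pi> m n F' (K - K') \<in> coboundaries v (pos P S) (m + n)"
  proof (cases n)
    case 0
    then have "K - K' = 0" using Kz(3) by simp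
    then show ?thesis by (simp only: twist_0_right coboundaries_0)
  next
    case (Suc k)
    then obtain H where H: "H \<in> cochains w (blocks_poset P \<pi>) k" "K - K' = d (blocks_poset P \<pi>) k H"
      using Kz(3) by auto
    have "d (pos P \<pi>) m F' = 0" using Fz(2) by (simp add: cocycles_def)
    then have e: "d (pos P S) (m + k) (twist P S \<pi> m k F' H) = (\<lambda>zs. (- 1) ^ m * twist P S \<pi> m n F' (K - K') zs)"
      using d_twist_eq[OF v Fc(2) H(1)] by (simp add: H(2) Suc twist_0_left)
    have "d (pos P S) (m + k) (twist P S \<pi> m k F' H) \<in> coboundaries v (pos P S) (m + n)"
      using twist_cochains[OF v Fc(2) H(1)] by (simp add: Suc)
    from coboundaries_smult[OF this, of "(- 1) ^ m"] show ?thesis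
      unfolding e by (simp add: sign_mult_self)
  qed
  show ?thesis
    using twist_cocycles[OF v Fz(1) Kz(1)] twist_cocycles[OF v Fz(2) Kz(2)] coboundaries_add[OF 1 2]
    unfolding cohomologous_def twist_diff[OF v Fc Kc, symmetric] by blast
qed

end

section \<open>Composition in cohomology\<close>

context
  fixes P :: "('a, 'p) ops_data" and S :: "'a pt set" and Ts :: "'a pt list"
  assumes P: "operadic_poset_species P" and S: "fin_set S" and Ts: "set Ts \<in> Parts S"
begin

lemmas fin_poset_block = fin_poset_blocks(2)[OF P S Ts]

lemma kunneth_blocks_cohomologous:
  assumes "factors (\<lambda>T. cohomologous w (pos P (elts T))) Ts ns GGs"
  shows "(kunneth (\<lambda>T. pos P (elts T)) Ts ns (map fst GGs), kunneth (\<lambda>T. pos P (elts T)) Ts ns (map snd GGs))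
    \<in> cohomologous w (blocks_poset P (set Ts)) (sum_list ns)"
proof -
  have "factors (\<lambda>T. cocycles w (pos P (elts T))) Ts ns (map fst GGs)"
    and "factors (\<lambda>T. cocycles w (pos P (elts T))) Ts ns (map snd GGs)"
    by (rule factors_mono[OF assms]; auto simp: cohomologous_def)+
  note k = kunneth_cocycles[of Ts "\<lambda>T. pos P (elts T)", OF fin_poset_block this(1)]
    kunneth_cocycles[of Ts "\<lambda>T. pos P (elts T)", OF fin_poset_block this(2)]
  \<comment> \<open>The exchange of factors starts with an empty prefix.\<close>
  have "kunneth (\<lambda>T. pos P (elts T)) ([] @ Ts) ([] @ ns) ([] @ map fst GGs) -
      kunneth (\<lambda>T. pos P (elts T)) ([] @ Ts) ([] @ ns) ([] @ map snd GGs)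
    \<in> coboundaries w (prod_poset (set ([] @ Ts)) (\<lambda>T. pos P (elts T))) (sum_list ([] @ ns))"
    by (rule kunneth_cohomologous[OF assms factors.Nil]) (use fin_poset_block in simp)
  then show ?thesis using k by (simp add: cohomologous_def)
qed

lemma rho_cochain_cocycles:
  assumes v: "rho_variants v u w" and F: "F \<in> cocycles u (pos P (set Ts)) m"
    and Gs: "factors (\<lambda>T. cocycles w (pos P (elts T))) Ts ns Gs"
  shows "rho_cochain P S Ts m F ns Gs \<in> cocycles v (pos P S) (m + sum_list ns)"
  unfolding rho_cochain_twist
  by (intro twist_cocycles[OF P S Ts v F] kunneth_cocycles[OF fin_poset_block Gs])

text \<open>All representatives in the union defining \<open>rho\<close> give cohomologous cochains,
  so the union is a single class: the composition is well defined on cohomology.\<close>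

lemma rho_coclass:
  assumes v: "rho_variants v u w" and F: "F \<in> cocycles u (pos P (set Ts)) m"
    and Gs: "factors (\<lambda>T. cocycles w (pos P (elts T))) Ts ns Gs"
  shows "rho v P S Ts m (coclass u (pos P (set Ts)) m F) ns
      (map (\<lambda>i. coclass w (pos P (elts (Ts ! i))) (ns ! i) (Gs ! i)) [0..<length Ts]) =
    coclass v (pos P S) (m + sum_list ns) (rho_cochain P S Ts m F ns Gs)"
    (is "rho v P S Ts m ?A ns ?Bs = ?C")
proof -
  have len: "length ns = length Ts" "length Gs = length Ts" using Gs by (simp_all add: factors_iff)
  have eq: "coclass v (pos P S) (m + sum_list ns) (rho_cochain P S Ts m F' ns Gs') = ?C"
    if F': "F' \<in> ?A" and Gs': "Gs' \<in> listset ?Bs" for F' Gs'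
  proof (rule coclass_eq)
    have B: "length Gs' = length Ts \<and> (\<forall>i<length Ts. Gs' ! i \<in> coclass w (pos P (elts (Ts ! i))) (ns ! i) (Gs ! i))"
      using Gs' by (auto simp: listset_iff list_all2_conv_all_nth)
    \<comment> \<open>Pairing the two choices of representatives yields one tuple of cohomologous
      pairs, the form in which factors are exchanged.\<close>
    then have "factors (\<lambda>T. cohomologous w (pos P (elts T))) Ts ns (zip Gs Gs')"
      using len by (simp add: factors_iff)
    note k = kunneth_blocks_cohomologous[OF this]
    have z: "map fst (zip Gs Gs') = Gs" "map snd (zip Gs Gs') = Gs'" using B len by simp_all
    have F2: "(F, F') \<in> cohomologous u (pos P (set Ts)) m" using F' by simp
    show "rho_cochain P S Ts m F' ns Gs' \<in> ?C"
      using twist_cohomologous[OF P S Ts v F2 k[unfolded z]] unfolding rho_cochain_twist by simp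
  qed
  have "F \<in> ?A" using coclass_self[OF F] .
  moreover have "Gs ! i \<in> coclass w (pos P (elts (Ts ! i))) (ns ! i) (Gs ! i)" if "i < length Ts" for i
    using Gs that by (intro coclass_self) (simp add: factors_iff)
  then have "Gs \<in> listset ?Bs"
    using len by (simp add: listset_iff list_all2_conv_all_nth)
  ultimately show ?thesis unfolding rho_def using eq by blast
qed

end

section \<open>Morphisms of operadic poset species\<close>

text \<open>An injective poset morphism reflects extremal elements: a \<open>y\<close> on the
  relevant side of \<open>x\<close> satisfies \<open>h y = h x\<close>, and the left inverse gives
  \<open>y = x\<close>.\<close>

lemma cohom_map_iso:
  assumes "fin_poset r" "fin_poset s" and h: "poset_hom r s h" and h': "poset_hom s r h'"
    and inv: "\<And>x. x \<in> Field r \<Longrightarrow> h' (h x) = x"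
  shows "cohom_map r s h"
proof -
  have mono: "(h x, h y) \<in> s" if "(x, y) \<in> r" for x y
    using h that by (auto simp: poset_hom_def)
  have "x \<in> minimals r" if x: "x \<in> Field r" "h x \<in> minimals s" for x
  proof -
    have "y = x" if "(y, x) \<in> r" for y
    proof -
      have "h y = h x" using mono[OF that] x(2) by (simp add: minimals_def)
      then have "h' (h y) = h' (h x)" by simp
      then show ?thesis by (simp only: inv[OF FieldI1[OF that]] inv[OF x(1)])
    qed
    then show ?thesis using x(1) by (simp add: minimals_def)
  qed
  moreover have "x \<in> maximals r" if x: "x \<in> Field r" "h x \<in> maximals s" for x
  proof -
    have "y = x" if "(x, y) \<in> r" for y
    proof -
      have "h y = h x" using mono[OF that] x(2) by (simp add: maximals_def)
      then have "h' (h y) = h' (h x)" by simp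
      then show ?thesis by (simp only: inv[OF FieldI2[OF that]] inv[OF x(1)])
    qed
    then show ?thesis using x(1) by (simp add: maximals_def)
  qed
  ultimately show ?thesis using assms by (simp add: cohom_map_def)
qed

lemma cohom_map_act:
  assumes P: "operadic_poset_species P" and S: "fin_set S" and g: "inj_on g S"
  shows "cohom_map (pos P S) (pos P (g ` S)) (act P S g)"
proof (rule cohom_map_iso)
  have gS: "fin_set (g ` S)" using S by (simp add: fin_set_def)
  \<comment> \<open>The inverse bijection acts into \<open>P\<close> of the image of the image of
    \<open>S\<close>, which has to be recognised as \<open>S\<close>.\<close>
  have im: "inv_into S g ` g ` S = S" using g by (simp add: inv_into_image_cancel)
  show "fin_poset (pos P S)" "fin_poset (pos P (g ` S))"
    using species_fin_poset[OF P] S gS by simp_all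
  show "poset_hom (pos P S) (pos P (g ` S)) (act P S g)" by (rule act_hom[OF P S g])
  show "poset_hom (pos P (g ` S)) (pos P S) (act P (g ` S) (inv_into S g))"
    using act_hom[OF P gS inj_on_inv_into[OF subset_refl]] by (simp only: im)
  show "act P (g ` S) (inv_into S g) (act P S g x) = x" if "x \<in> Field (pos P S)" for x
    by (rule act_inverse[OF P S g that])
qed

lemma pull_cong:
  assumes "\<And>x. x \<in> Field r \<Longrightarrow> f x = g x"
  shows "pull r s f n F = pull r s g n F"
proof -
  have "map f xs = map g xs" if "xs \<in> chains r n" for xs
    using that assms by (intro map_cong refl) (auto simp: chains_def)
  then have "{xs \<in> chains r n. map f xs = ys} = {xs \<in> chains r n. map g xs = ys}" for ys by auto
  then show ?thesis unfolding pull_def by (simp only:)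
qed

lemma hpull_cong: "(\<And>x. x \<in> Field r \<Longrightarrow> f x = g x) \<Longrightarrow> hpull v r s f n A = hpull v r s g n A"
  unfolding hpull_def by (simp only: pull_cong[of r f g])

section \<open>Naturality of the composition\<close>

context
  fixes P :: "('a, 'p) ops_data" and Q :: "('a, 'q) ops_data" and f :: "'a pt set \<Rightarrow> 'p \<Rightarrow> 'q"
  assumes P: "operadic_poset_species P" and Q: "operadic_poset_species Q" and f: "ops_morphism P Q f"
begin

lemma morphism_at:
  assumes S: "fin_set S"
  shows "poset_hom (pos P S) (pos Q S) (f S)"
    and "inj_on g S \<Longrightarrow> x \<in> Field (pos P S) \<Longrightarrow> f (g ` S) (act P S g x) = act Q S g (f S x)"
    and "x \<in> Field (pos P S) \<Longrightarrow> amap Q S (f S x) = amap P S x"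
    and "(y, x) \<in> pos P S \<Longrightarrow> phi Q S (f S x) (f S y) = f (amap P S x) (phi P S x y)"
    and "(x, y) \<in> pos P S \<Longrightarrow> T \<in> amap P S x \<Longrightarrow> psi Q S (f S x) (f S y) T = f (elts T) (psi P S x y T)"
proof -
  note a = f[unfolded ops_morphism_def, rule_format, OF S]
  show "poset_hom (pos P S) (pos Q S) (f S)" by (rule conjunct1[OF a])
  show "f (g ` S) (act P S g x) = act Q S g (f S x)" if "inj_on g S" "x \<in> Field (pos P S)"
    by (rule conjunct1[OF conjunct2[OF a], rule_format]) (simp add: that)
  note b = conjunct2[OF conjunct2[OF a], rule_format]
  show "amap Q S (f S x) = amap P S x" if "x \<in> Field (pos P S)"
    by (rule conjunct1[OF b[OF that]])
  show "phi Q S (f S x) (f S y) = f (amap P S x) (phi P S x y)" if "(y, x) \<in> pos P S"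
    using that by (rule conjunct1[OF conjunct2[OF b[OF FieldI2[OF that]]], rule_format])
  show "psi Q S (f S x) (f S y) T = f (elts T) (psi P S x y T)" if "(x, y) \<in> pos P S" "T \<in> amap P S x"
    using that by (rule conjunct2[OF conjunct2[OF b[OF FieldI1[OF that(1)]]], rule_format])
qed

text \<open>\<open>f\<close> preserves \<open>a\<close>, and \<open>a\<close> detects extremal
  elements in both species.\<close>

lemma cohom_map_morphism:
  assumes S: "fin_set S"
  shows "cohom_map (pos P S) (pos Q S) (f S)"
proof -
  note h = morphism_at[OF S]
  have F: "f S x \<in> Field (pos Q S)" if "x \<in> Field (pos P S)" for x
    using h(1) that by (auto simp: poset_hom_def)
  show ?thesis
    unfolding cohom_map_def
    using species_fin_poset[OF P S] species_fin_poset[OF Q S] h(1)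
      minimals_iff_amap[OF P S] minimals_iff_amap[OF Q S F] maximals_iff_amap[OF P S] maximals_iff_amap[OF Q S F] h(3)
    by simp
qed

text \<open>Compatibility with \<open>psi\<close> gives equality on the blocks; elsewhere both
  tuples are \<open>undefined\<close>, as elements of a product are extensional. Full equality is
  needed because cochains are evaluated on lists of such tuples.\<close>

lemma map_psi_morphism:
  assumes S: "fin_set S" and le: "(x, y) \<in> pos P S"
  shows "(\<lambda>T\<in>amap P S x. f (elts T) (psi P S x y T)) = psi Q S (f S x) (f S y)"
proof -
  have x: "x \<in> Field (pos P S)" using le by (rule FieldI1)
  note h = morphism_at[OF S]
  have le': "(f S x, f S y) \<in> pos Q S" using h(1) le by (auto simp: poset_hom_def)
  have "psi Q S (f S x) (f S y) \<in> Field (blocks_poset Q (amap P S x))"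
    using psi_hom(1)[OF Q S FieldI1[OF le'] le'] by (simp only: h(3)[OF x])
  then have "psi Q S (f S x) (f S y) \<in> extensional (amap P S x)"
    by (auto simp: Field_def prod_poset_def PiE_def)
  then show ?thesis
    using h(5)[OF le] by (intro extensionalityI[of _ "amap P S x"]) simp_all
qed

text \<open>At \<open>zs\<close> the left side works with \<open>f S (zs ! m)\<close> and the right
  side with \<open>zs ! m\<close>, which have the same partition, so both are zero or both reduce to
  a single product. Its two halves are compared by compatibility with \<open>phi\<close>, and by
  compatibility with \<open>psi\<close> together with naturality of the Kuenneth map.\<close>

lemma pull_rho_cochain:
  assumes S: "fin_set S" and Ts: "set Ts \<in> Parts S" and v: "rho_variants v u w"
    and F: "F \<in> cochains u (pos Q (set Ts)) m" and Gs: "factors (\<lambda>T. cochains w (pos Q (elts T))) Ts ns Gs"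
  shows "pull (pos P S) (pos Q S) (f S) (m + sum_list ns) (rho_cochain Q S Ts m F ns Gs) =
    rho_cochain P S Ts m (pull (pos P (set Ts)) (pos Q (set Ts)) (f (set Ts)) m F) ns
      (map (\<lambda>i. pull (pos P (elts (Ts ! i))) (pos Q (elts (Ts ! i))) (f (elts (Ts ! i))) (ns ! i) (Gs ! i)) [0..<length Ts])"
    (is "?L = rho_cochain P S Ts m ?F ns ?Gs")
proof -
  let ?\<pi> = "set Ts" and ?N = "sum_list ns"
  let ?KQ = "kunneth (\<lambda>T. pos Q (elts T)) Ts ns Gs" and ?KP = "kunneth (\<lambda>T. pos P (elts T)) Ts ns ?Gs"
  have f\<pi>: "fin_set ?\<pi>" by (rule Parts_fin_set[OF S Ts])
  have fT: "cohom_map (pos P (elts T)) (pos Q (elts T)) (f (elts T))" if "T \<in> ?\<pi>" for T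
    by (rule cohom_map_morphism[OF Parts_fin_set_elts[OF S Ts that]])
  have Gs': "factors (\<lambda>T. cochains w (pos P (elts T))) Ts ns ?Gs"
    using Gs by (auto simp: factors_iff intro!: pull_cochains fT)
  have KQ: "?KQ \<in> cochains w (blocks_poset Q ?\<pi>) ?N"
    by (rule kunneth_cochains[OF fin_poset_blocks(2)[OF Q S Ts] Gs])
  have KP: "?KP \<in> cochains w (blocks_poset P ?\<pi>) ?N"
    by (rule kunneth_cochains[OF fin_poset_blocks(2)[OF P S Ts] Gs'])
  have FP: "?F \<in> cochains u (pos P ?\<pi>) m"
    by (rule pull_cochains[OF cohom_map_morphism[OF f\<pi>] F])
  note TQ = twist_cochains[OF Q S Ts v F KQ] and TP = twist_cochains[OF P S Ts v FP KP]
  have "?L = twist P S ?\<pi> m ?N ?F ?KP"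
    unfolding rho_cochain_twist
  proof (rule cochains_eqI[OF pull_cochains[OF cohom_map_morphism[OF S] TQ] TP])
    fix zs assume zs: "zs \<in> wchains (pos P S) (m + ?N)"
    note h = morphism_at[OF S]
    let ?x = "zs ! m"
    let ?xs = "take (Suc m) zs" and ?ys = "drop m zs"
    note fpP = species_fin_poset[OF P S]
    note c = chain_take_drop[OF fpP zs refl]
    have lz: "length zs = Suc (m + ?N)" using zs by (rule wchains_length)
    have x: "?x \<in> Field (pos P S)" by (rule wchains_nth_in[OF zs]) simp
    have zs': "map (f S) zs \<in> wchains (pos Q S) (m + ?N)" by (rule wchains_map[OF h(1) zs])
    note c' = chain_take_drop[OF species_fin_poset[OF Q S] zs' refl]
    have x': "map (f S) zs ! m = f S ?x" using lz by simp
    have xs: "?xs \<in> wchains (pos P S) m" by (rule wchains_take[OF zs]) simp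
    have ys: "?ys \<in> wchains (pos P S) ?N" by (rule wchains_drop[OF zs])
    have xs_le: "(y, ?x) \<in> pos P S" if "y \<in> set ?xs" for y
      using c(1) that Field_down[OF fpP] by (auto simp: wchains_def)
    have ys_le: "(?x, y) \<in> pos P S" if "y \<in> set ?ys" for y
      using c(2) that Field_up[OF fpP] by (auto simp: wchains_def)
    have l: "lpart Q S ?\<pi> F (take (Suc m) (map (f S) zs)) = lpart P S ?\<pi> ?F ?xs"
    proof (cases "amap P S ?x = ?\<pi>")
      case True
      have "map (phi Q S (f S ?x)) (map (f S) ?xs) = map (f ?\<pi>) (map (phi P S ?x) ?xs)"
        using h(4)[OF xs_le] True by simp
      moreover have "?F (map (phi P S ?x) ?xs) = F (map (f ?\<pi>) (map (phi P S ?x) ?xs))"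
        using map_phi_wchains[OF P S Ts xs] c(3) True
        by (intro pull_wchain[OF _ _ F] fin_poset_blocks(1)[OF P S Ts] fin_poset_blocks(1)[OF Q S Ts]) simp
      ultimately show ?thesis
        unfolding lpart_def c'(3) c(3) x' h(3)[OF x] by (simp only: take_map True refl if_True)
    next
      case False
      then show ?thesis unfolding lpart_def c'(3) c(3) x' h(3)[OF x] by simp
    qed
    have r: "rpart Q S ?\<pi> ?KQ (drop m (map (f S) zs)) = rpart P S ?\<pi> ?KP ?ys"
    proof (cases "amap P S ?x = ?\<pi>")
      case True
      have "map (psi Q S (f S ?x)) (map (f S) ?ys) =
          map (\<lambda>u. \<lambda>T\<in>?\<pi>. f (elts T) (u T)) (map (psi P S ?x) ?ys)"
        using map_psi_morphism[OF S ys_le] True by simp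
      moreover have "map (psi P S ?x) ?ys \<in> wchains (blocks_poset P ?\<pi>) ?N"
        using map_psi_wchains[OF P S Ts ys] c(4) True by simp
      from pull_kunneth[of Ts "\<lambda>T. pos P (elts T)" "\<lambda>T. pos Q (elts T)" "\<lambda>T. f (elts T)", OF fT Gs this]
      have "?KQ (map (\<lambda>u. \<lambda>T\<in>?\<pi>. f (elts T) (u T)) (map (psi P S ?x) ?ys)) = ?KP (map (psi P S ?x) ?ys)" .
      ultimately show ?thesis
        unfolding rpart_def c'(4) c(4) x' h(3)[OF x] by (simp only: drop_map True refl if_True)
    next
      case False
      then show ?thesis unfolding rpart_def c'(4) c(4) x' h(3)[OF x] by simp
    qed
    show "pull (pos P S) (pos Q S) (f S) (m + ?N) (twist Q S ?\<pi> m ?N F ?KQ) zs = twist P S ?\<pi> m ?N ?F ?KP zs"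
      unfolding pull_wchain[OF fpP species_fin_poset[OF Q S] TQ zs]
        twist_wchain[OF Q S Ts F KQ zs'] twist_wchain[OF P S Ts FP KP zs] l r by (rule refl)
  qed
  then show ?thesis by (simp only: rho_cochain_twist)
qed

lemma pullback_coclass:
  assumes "fin_set S" "F \<in> cocycles v (pos Q S) n"
  shows "pullback v P Q f S n (coclass v (pos Q S) n F) = coclass v (pos P S) n (pull (pos P S) (pos Q S) (f S) n F)"
  unfolding pullback_def by (rule hpull_coclass[OF cohom_map_morphism[OF assms(1)] assms(2)])

text \<open>Once representatives are chosen for all factors, every operation on classes becomes one
  on cochains and \<open>pull_rho_cochain\<close> applies. The variants \<open>v\<close>,
  \<open>u\<close>, \<open>w\<close> cover the operad and both modules at once.\<close>

lemma pullback_rho: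
  assumes S: "fin_set S" and Ts: "set Ts \<in> Parts S" and v: "rho_variants v u w"
    and A: "A \<in> cohomology u (pos Q (set Ts)) m"
    and len: "length ns = length Ts" "length Bs = length Ts"
    and Bs: "\<And>i. i < length Ts \<Longrightarrow> Bs ! i \<in> cohomology w (pos Q (elts (Ts ! i))) (ns ! i)"
  shows "pullback v P Q f S (m + sum_list ns) (rho v Q S Ts m A ns Bs) =
    rho v P S Ts m (pullback u P Q f (set Ts) m A) ns (map_factors (pullback w P Q f) Ts ns Bs)"
proof -
  obtain F where F: "F \<in> cocycles u (pos Q (set Ts)) m" "A = coclass u (pos Q (set Ts)) m F"
    using A by (rule cohomologyE)
  have "\<exists>G. \<forall>i<length Ts. G i \<in> cocycles w (pos Q (elts (Ts ! i))) (ns ! i) \<and>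
      Bs ! i = coclass w (pos Q (elts (Ts ! i))) (ns ! i) (G i)"
    using Bs by (intro choice allI) (metis cohomologyE)
  then obtain G where G: "\<And>i. i < length Ts \<Longrightarrow> G i \<in> cocycles w (pos Q (elts (Ts ! i))) (ns ! i)"
    "\<And>i. i < length Ts \<Longrightarrow> Bs ! i = coclass w (pos Q (elts (Ts ! i))) (ns ! i) (G i)" by blast
  let ?Gs = "map G [0..<length Ts]"
  have Gs: "factors (\<lambda>T. cocycles w (pos Q (elts T))) Ts ns ?Gs"
    using G(1) len by (simp add: factors_iff)
  have Bs': "Bs = map (\<lambda>i. coclass w (pos Q (elts (Ts ! i))) (ns ! i) (?Gs ! i)) [0..<length Ts]"
    using G(2) len by (intro nth_equalityI) simp_all
  let ?F' = "pull (pos P (set Ts)) (pos Q (set Ts)) (f (set Ts)) m F"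
  let ?Gs' = "map (\<lambda>i. pull (pos P (elts (Ts ! i))) (pos Q (elts (Ts ! i))) (f (elts (Ts ! i))) (ns ! i) (?Gs ! i)) [0..<length Ts]"
  have fp: "fin_set (set Ts)" by (rule Parts_fin_set[OF S Ts])
  have fT: "fin_set (elts (Ts ! i))" if "i < length Ts" for i
    using that by (intro Parts_fin_set_elts[OF S Ts]) simp
  have F': "?F' \<in> cocycles u (pos P (set Ts)) m"
    by (rule pull_cocycles[OF cohom_map_morphism[OF fp] F(1)])
  have Gs': "factors (\<lambda>T. cocycles w (pos P (elts T))) Ts ns ?Gs'"
    using Gs by (auto simp: factors_iff intro!: pull_cocycles cohom_map_morphism fT)
  have mf: "map_factors (pullback w P Q f) Ts ns Bs =
      map (\<lambda>i. coclass w (pos P (elts (Ts ! i))) (ns ! i) (?Gs' ! i)) [0..<length Ts]"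
    unfolding map_factors_def
  proof (rule map_cong[OF refl])
    fix i assume "i \<in> set [0..<length Ts]"
    then have i: "i < length Ts" by simp
    show "pullback w P Q f (elts (Ts ! i)) (ns ! i) (Bs ! i) = coclass w (pos P (elts (Ts ! i))) (ns ! i) (?Gs' ! i)"
      unfolding G(2)[OF i] pullback_coclass[OF fT[OF i] G(1)[OF i]] using i by simp
  qed
  have "pullback v P Q f S (m + sum_list ns) (rho v Q S Ts m A ns Bs) =
      coclass v (pos P S) (m + sum_list ns)
        (pull (pos P S) (pos Q S) (f S) (m + sum_list ns) (rho_cochain Q S Ts m F ns ?Gs))"
    unfolding F(2) Bs' rho_coclass[OF Q S Ts v F(1) Gs]
    by (rule pullback_coclass[OF S rho_cochain_cocycles[OF Q S Ts v F(1) Gs]])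
  also have "\<dots> = coclass v (pos P S) (m + sum_list ns) (rho_cochain P S Ts m ?F' ns ?Gs')"
    by (simp only: pull_rho_cochain[OF S Ts v cocycles_cochains[OF F(1)] factors_cocycles_cochains[OF Gs]])
  also have "\<dots> = rho v P S Ts m (pullback u P Q f (set Ts) m A) ns (map_factors (pullback w P Q f) Ts ns Bs)"
    unfolding F(2) mf pullback_coclass[OF fp F(1)]
    by (rule rho_coclass[OF P S Ts v F' Gs', symmetric])
  finally show ?thesis .
qed

end

text \<open>A one-point poset has no chain with two elements, and its point is both minimal and
  maximal, so every variant is covered.\<close>

lemma basis_cocycle:
  assumes r: "fin_poset r" and p: "Field r = {p}"
  shows "basis [p] \<in> cocycles v r 0"
proof -
  have "[p] \<in> chains r 0" by (simp add: chains_def p)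
  moreover have "p \<in> minimals r" "p \<in> maximals r"
    using p unfolding minimals_def maximals_def by (auto simp: Field_def)
  ultimately have "basis [p] \<in> cochains v r 0"
    by (intro cochainsI) (auto simp: basis_def split: if_splits)
  moreover have "zs \<notin> chains r (Suc 0)" for zs
    by (auto simp: chains_def p length_Suc_conv)
  then have "d r 0 (basis [p]) = 0" by (intro ext) (simp add: d_eq_0)
  ultimately show ?thesis by (simp add: cocycles_def)
qed

lemma pull_basis:
  assumes f: "cohom_map r s f" and p: "Field r = {p}" and q: "Field s = {q}"
  shows "pull r s f 0 (basis [q]) = basis [p]"
proof (rule cochains_eqI)
  have r: "fin_poset r" "fin_poset s" "poset_hom r s f" using f by (simp_all add: cohom_map_def)
  note bq = cocycles_cochains[OF basis_cocycle[OF r(2) q, of Plain]]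
  show "pull r s f 0 (basis [q]) \<in> cochains Plain r 0" by (rule pull_cochains[OF f bq])
  show "basis [p] \<in> cochains Plain r 0" by (rule cocycles_cochains[OF basis_cocycle[OF r(1) p]])
  fix xs assume xs: "xs \<in> wchains r 0"
  then have "xs = [p]" by (auto simp: wchains_def p length_Suc_conv)
  moreover have "f p = q" using r(3) p q by (auto simp: poset_hom_def)
  ultimately show "pull r s f 0 (basis [q]) xs = basis [p] xs"
    unfolding pull_wchain[OF r(1,2) bq xs] by (simp add: basis_def)
qed

section \<open>The structures on cohomology and their morphisms\<close>

lemma h_operad_simps [simp]:
  "gcarrier (h_operad K P) S n = cohomology Plain (pos P S) n"
  "gunit (h_operad K P) s = coclass Plain (pos P {s}) 0 (basis [the_elem (Field (pos P {s}))])"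
  "gcomp (h_operad K P) = rho Plain P"
  by (simp_all add: h_operad_def h_species_def gspecies.defs goperad.defs)

lemma h_check_module_simps [simp]:
  "gcarrier (h_check_module K P) S n = cohomology Check (pos P S) n"
  "lcomp (h_check_module K P) = rho Check P"
  by (simp_all add: h_check_module_def h_species_def gspecies.defs gleft_module.defs)

lemma h_hat_module_simps [simp]:
  "gcarrier (h_hat_module K P) S n = cohomology Hat (pos P S) n"
  "rcomp (h_hat_module K P) = rho Hat P"
  by (simp_all add: h_hat_module_def h_species_def gspecies.defs gright_module.defs)

lemma gspecies_morphism_truncate:
  "gspecies_morphism (h_species Plain K Q) (h_species Plain K P) F \<Longrightarrow> gspecies_morphism (h_operad K Q) (h_operad K P) F"
  "gspecies_morphism (h_species Check K Q) (h_species Check K P) F \<Longrightarrow> gspecies_morphism (h_check_module K Q) (h_check_module K P) F"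
  "gspecies_morphism (h_species Hat K Q) (h_species Hat K P) F \<Longrightarrow> gspecies_morphism (h_hat_module K Q) (h_hat_module K P) F"
  by (simp_all add: gspecies_morphism_def h_operad_def h_check_module_def h_hat_module_def h_species_def
      gspecies.defs goperad.defs gleft_module.defs gright_module.defs)

lemma pullback_gspecies_morphism:
  fixes K :: "'k::{comm_ring,comm_monoid_mult} itself"
  assumes P: "operadic_poset_species P" and Q: "operadic_poset_species Q" and f: "ops_morphism P Q f"
  shows "gspecies_morphism (h_species v K Q) (h_species v K P) (pullback v P Q f)"
proof -
  have "pullback v P Q f S n \<in> cohomology v (pos Q S) n \<rightarrow> (cohomology v (pos P S) n :: ('b list \<Rightarrow> 'k) set set)"
    if S: "fin_set S" for S n
    unfolding pullback_def using hpull_cohomology[OF cohom_map_morphism[OF P Q f S]] by blast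
  moreover have "pullback v P Q f S n (hadd v (pos Q S) n A B) =
      hadd v (pos P S) n (pullback v P Q f S n A) (pullback v P Q f S n B)"
    if S: "fin_set S" and A: "A \<in> cohomology v (pos Q S) n" and B: "B \<in> cohomology v (pos Q S) n"
    for S n and A B :: "('c list \<Rightarrow> 'k) set"
  proof -
    note pc = pull_cocycles[OF cohom_map_morphism[OF P Q f S]]
    obtain F where F: "F \<in> cocycles v (pos Q S) n" "A = coclass v (pos Q S) n F" using A by (rule cohomologyE)
    obtain G where G: "G \<in> cocycles v (pos Q S) n" "B = coclass v (pos Q S) n G" using B by (rule cohomologyE)
    show ?thesis
      unfolding F(2) G(2) hadd_coclass[OF F(1) G(1)] pullback_coclass[OF P Q f S cocycles_add[OF F(1) G(1)]]
        pullback_coclass[OF P Q f S F(1)] pullback_coclass[OF P Q f S G(1)] hadd_coclass[OF pc[OF F(1)] pc[OF G(1)]]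
      by (simp only: pull_add)
  qed
  moreover have "pullback v P Q f S n (hsmult v (pos Q S) n c A) = hsmult v (pos P S) n c (pullback v P Q f S n A)"
    if S: "fin_set S" and A: "A \<in> cohomology v (pos Q S) n" for S n and c :: 'k and A :: "('c list \<Rightarrow> 'k) set"
  proof -
    note pc = pull_cocycles[OF cohom_map_morphism[OF P Q f S]]
    obtain F where F: "F \<in> cocycles v (pos Q S) n" "A = coclass v (pos Q S) n F" using A by (rule cohomologyE)
    show ?thesis
      unfolding F(2) hsmult_coclass[OF F(1)] pullback_coclass[OF P Q f S cocycles_smult[OF F(1)]]
        pullback_coclass[OF P Q f S F(1)] hsmult_coclass[OF pc[OF F(1)]]
      by (simp only: pull_smult)
  qed
  moreover have "pullback v P Q f (g ` S) n (hpull v (pos Q (g ` S)) (pos Q S) (act Q (g ` S) (inv_into S g)) n A) =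
      hpull v (pos P (g ` S)) (pos P S) (act P (g ` S) (inv_into S g)) n (pullback v P Q f S n A)"
    if S: "fin_set S" and g: "inj_on g S" and A: "A \<in> cohomology v (pos Q S) n"
    for S g n and A :: "('c list \<Rightarrow> 'k) set"
  proof -
    let ?i = "inv_into S g"
    have gS: "fin_set (g ` S)" using S by (simp add: fin_set_def)
    have im: "?i ` g ` S = S" using g by (simp add: inv_into_image_cancel)
    have i: "inj_on ?i (g ` S)" by (simp add: inj_on_inv_into)
    have aP: "cohom_map (pos P (g ` S)) (pos P S) (act P (g ` S) ?i)"
      using cohom_map_act[OF P gS i] by (simp only: im)
    have aQ: "cohom_map (pos Q (g ` S)) (pos Q S) (act Q (g ` S) ?i)"
      using cohom_map_act[OF Q gS i] by (simp only: im)
    \<comment> \<open>Both ways around the square are pullbacks along composites by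
      \<open>hpull_comp\<close>; it remains to compare the underlying maps, which is naturality of
      \<open>f\<close> for the inverse bijection.\<close>
    have "(act Q (g ` S) ?i \<circ> f (g ` S)) x = (f S \<circ> act P (g ` S) ?i) x" if "x \<in> Field (pos P (g ` S))" for x
      using morphism_at(2)[OF P Q f gS i that] unfolding im by simp
    then show ?thesis
      unfolding pullback_def hpull_comp[OF cohom_map_morphism[OF P Q f gS] aQ A]
        hpull_comp[OF aP cohom_map_morphism[OF P Q f S] A] by (rule hpull_cong)
  qed
  ultimately show ?thesis
    unfolding gspecies_morphism_def h_species_def by simp
qed

lemma enumerates_partitionD: "enumerates_partition S Ts \<Longrightarrow> set Ts \<in> Parts S"
  by (simp add: enumerates_partition_def)

lemma pullback_goperad_morphism:
  fixes K :: "'k::{comm_ring,comm_monoid_mult} itself"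
  assumes P: "operadic_poset_species P" and Q: "operadic_poset_species Q" and f: "ops_morphism P Q f"
  shows "goperad_morphism (h_operad K Q) (h_operad K P) (pullback Plain P Q f)"
  unfolding goperad_morphism_def
proof (intro conjI allI impI gspecies_morphism_truncate pullback_gspecies_morphism P Q f)
  fix s :: "'a pt"
  have S: "fin_set {s}" by (simp add: fin_set_def)
  \<comment> \<open>By unitality both posets have one point, so the units are the classes of their
    unique chains.\<close>
  have "is_singleton (Field (pos P {s}))" "is_singleton (Field (pos Q {s}))"
    using P Q by (simp_all add: operadic_poset_species_def unitality_def)
  then obtain p q where p: "Field (pos P {s}) = {p}" and q: "Field (pos Q {s}) = {q}"
    by (auto simp: is_singleton_def)
  show "pullback Plain P Q f {s} 0 (gunit (h_operad K Q) s) = gunit (h_operad K P) s"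
    unfolding h_operad_simps p q the_elem_eq
      pullback_coclass[OF P Q f S basis_cocycle[OF species_fin_poset[OF Q S] q]]
      pull_basis[OF cohom_map_morphism[OF P Q f S] p q] by (rule refl)
next
  fix S :: "'a pt set" and Ts m A ns Bs
  assume *: "fin_set S \<and> enumerates_partition S Ts \<and> A \<in> gcarrier (h_operad K Q) (set Ts) m \<and>
    tensor_factors (h_operad K Q) Ts ns Bs"
  show "pullback Plain P Q f S (m + sum_list ns) (gcomp (h_operad K Q) S Ts m A ns Bs) =
    gcomp (h_operad K P) S Ts m (pullback Plain P Q f (set Ts) m A) ns (map_factors (pullback Plain P Q f) Ts ns Bs)"
    unfolding h_operad_simps
    by (rule pullback_rho[OF P Q f]) (use * in \<open>simp_all add: enumerates_partitionD tensor_factors_def rho_variants_def\<close>)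
qed

theorem mainTheorem4:
  fixes P :: "('a, 'p) ops_data" and Q :: "('a, 'q) ops_data" and f :: "'a pt set \<Rightarrow> 'p \<Rightarrow> 'q"
    and K :: "'k::{comm_ring,comm_monoid_mult} itself"
  assumes "operadic_poset_species P" and "operadic_poset_species Q" and "ops_morphism P Q f"
  shows "goperad_morphism (h_operad K Q) (h_operad K P) (pullback Plain P Q f) \<and>
    gleft_module_morphism (h_operad K Q) (h_operad K P) (pullback Plain P Q f)
      (h_check_module K Q) (h_check_module K P) (pullback Check P Q f) \<and>
    gright_module_morphism (h_operad K Q) (h_operad K P) (pullback Plain P Q f)
      (h_hat_module K Q) (h_hat_module K P) (pullback Hat P Q f) \<and>
    (\<forall>v S n. fin_set S \<longrightarrow>
      (\<forall>A \<in> gcarrier (h_species v K P) S n. pullback v P P (\<lambda>_. id) S n A = A) \<and>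
      (\<forall>(R :: ('a, 'r) ops_data) g. operadic_poset_species R \<and> ops_morphism Q R g \<longrightarrow>
        (\<forall>A \<in> gcarrier (h_species v K R) S n.
          pullback v P R (\<lambda>S. g S \<circ> f S) S n A = pullback v P Q f S n (pullback v Q R g S n A))))"
proof (intro conjI allI impI ballI)
  note op = pullback_goperad_morphism[OF assms, of K]
  note sp = gspecies_morphism_truncate[OF pullback_gspecies_morphism[OF assms]]
  note rho = pullback_rho[OF assms]
  show "goperad_morphism (h_operad K Q) (h_operad K P) (pullback Plain P Q f)" by (rule op)
  show "gleft_module_morphism (h_operad K Q) (h_operad K P) (pullback Plain P Q f)
      (h_check_module K Q) (h_check_module K P) (pullback Check P Q f)"
    unfolding gleft_module_morphism_def
  proof (intro conjI allI impI op sp)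
    fix S :: "'a pt set" and Ts m A ns Bs
    assume *: "fin_set S \<and> enumerates_partition S Ts \<and> A \<in> gcarrier (h_operad K Q) (set Ts) m \<and>
      tensor_factors (h_check_module K Q) Ts ns Bs"
    show "pullback Check P Q f S (m + sum_list ns) (lcomp (h_check_module K Q) S Ts m A ns Bs) =
      lcomp (h_check_module K P) S Ts m (pullback Plain P Q f (set Ts) m A) ns (map_factors (pullback Check P Q f) Ts ns Bs)"
      unfolding h_check_module_simps
      by (rule rho) (use * in \<open>simp_all add: enumerates_partitionD tensor_factors_def rho_variants_def\<close>)
  qed
  show "gright_module_morphism (h_operad K Q) (h_operad K P) (pullback Plain P Q f)
      (h_hat_module K Q) (h_hat_module K P) (pullback Hat P Q f)"
    unfolding gright_module_morphism_def
  proof (intro conjI allI impI op sp)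
    fix S :: "'a pt set" and Ts m A ns Bs
    assume *: "fin_set S \<and> enumerates_partition S Ts \<and> A \<in> gcarrier (h_hat_module K Q) (set Ts) m \<and>
      tensor_factors (h_operad K Q) Ts ns Bs"
    show "pullback Hat P Q f S (m + sum_list ns) (rcomp (h_hat_module K Q) S Ts m A ns Bs) =
      rcomp (h_hat_module K P) S Ts m (pullback Hat P Q f (set Ts) m A) ns (map_factors (pullback Plain P Q f) Ts ns Bs)"
      unfolding h_hat_module_simps
      by (rule rho) (use * in \<open>simp_all add: enumerates_partitionD tensor_factors_def rho_variants_def\<close>)
  qed
next
  fix v S n A
  assume S: "fin_set S" and A: "A \<in> gcarrier (h_species v K P) S n"
  have r: "fin_poset (pos P S)" by (rule species_fin_poset[OF assms(1) S])
  have id: "cohom_map (pos P S) (pos P S) id"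
    by (rule cohom_map_iso[OF r r, of id id]) (simp_all add: poset_hom_def)
  obtain F where F: "F \<in> cocycles v (pos P S) n" "A = coclass v (pos P S) n F"
    using A by (auto simp: h_species_def elim: cohomologyE)
  show "pullback v P P (\<lambda>_. id) S n A = A"
    unfolding pullback_def F(2) hpull_coclass[OF id F(1)] pull_id[OF r cocycles_cochains[OF F(1)]] by (rule refl)
next
  fix v S n A and R :: "('a, 'r) ops_data" and g
  assume S: "fin_set S" and R: "operadic_poset_species R \<and> ops_morphism Q R g"
    and A: "A \<in> gcarrier (h_species v K R) S n"
  \<comment> \<open>The law for composites holds for each \<open>S\<close> separately; of the two
    maps \<open>hpull_comp\<close> asks only \<open>cohom_map\<close>.\<close>
  have "cohom_map (pos Q S) (pos R S) (g S)" using cohom_map_morphism[OF assms(2)] R S by blast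
  moreover have "A \<in> cohomology v (pos R S) n" using A by (simp add: h_species_def)
  ultimately show "pullback v P R (\<lambda>S. g S \<circ> f S) S n A = pullback v P Q f S n (pullback v Q R g S n A)"
    unfolding pullback_def by (rule hpull_comp[OF cohom_map_morphism[OF assms S], symmetric])
qed

end
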